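(* Let $\bar A=(A_0,A_1)$ be a compatible couple of (quasi-)Banach spaces with $A_0\cap A_1\neq\{0\}$. Let $0<q_1,r_1\le\infty$ and $a_1,b_1\in SV$ be such that $\|s^{-1/r_1}b_1(s)\|_{r_1,(1,\infty)}<\infty$ and $\left\|s^{-1/r_1}b_1(s)\|u^{-1/q_1}a_1(u)\|_{q_1,(0,s)}\right\|_{r_1,(0,1)}<\infty$, and put $$\chi_1(t)=\left\|s^{-1/r_1}b_1(s)\|u^{-1/q_1}a_1(u)\|_{q_1,(0,s)}\right\|_{r_1,(0,t)}+\|s^{-1/r_1}b_1(s)\|_{r_1,(t,\infty)}\|u^{-1/q_1}a_1(u)\|_{q_1,(0,t)}.$$ Let $0<r,r_0,q_0\le\infty$, $a,a_0,b_0\in SV$, $\|s^{-1/r_0}b_0(s)\|_{r_0,(0,1)}<\infty$, and $\left\|s^{-1/r_0}b_0(s)\|u^{-1/q_0}a_0(u)\|_{q_0,(s,\infty)}\right\|_{r_0,(1,\infty)}<\infty$. Put $$\chi_0(t)=\left\|s^{-1/r_0}b_0(s)\|u^{-1/q_0}a_0(u)\|_{q_0,(s,\infty)}\right\|_{r_0,(t,\infty)}+\|s^{-1/r_0}b_0(s)\|_{r_0,(0,t)}\|u^{-1/q_0}a_0(u)\|_{q_0,(t,\infty)}$$ and $\rho(t)=t\frac{\chi_0(t)}{\chi_1(t)}$. For given $0\le\theta\le1$ denote $a^{\#}=\chi_0^{1-\theta}\chi_1^{\theta}\,(a\circ\rho)$. (i) If $0<\theta<1$, then $\left(\bar A^{\mathcal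 R}_{0,r_0,b_0,q_0,a_0},\bar A^{\mathcal L}_{1,r_1,b_1,q_1,a_1}\right)_{\theta,r,a}=\bar A_{\theta,r,a^{\#}}$. (ii) If $\|s^{-1/r}a(s)\|_{r,(1,\infty)}<\infty$, then, with $\theta=0$ (i.e. $a^{\#}=\chi_0\,(a\circ\rho)$), $\left(\bar A^{\mathcal R}_{0,r_0,b_0,q_0,a_0},\bar A^{\mathcal L}_{1,r_1,b_1,q_1,a_1}\right)_{0,r,a}=\bar A_{0,r,a^{\#}}\cap\bar A^{\mathcal R,\mathcal L}_{0,r,a\circ\rho,r_0,b_0,q_0,a_0}$. (iii) If $\|s^{-1/r}a(s)\|_{r,(0,1)}<\infty$, then, with $\theta=1$ (i.e. $a^{\#}=\chi_1\,(a\circ\rho)$), $\left(\bar A^{\mathcal R}_{0,r_0,b_0,q_0,a_0},\bar A^{\mathcal L}_{1,r_1,b_1,q_1,a_1}\right)_{1,r,a}=\bar A_{1,r,a^{\#}}\cap\bar A^{\mathcal L,\mathcal R}_{1,r,a\circ\rho,r_1,b_1,q_1,a_1}$.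
   Context: Conventions: $1/\infty=0$; $\|\cdot\|_{q,(a,b)}$ is the usual (quasi-)norm of $L_q$ on the interval $(a,b)$, $0<q\le\infty$. Two positive functions satisfy $f\approx g$ (are equivalent) if $C^{-1}g\le f\le Cg$ for some constant $C>0$ independent of all significant quantities. $b\in SV$ (slowly varying) means that $b$ is a positive Lebesgue measurable function on $(0,\infty)$ such that for each $\varepsilon>0$ the function $t^{\varepsilon}b(t)$ is equivalent to an increasing function and $t^{-\varepsilon}b(t)$ is equivalent to a decreasing function. For a compatible couple $(X_0,X_1)$ of (quasi-)normed spaces, $K(t,f;X_0,X_1)=\inf\{\|f_0\|_{X_0}+t\|f_1\|_{X_1}: f=f_0+f_1,\ f_i\in X_i\}$ for $f\in X_0+X_1$, $t>0$; $K(t,f):=K(t,f;A_0,A_1)$. For $0\le\theta\le1$, $0<q\le\infty$, $b\in SV$, $(X_0,X_1)_{\theta,q,b}$ is the space of all $f\in X_0+X_1$ with finite (quasi-)norm $\|u^{-\theta-1/q}b(u)K(u,f;X_0,X_1)\|_{q,(0,\infty)}$, and $\bar A_{\theta,q,b}:=(A_0,A_1)_{\theta,q,b}$. For $0<p,r,q\le\infty$ and $a,b,c\in SV$, the following are the spaces of all $f\in A_0+A_1$ with finite (quasi-)norm: - $\bar A^{\mathcal L}_{\theta,r,b,q,a}$: $\left\|t^{-1/r}b(t)\|u^{-\theta-1/q}a(u)K(u,f)\|_{q,(0,t)}\right\|_{r,(0,\infty)}$; - $\bar A^{\mathcal R}_{\theta,r,b,q,a}$: $\left\|t^{-1/r}b(t)\|u^{-\theta-1/q}a(u)K(u,f)\|_{q,(t,\infty)}\right\|_{r,(0,\infty)}$;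 - $\bar A^{\mathcal R,\mathcal L}_{\theta,p,c,r,b,q,a}$: $\left\|t^{-1/p}c(t)\left\|u^{-1/r}b(u)\|v^{-\theta-1/q}a(v)K(v,f)\|_{q,(u,t)}\right\|_{r,(0,t)}\right\|_{p,(0,\infty)}$; - $\bar A^{\mathcal L,\mathcal R}_{\theta,p,c,r,b,q,a}$: $\left\|t^{-1/p}c(t)\left\|u^{-1/r}b(u)\|v^{-\theta-1/q}a(v)K(v,f)\|_{q,(t,u)}\right\|_{r,(t,\infty)}\right\|_{p,(0,\infty)}$. Equality of (quasi-)normed spaces means that each is continuously embedded in the other; intersections carry the maximum (equivalently, the sum) of the (quasi-)norms. Standing assumption: none of the spaces under consideration is $\{0\}$. *)

theory Defs
  imports "HOL-Analysis.Analysis"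
begin

section \<open>Quasi-normed spaces and compatible couples\<close>

class hausdorff_tvs = real_vector + t2_space + topological_ab_group_add +
  assumes tendsto_scaleR_Pair: "LIM x (nhds c \<times>\<^sub>F nhds v). fst x *\<^sub>R snd x :> nhds (c *\<^sub>R v)"

text \<open>A space is a subset of the ambient vector space with a functional that is only relevant on
  this subset. Complex spaces are covered by restricting the scalars: no notion below other than
  the vector space structure itself refers to the scalar field.\<close>

record 'a qspace =
  carr :: "'a set"
  qnrm :: "'a \<Rightarrow> real"

definition quasi_normed :: "'a::real_vector qspace \<Rightarrow> bool" where
  "quasi_normed X \<longleftrightarrow>
     subspace (carr X) \<and>
     (\<forall>x\<in>carr X. 0 \<le> qnrm X x \<and> (qnrm X x = 0 \<longleftrightarrow> x = 0)) \<and>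
     (\<forall>x\<in>carr X. \<forall>c. qnrm X (c *\<^sub>R x) = \<bar>c\<bar> * qnrm X x) \<and>
     (\<exists>C\<ge>1. \<forall>x\<in>carr X. \<forall>y\<in>carr X. qnrm X (x + y) \<le> C * (qnrm X x + qnrm X y))"

definition quasi_banach :: "'a::real_vector qspace \<Rightarrow> bool" where
  "quasi_banach X \<longleftrightarrow>
     quasi_normed X \<and>
     (\<forall>x :: nat \<Rightarrow> 'a. (\<forall>n. x n \<in> carr X) \<longrightarrow>
        (\<forall>e>0. \<exists>N. \<forall>m\<ge>N. \<forall>n\<ge>N. qnrm X (x m - x n) < e) \<longrightarrow>
        (\<exists>l\<in>carr X. (\<lambda>n. qnrm X (x n - l)) \<longlonglongrightarrow> 0))"

text \<open>Continuity at the origin suffices, as the inclusion map is linear.\<close>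

definition embedded_in_ambient :: "'a::hausdorff_tvs qspace \<Rightarrow> bool" where
  "embedded_in_ambient X \<longleftrightarrow>
     (\<forall>U. open U \<and> 0 \<in> U \<longrightarrow> (\<exists>d>0. \<forall>x\<in>carr X. qnrm X x < d \<longrightarrow> x \<in> U))"

definition compatible_couple :: "'a::hausdorff_tvs qspace \<Rightarrow> 'a qspace \<Rightarrow> bool" where
  "compatible_couple X0 X1 \<longleftrightarrow> embedded_in_ambient X0 \<and> embedded_in_ambient X1"

definition embedded :: "'a qspace \<Rightarrow> 'a qspace \<Rightarrow> bool" where
  "embedded X Y \<longleftrightarrow>
     carr X \<subseteq> carr Y \<and> (\<exists>C>0. \<forall>f\<in>carr X. qnrm Y f \<le> C * qnrm X f)"

definition same_space :: "'a qspace \<Rightarrow> 'a qspace \<Rightarrow> bool" where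
  "same_space X Y \<longleftrightarrow> embedded X Y \<and> embedded Y X"

definition inter_space :: "'a qspace \<Rightarrow> 'a qspace \<Rightarrow> 'a qspace" where
  "inter_space X Y = \<lparr>carr = carr X \<inter> carr Y, qnrm = (\<lambda>f. max (qnrm X f) (qnrm Y f))\<rparr>"

definition sum_carr :: "'a::plus qspace \<Rightarrow> 'a qspace \<Rightarrow> 'a set" where
  "sum_carr X0 X1 = {f0 + f1 | f0 f1. f0 \<in> carr X0 \<and> f1 \<in> carr X1}"

definition finite_part :: "'a set \<Rightarrow> ('a \<Rightarrow> ennreal) \<Rightarrow> 'a qspace" where
  "finite_part S N = \<lparr>carr = {f \<in> S. N f < \<infinity>}, qnrm = (\<lambda>f. enn2real (N f))\<rparr>"


section \<open>Lebesgue quasi-norms and slowly varying functions\<close>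

definition ennpow :: "ennreal \<Rightarrow> real \<Rightarrow> ennreal" where
  "ennpow x p = (if x = \<infinity> then \<infinity> else ennreal (enn2real x powr p))"

text \<open>Exponents range over \<open>(0, \<infinity>]\<close> and are of type \<^typ>\<open>ennreal\<close>; \<open>recip \<infinity> = 0\<close>.\<close>

definition recip :: "ennreal \<Rightarrow> real" where
  "recip q = enn2real (1 / q)"

text \<open>The functions are \<open>[0,\<infinity>]\<close>-valued because quasi-norms over subintervals occur nested and may
  be infinite. The essential supremum is spelled out so that it is monotone and homogeneous
  without any measurability assumption, as the lower integral \<open>\<integral>\<^sup>+\<close> is: for a slowly varying \<open>a\<close>,
  the weight \<open>a \<circ> \<rho>\<close> need only be equivalent to a measurable function.\<close>

definition Lq :: "ennreal \<Rightarrow> real set \<Rightarrow> (real \<Rightarrow> ennreal) \<Rightarrow> ennreal" where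
  "Lq q S g =
     (if q = \<infinity> then Inf {z. AE x in lebesgue_on S. g x \<le> z}
      else ennpow (\<integral>\<^sup>+ x. ennpow (g x) (enn2real q) \<partial>lebesgue_on S) (recip q))"

definition equiv_pos :: "(real \<Rightarrow> real) \<Rightarrow> (real \<Rightarrow> real) \<Rightarrow> bool" where
  "equiv_pos f g \<longleftrightarrow> (\<exists>C>0. \<forall>t>0. inverse C * g t \<le> f t \<and> f t \<le> C * g t)"

definition SV :: "(real \<Rightarrow> real) set" where
  "SV = {b. (\<forall>t>0. 0 < b t) \<and> b \<in> borel_measurable (lebesgue_on {0<..}) \<and>
     (\<forall>e>0. (\<exists>g. (\<forall>t>0. 0 < g t) \<and> mono_on {0<..} g \<and> equiv_pos (\<lambda>t. t powr e * b t) g) \<and>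
            (\<exists>g. (\<forall>t>0. 0 < g t) \<and> antimono_on {0<..} g \<and> equiv_pos (\<lambda>t. t powr (- e) * b t) g))}"

definition wt :: "ennreal \<Rightarrow> (real \<Rightarrow> real) \<Rightarrow> real \<Rightarrow> ennreal" where
  "wt q b t = ennreal (t powr (- recip q) * b t)"


section \<open>Interpolation spaces\<close>

definition K_fun :: "'a::plus qspace \<Rightarrow> 'a qspace \<Rightarrow> real \<Rightarrow> 'a \<Rightarrow> real" where
  "K_fun X0 X1 t f =
     Inf {qnrm X0 f0 + t * qnrm X1 f1 | f0 f1. f0 \<in> carr X0 \<and> f1 \<in> carr X1 \<and> f = f0 + f1}"

definition K_wt ::
  "'a::plus qspace \<Rightarrow> 'a qspace \<Rightarrow> real \<Rightarrow> ennreal \<Rightarrow> (real \<Rightarrow> real) \<Rightarrow> 'a \<Rightarrow> real \<Rightarrow> ennreal" where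
  "K_wt X0 X1 \<theta> q a f u = ennreal (u powr (- \<theta> - recip q) * a u * K_fun X0 X1 u f)"

definition interp_space ::
  "'a::plus qspace \<Rightarrow> 'a qspace \<Rightarrow> real \<Rightarrow> ennreal \<Rightarrow> (real \<Rightarrow> real) \<Rightarrow> 'a qspace" where
  "interp_space X0 X1 \<theta> q b = finite_part (sum_carr X0 X1) (\<lambda>f. Lq q {0<..} (K_wt X0 X1 \<theta> q b f))"

definition L_space ::
  "'a::plus qspace \<Rightarrow> 'a qspace \<Rightarrow> real \<Rightarrow> ennreal \<Rightarrow> (real \<Rightarrow> real) \<Rightarrow>
   ennreal \<Rightarrow> (real \<Rightarrow> real) \<Rightarrow> 'a qspace" where
  "L_space A0 A1 \<theta> r b q a = finite_part (sum_carr A0 A1)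
     (\<lambda>f. Lq r {0<..} (\<lambda>t. wt r b t * Lq q {0<..<t} (K_wt A0 A1 \<theta> q a f)))"

definition R_space ::
  "'a::plus qspace \<Rightarrow> 'a qspace \<Rightarrow> real \<Rightarrow> ennreal \<Rightarrow> (real \<Rightarrow> real) \<Rightarrow>
   ennreal \<Rightarrow> (real \<Rightarrow> real) \<Rightarrow> 'a qspace" where
  "R_space A0 A1 \<theta> r b q a = finite_part (sum_carr A0 A1)
     (\<lambda>f. Lq r {0<..} (\<lambda>t. wt r b t * Lq q {t<..} (K_wt A0 A1 \<theta> q a f)))"

definition RL_space ::
  "'a::plus qspace \<Rightarrow> 'a qspace \<Rightarrow> real \<Rightarrow> ennreal \<Rightarrow> (real \<Rightarrow> real) \<Rightarrow>
   ennreal \<Rightarrow> (real \<Rightarrow> real) \<Rightarrow> ennreal \<Rightarrow> (real \<Rightarrow> real) \<Rightarrow> 'a qspace" where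
  "RL_space A0 A1 \<theta> p c r b q a = finite_part (sum_carr A0 A1)
     (\<lambda>f. Lq p {0<..} (\<lambda>t. wt p c t *
            Lq r {0<..<t} (\<lambda>u. wt r b u * Lq q {u<..<t} (K_wt A0 A1 \<theta> q a f))))"

definition LR_space ::
  "'a::plus qspace \<Rightarrow> 'a qspace \<Rightarrow> real \<Rightarrow> ennreal \<Rightarrow> (real \<Rightarrow> real) \<Rightarrow>
   ennreal \<Rightarrow> (real \<Rightarrow> real) \<Rightarrow> ennreal \<Rightarrow> (real \<Rightarrow> real) \<Rightarrow> 'a qspace" where
  "LR_space A0 A1 \<theta> p c r b q a = finite_part (sum_carr A0 A1)
     (\<lambda>f. Lq p {0<..} (\<lambda>t. wt p c t *
            Lq r {t<..} (\<lambda>u. wt r b u * Lq q {t<..<u} (K_wt A0 A1 \<theta> q a f))))"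


section \<open>The functions \<open>\<chi>\<^sub>0\<close>, \<open>\<chi>\<^sub>1\<close>, \<open>\<rho>\<close> and \<open>a\<^sup>#\<close>\<close>

definition chi1 ::
  "ennreal \<Rightarrow> (real \<Rightarrow> real) \<Rightarrow> ennreal \<Rightarrow> (real \<Rightarrow> real) \<Rightarrow> real \<Rightarrow> ennreal" where
  "chi1 r1 b1 q1 a1 t =
     Lq r1 {0<..<t} (\<lambda>s. wt r1 b1 s * Lq q1 {0<..<s} (wt q1 a1)) +
     Lq r1 {t<..} (wt r1 b1) * Lq q1 {0<..<t} (wt q1 a1)"

definition chi0 ::
  "ennreal \<Rightarrow> (real \<Rightarrow> real) \<Rightarrow> ennreal \<Rightarrow> (real \<Rightarrow> real) \<Rightarrow> real \<Rightarrow> ennreal" where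
  "chi0 r0 b0 q0 a0 t =
     Lq r0 {t<..} (\<lambda>s. wt r0 b0 s * Lq q0 {s<..} (wt q0 a0)) +
     Lq r0 {0<..<t} (wt r0 b0) * Lq q0 {t<..} (wt q0 a0)"

text \<open>In the following two definitions \<open>X0\<close> and \<open>X1\<close> stand for \<open>\<chi>\<^sub>0\<close> and \<open>\<chi>\<^sub>1\<close>. The conversion to
  real numbers loses nothing, because the conditions imposed on the weights make \<open>\<chi>\<^sub>0\<close> and \<open>\<chi>\<^sub>1\<close>
  finite and positive on \<open>(0,\<infinity>)\<close>.\<close>

definition rho :: "(real \<Rightarrow> ennreal) \<Rightarrow> (real \<Rightarrow> ennreal) \<Rightarrow> real \<Rightarrow> real" where
  "rho X0 X1 t = t * (enn2real (X0 t) / enn2real (X1 t))"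

definition a_sharp ::
  "(real \<Rightarrow> ennreal) \<Rightarrow> (real \<Rightarrow> ennreal) \<Rightarrow> (real \<Rightarrow> real) \<Rightarrow> real \<Rightarrow> real \<Rightarrow> real" where
  "a_sharp X0 X1 a \<theta> t =
     enn2real (X0 t) powr (1 - \<theta>) * enn2real (X1 t) powr \<theta> * a (rho X0 X1 t)"

end

theory Submission
  imports Defs
begin

text \<open>Sampling at the points \<open>exp k\<close>, \<open>k \<in> \<int>\<close>, turns every weighted Lebesgue quasi-norm of the
  statement into a weighted \<open>\<ell>\<^sub>q\<close> quasi-norm of sequences, because slowly varying weights and
  K-functionals change only by bounded factors between neighbouring samples. Write \<open>k\<^sub>n = K (e\<^sup>n, f)\<close>,
  let \<open>N\<^sub>0\<close>, \<open>N\<^sub>1\<close> be the sequence quasi-norms with \<open>\<parallel>f\<parallel>\<^bsub>X0\<^esub> \<approx> N\<^sub>0 (k\<^sub>n)\<close> and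
  \<open>\<parallel>f\<parallel>\<^bsub>X1\<^esub> \<approx> N\<^sub>1 (e\<^bsup>-n\<^esup> k\<^sub>n)\<close>, and let \<open>1\<^bsub>\<le>n\<^esub>\<close>, \<open>1\<^bsub>\<ge>n\<^esub>\<close> be the indicator sequences. Then
  \<open>\<chi>\<^sub>0 (e\<^sup>n) \<approx> N\<^sub>0 (1\<^bsub>\<ge>n\<^esub>)\<close> and \<open>\<chi>\<^sub>1 (e\<^sup>n) \<approx> N\<^sub>1 (1\<^bsub>\<le>n\<^esub>)\<close>, both are slowly varying, and \<open>N\<^sub>0\<close> of a sequence
  decaying geometrically to the left of \<open>n\<close> is at most a multiple of \<open>\<chi>\<^sub>0 (e\<^sup>n)\<close>. This yields the
  Holmstedt formula
  \<open>K (\<rho> (e\<^sup>n), f; X0, X1) \<approx> N\<^sub>0 (k 1\<^bsub>\<le>n\<^esub>) + \<chi>\<^sub>0 (e\<^sup>n) k\<^sub>n + \<rho> (e\<^sup>n) N\<^sub>1 (e\<^bsup>-j\<^esup> k\<^sub>j 1\<^bsub>\<ge>n\<^esub>)\<close>.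
  Insert it into the norm of \<open>(X0, X1)\<^bsub>\<theta>,r,a\<^esub>\<close> sampled at \<open>\<rho> (e\<^sup>n)\<close>. The middle term gives the norm
  with weight \<open>a\<^sup>#\<close>; a Hardy inequality absorbs the first term if \<open>\<theta> > 0\<close> and the last one if
  \<open>\<theta> < 1\<close>; the term that survives at an endpoint is the \<open>\<R>,\<L>\<close>- or \<open>\<L>,\<R>\<close>-norm.\<close>

section \<open>Sequence quasi-norms\<close>

text \<open>Every estimate is therefore brought down to a pointwise majorant that decays
  geometrically away from n: a fraction of the decay rate pays for each slowly varying factor, and
  what is left is summable in every l_q. This is why the quasi-norms are accessed only through a few
  properties, chiefly their values on tails and on geometric sequences. The function \<rho> is made
  so that both pieces of a decomposition produce the same middle term: \<rho>(e^n)
  \<open>\<chi>\<^sub>1\<close>(e^n) e^(-n) k_n = \<open>\<chi>\<^sub>0\<close>(e^n) k_n. The lower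
  half of the Holmstedt formula has to control cross terms, such as the low part of the piece lying
  in X1, measured in the quasi-norm of X0. Here K(t,f)/t is nonincreasing and K(t,f) nondecreasing:
  the norm of a monotone sequence bounds each of its entries, and the factor e^j between the two
  normalisations of K beats the slow variation.\<close>

lemma ennpow_real: "0 \<le> x \<Longrightarrow> ennpow (ennreal x) p = ennreal (x powr p)"
  by (simp add: ennpow_def)

lemma ennpow_top [simp]: "ennpow \<infinity> p = \<infinity>" "ennpow top p = top"
  by (simp_all add: ennpow_def)

lemma ennpow_0 [simp]: "ennpow 0 p = 0"
  by (simp add: ennpow_def)

lemma ennpow_1 [simp]: "ennpow x 1 = x"
  by (cases x) (auto simp: ennpow_def)

lemma ennpow_mono: "x \<le> y \<Longrightarrow> 0 \<le> p \<Longrightarrow> ennpow x p \<le> ennpow y p"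
  by (cases x; cases y) (auto simp: ennpow_def powr_mono2 top_unique intro!: ennreal_leI)

lemma ennpow_cmult: "0 \<le> c \<Longrightarrow> 0 < p \<Longrightarrow> ennpow (ennreal c * x) p = ennreal (c powr p) * ennpow x p"
  by (cases x; cases "c = 0")
     (auto simp: ennpow_real powr_mult ennreal_mult[symmetric] ennreal_mult_top
       simp flip: ennreal_mult'')

lemma ennpow_ennpow: "0 < p \<Longrightarrow> 0 < p' \<Longrightarrow> ennpow (ennpow x p) p' = ennpow x (p * p')"
  by (cases x) (auto simp: ennpow_real powr_powr)

lemma ennpow_inverse:
  assumes "0 < p" shows "ennpow (ennpow x p) (1 / p) = x" "ennpow (ennpow x (1 / p)) p = x"
  using assms by (simp_all add: ennpow_ennpow)

text \<open>From x + y <= 2 max x y; one constant serves p < 1 and p >= 1 alike.\<close>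

lemma ennpow_add_le:
  assumes "0 < p"
  shows "ennpow (x + y) p \<le> ennreal (2 powr p) * (ennpow x p + ennpow y p)"
proof -
  have *: "x + y \<le> ennreal 2 * max x y"
    by (metis add_mono ennreal_numeral max.cobounded1 max.cobounded2 mult_2)
  have "ennpow (x + y) p \<le> ennreal (2 powr p) * ennpow (max x y) p"
    using ennpow_mono[OF *, of p] assms by (simp add: ennpow_cmult del: ennreal_numeral)
  also have "ennpow (max x y) p \<le> ennpow x p + ennpow y p"
    by (auto simp: max_def)
  finally show ?thesis by (simp add: mult_left_mono)
qed

lemma exponent_cases:
  assumes "0 < (q::ennreal)"
  obtains "q = \<infinity>" "recip q = 0"
  | p where "q = ennreal p" "0 < p" "q \<noteq> \<infinity>" "enn2real q = p" "recip q = 1 / p"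
proof (cases q)
  case (real p)
  then have "0 < p" using assms by (auto simp: less_le)
  then have "recip q = 1 / p"
    using real by (simp add: recip_def divide_ennreal[of 1, simplified])
  with real \<open>0 < p\<close> that(2)[of p] show ?thesis by auto
qed (use that(1) in \<open>auto simp: recip_def\<close>)

lemma recip_nonneg [simp]: "0 \<le> recip q"
  by (simp add: recip_def)

text \<open>Counting measure in place of a series gives Tonelli's theorem and reindexing along
  bijections directly for two-sided sequences with values in [0, \<infinity>].\<close>

definition lq :: "ennreal \<Rightarrow> (int \<Rightarrow> ennreal) \<Rightarrow> ennreal" where
  "lq q g = (if q = \<infinity> then (SUP k. g k)
     else ennpow (\<integral>\<^sup>+ k. ennpow (g k) (enn2real q) \<partial>count_space UNIV) (recip q))"

lemma lq_top: "lq top g = (SUP k. g k)" by (simp add: lq_def)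

lemma lq_real: "0 < p \<Longrightarrow> lq (ennreal p) g = ennpow (\<integral>\<^sup>+ k. ennpow (g k) p \<partial>count_space UNIV) (1 / p)"
  by (simp add: lq_def recip_def divide_ennreal[of 1, simplified])

lemma lq_mono: "(\<And>k. g k \<le> h k) \<Longrightarrow> lq q g \<le> lq q h"
  by (auto simp: lq_def intro!: SUP_mono' ennpow_mono nn_integral_mono)

lemma lq_cmult:
  assumes "0 < q" "0 \<le> c"
  shows "lq q (\<lambda>k. ennreal c * g k) = ennreal c * lq q g"
  using assms(1)
proof (cases rule: exponent_cases)
  case (2 p)
  then show ?thesis using assms(2)
    by (cases "c = 0") (auto simp: lq_real ennpow_cmult nn_integral_cmult powr_powr)
qed (simp add: lq_top SUP_mult_left_ennreal)

lemma lq_ge: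
  assumes "0 < q" shows "g k \<le> lq q g"
  using assms
proof (cases rule: exponent_cases)
  case (2 p)
  have "ennpow (g k) p = (\<integral>\<^sup>+ j. ennpow (g j) p * indicator {k} j \<partial>count_space UNIV)"
    by (simp add: nn_integral_indicator_singleton')
  also have "\<dots> \<le> (\<integral>\<^sup>+ j. ennpow (g j) p \<partial>count_space UNIV)"
    by (intro nn_integral_mono) (auto simp: indicator_def)
  finally show ?thesis
    using ennpow_mono[of "ennpow (g k) p" _ "1 / p"] 2 by (simp add: lq_real ennpow_inverse)
qed (auto simp: lq_top intro: SUP_upper)

lemma lq_add:
  assumes "0 < q"
  obtains C where "1 \<le> C" "\<And>g h. lq q (\<lambda>k. g k + h k) \<le> ennreal C * (lq q g + lq q h)"
  using assms
proof (cases rule: exponent_cases)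
  case 1
  have "lq q (\<lambda>k. g k + h k) \<le> ennreal 1 * (lq q g + lq q h)" for g h
    using 1 by (auto simp: lq_top intro!: SUP_least add_mono SUP_upper)
  then show ?thesis using that[of 1] by auto
next
  case (2 p)
  let ?M = "count_space (UNIV::int set)"
  have "lq q (\<lambda>k. g k + h k) \<le> ennreal (2 * 2 powr (1/p)) * (lq q g + lq q h)" for g h
  proof -
    have "(\<integral>\<^sup>+ k. ennpow (g k + h k) p \<partial>?M)
        \<le> (\<integral>\<^sup>+ k. ennreal (2 powr p) * (ennpow (g k) p + ennpow (h k) p) \<partial>?M)"
      using 2 by (intro nn_integral_mono ennpow_add_le)
    also have "\<dots> = ennreal (2 powr p) * ((\<integral>\<^sup>+ k. ennpow (g k) p \<partial>?M) + (\<integral>\<^sup>+ k. ennpow (h k) p \<partial>?M))"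
      by (simp add: nn_integral_cmult nn_integral_add)
    finally have "lq q (\<lambda>k. g k + h k) \<le> ennpow (ennreal (2 powr p) *
         ((\<integral>\<^sup>+ k. ennpow (g k) p \<partial>?M) + (\<integral>\<^sup>+ k. ennpow (h k) p \<partial>?M))) (1/p)"
      using 2 by (auto simp: lq_real intro!: ennpow_mono)
    also have "\<dots> = 2 * ennpow ((\<integral>\<^sup>+ k. ennpow (g k) p \<partial>?M) + (\<integral>\<^sup>+ k. ennpow (h k) p \<partial>?M)) (1/p)"
      using 2 by (simp add: ennpow_cmult powr_powr)
    also have "\<dots> \<le> 2 * (ennreal (2 powr (1/p)) * (lq q g + lq q h))"
      using 2 ennpow_add_le[of "1/p"] by (simp add: lq_real mult_left_mono)
    finally show ?thesis by (simp add: ennreal_mult mult.assoc)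
  qed
  moreover have "1 \<le> 2 * 2 powr (1/p)" using 2 ge_one_powr_ge_zero[of 2 "1/p"] by simp
  ultimately show ?thesis using that by blast
qed

text \<open>An entry of \<open>g\<close> occurs at most \<open>N\<close> times among the
  \<open>g (\<phi> n)\<close>, so the sum of p-th powers grows at most by the factor
  \<open>N\<close>. It serves index maps that are neither injective nor monotone.\<close>

lemma lq_fibres:
  assumes "0 < q" and fin: "\<And>k. finite {n. \<phi> n = k}" and card: "\<And>k. card {n. \<phi> n = k} \<le> N"
  obtains C where "1 \<le> C" "\<And>g. lq q (\<lambda>n. g (\<phi> n)) \<le> ennreal C * lq q g"
  using assms(1)
proof (cases rule: exponent_cases)
  case 1
  have "lq q (\<lambda>n. g (\<phi> n)) \<le> ennreal 1 * lq q g" for g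
    using 1 by (auto simp: lq_top intro!: SUP_least SUP_upper)
  then show ?thesis using that[of 1] by auto
next
  case (2 p)
  let ?M = "count_space (UNIV::int set)"
  have int: "(\<integral>\<^sup>+ n. h (\<phi> n) \<partial>?M) \<le> of_nat N * (\<integral>\<^sup>+ k. h k \<partial>?M)" for h :: "int \<Rightarrow> ennreal"
  proof -
    have "(\<integral>\<^sup>+ n. h (\<phi> n) \<partial>?M) = (\<integral>\<^sup>+ n. \<integral>\<^sup>+ k. h k * indicator {\<phi> n} k \<partial>?M \<partial>?M)"
      by (simp add: nn_integral_indicator_singleton')
    also have "\<dots> = (\<integral>\<^sup>+ k. \<integral>\<^sup>+ n. h k * indicator {\<phi> n} k \<partial>?M \<partial>?M)"
      by (intro nn_integral_count_space_nn_integral[symmetric]) auto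
    also have "\<dots> = (\<integral>\<^sup>+ k. \<integral>\<^sup>+ n. h k * indicator {n. \<phi> n = k} n \<partial>?M \<partial>?M)"
      by (intro nn_integral_cong) (auto simp: indicator_def)
    also have "\<dots> = (\<integral>\<^sup>+ k. h k * of_nat (card {n. \<phi> n = k}) \<partial>?M)"
      using fin by (simp add: nn_integral_cmult)
    also have "\<dots> \<le> (\<integral>\<^sup>+ k. h k * of_nat N \<partial>?M)"
      using card by (intro nn_integral_mono mult_left_mono) auto
    finally show ?thesis by (simp add: mult.commute[of _ "of_nat N"] nn_integral_cmult)
  qed
  have "lq q (\<lambda>n. g (\<phi> n)) \<le> ennreal (max 1 (real N powr (1/p))) * lq q g" for g
  proof -
    have "lq q (\<lambda>n. g (\<phi> n)) \<le> ennpow (ennreal (real N) * (\<integral>\<^sup>+ k. ennpow (g k) p \<partial>?M)) (1/p)"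
      using 2 int[of "\<lambda>k. ennpow (g k) p"]
      by (auto simp: lq_real ennreal_of_nat_eq_real_of_nat intro!: ennpow_mono)
    also have "\<dots> = ennreal (real N powr (1/p)) * lq q g"
      using 2 by (simp add: ennpow_cmult lq_real)
    also have "\<dots> \<le> ennreal (max 1 (real N powr (1/p))) * lq q g"
      by (intro mult_right_mono ennreal_leI) auto
    finally show ?thesis .
  qed
  then show ?thesis using that[of "max 1 (real N powr (1/p))"] by auto
qed

lemma lq_bij:
  assumes "bij \<phi>" shows "lq q (\<lambda>n. g (\<phi> n)) = lq q g"
proof -
  have "(SUP n. g (\<phi> n)) = (SUP k. g k)"
    using bij_is_surj[OF assms] by (metis image_image)
  moreover have "(\<integral>\<^sup>+ n. h (\<phi> n) \<partial>count_space UNIV) = (\<integral>\<^sup>+ k. h k \<partial>count_space UNIV)" for h :: "int \<Rightarrow> ennreal"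
    using nn_integral_bij_count_space[OF assms] by simp
  from this[of "\<lambda>k. ennpow (g k) (enn2real q)"] calculation show ?thesis by (simp add: lq_def)
qed

lemma lq_shift: "lq q (\<lambda>n. g (n + m)) = lq q g"
  by (rule lq_bij[where \<phi> = "\<lambda>n. n + m"]) (simp add: bij_plus_right)

lemma lq_uminus: "lq q (\<lambda>n. g (- n)) = lq q g"
  by (rule lq_bij[where \<phi> = uminus]) (simp add: bij_uminus)

section \<open>Geometric kernels and a discrete Hardy inequality\<close>

definition decay :: "real \<Rightarrow> int \<Rightarrow> int \<Rightarrow> real" where
  "decay e n j = (if j \<le> n then exp (- e * of_int (n - j)) else 0)"

lemma decay_nonneg [simp]: "0 \<le> decay e n j" by (simp add: decay_def)

lemma nn_integral_decay:
  assumes "0 < e"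
  shows "(\<integral>\<^sup>+ i. ennreal (if 0 \<le> i then exp (- e * of_int i) else 0) \<partial>count_space UNIV) < \<infinity>"
proof -
  let ?f = "\<lambda>i::int. ennreal (if 0 \<le> i then exp (- e * of_int i) else 0)"
  have "(\<integral>\<^sup>+ i. ?f i \<partial>count_space UNIV) = (\<integral>\<^sup>+ i. ?f i \<partial>count_space (range int))"
    by (rule nn_integral_count_space_eq) (auto simp: image_iff intro: nonneg_int_cases)
  also have "\<dots> = (\<integral>\<^sup>+ i. ?f (int i) \<partial>count_space UNIV)"
    by (rule nn_integral_bij_count_space[symmetric]) (auto simp: bij_betw_def)
  also have "\<dots> = (\<Sum>i. ennreal (exp (- e) ^ i))"
    by (simp add: nn_integral_count_space_nat exp_of_nat_mult[symmetric] mult.commute)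
  also have "\<dots> < \<infinity>"
    using assms by (intro ennreal_suminf_neq_top[THEN less_top[THEN iffD1]] summable_geometric
       | simp add: less_top)+
  finally show ?thesis .
qed

lemma decay_reindex: "decay e n j = (if 0 \<le> n - j then exp (- e * of_int (n - j)) else 0)"
  by (simp add: decay_def)

lemma decay_powr: "0 < p \<Longrightarrow> ennpow (ennreal (decay e n j)) p = ennreal (decay (e * p) n j)"
  by (simp add: decay_def ennpow_real exp_powr_real algebra_simps)

text \<open>The kernel depends on n - j only, so all row sums and all column sums equal one
  geometric series. Row sums are used for \<open>lq_decay\<close>, column sums for
  \<open>lq_hardy\<close>.\<close>

lemma decay_int_bound:
  assumes "0 < e"
  obtains S where "1 \<le> S" "\<And>n. (\<integral>\<^sup>+ j. ennreal (decay e n j) \<partial>count_space UNIV) \<le> ennreal S"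
    "\<And>j. (\<integral>\<^sup>+ n. ennreal (decay e n j) \<partial>count_space UNIV) \<le> ennreal S"
proof -
  let ?f = "\<lambda>i::int. ennreal (if 0 \<le> i then exp (- e * of_int i) else 0)"
  have 1: "(\<integral>\<^sup>+ j. ennreal (decay e n j) \<partial>count_space UNIV) = (\<integral>\<^sup>+ i. ?f i \<partial>count_space UNIV)" for n
    unfolding decay_reindex
    by (rule nn_integral_bij_count_space[where g = "\<lambda>j. n - j" and f = ?f])
       (auto intro!: bij_betwI[where g = "\<lambda>j. n - j"])
  have 2: "(\<integral>\<^sup>+ n. ennreal (decay e n j) \<partial>count_space UNIV) = (\<integral>\<^sup>+ i. ?f i \<partial>count_space UNIV)" for j
    unfolding decay_reindex
    by (rule nn_integral_bij_count_space[where g = "\<lambda>n. n - j" and f = ?f])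
       (auto intro!: bij_betwI[where g = "\<lambda>i. i + j"])
  let ?S = "\<integral>\<^sup>+ i. ?f i \<partial>count_space UNIV"
  have "?S = ennreal (enn2real ?S)"
    using nn_integral_decay[OF assms] by simp
  also have "\<dots> \<le> ennreal (max 1 (enn2real ?S))"
    by (intro ennreal_leI) auto
  finally show ?thesis using that[of "max 1 (enn2real ?S)"] 1 2 by simp
qed

lemma lq_decay:
  assumes "0 < q" "0 < e"
  obtains C where "1 \<le> C" "\<And>n. lq q (\<lambda>j. ennreal (decay e n j)) \<le> ennreal C"
  using assms(1)
proof (cases rule: exponent_cases)
  case 1
  have "lq q (\<lambda>j. ennreal (decay e n j)) \<le> ennreal 1" for n
    using 1 assms by (auto simp: lq_top decay_def intro!: SUP_least)
  then show ?thesis using that[of 1] by auto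
next
  case (2 p)
  then obtain S where S: "1 \<le> S" "\<And>n. (\<integral>\<^sup>+ j. ennreal (decay (e * p) n j) \<partial>count_space UNIV) \<le> ennreal S"
    using assms by (metis decay_int_bound mult_pos_pos)
  have "lq q (\<lambda>j. ennreal (decay e n j)) \<le> ennreal (S powr (1 / p))" for n
    using 2 ennpow_mono[OF S(2), of "1/p" n] S(1) by (simp add: lq_real decay_powr) (simp add: ennpow_real)
  moreover have "1 \<le> S powr (1 / p)" using S(1) 2 by (simp add: ge_one_powr_ge_zero)
  ultimately show ?thesis using that by blast
qed

text \<open>Inner and outer exponent agree, so p-th powers leave a double sum with a nonnegative
  kernel, and Tonelli with the uniform column sums finishes it. The p-th power of the kernel is
  again geometric, of rate \<open>e * p\<close>, which covers p < 1 as well.\<close>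

lemma lq_hardy:
  assumes "0 < q" "0 < e"
  obtains C where "1 \<le> C"
    "\<And>G. lq q (\<lambda>n. lq q (\<lambda>j. ennreal (decay e n j) * G j)) \<le> ennreal C * lq q G"
  using assms(1)
proof (cases rule: exponent_cases)
  case 1
  have "lq q (\<lambda>n. lq q (\<lambda>j. ennreal (decay e n j) * G j)) \<le> ennreal 1 * lq q G" for G
  proof -
    have "ennreal (decay e n j) * G j \<le> G j" for n j
      using mult_right_mono[of "ennreal (decay e n j)" 1 "G j"] assms by (simp add: decay_def)
    then show ?thesis
      using 1 by (auto simp: lq_top intro!: SUP_least intro: SUP_upper2)
  qed
  then show ?thesis using that[of 1] by auto
next
  case (2 p)
  let ?M = "count_space (UNIV::int set)"
  obtain S where S: "1 \<le> S" "\<And>j. (\<integral>\<^sup>+ n. ennreal (decay (e * p) n j) \<partial>?M) \<le> ennreal S"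
    using assms 2 by (metis decay_int_bound mult_pos_pos)
  have "lq q (\<lambda>n. lq q (\<lambda>j. ennreal (decay e n j) * G j)) \<le> ennreal (S powr (1 / p)) * lq q G" for G
  proof -
    have "(\<integral>\<^sup>+ n. ennpow (lq q (\<lambda>j. ennreal (decay e n j) * G j)) p \<partial>?M)
       = (\<integral>\<^sup>+ n. \<integral>\<^sup>+ j. ennreal (decay (e * p) n j) * ennpow (G j) p \<partial>?M \<partial>?M)"
      using 2 by (simp add: lq_real ennpow_inverse ennpow_cmult)
        (simp add: ennpow_real[symmetric] decay_powr)
    also have "\<dots> = (\<integral>\<^sup>+ j. \<integral>\<^sup>+ n. ennreal (decay (e * p) n j) * ennpow (G j) p \<partial>?M \<partial>?M)"
      by (intro nn_integral_count_space_nn_integral[symmetric]) auto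
    also have "\<dots> \<le> (\<integral>\<^sup>+ j. ennreal S * ennpow (G j) p \<partial>?M)"
      using S(2) by (intro nn_integral_mono) (simp add: nn_integral_multc mult_right_mono)
    finally have "lq q (\<lambda>n. lq q (\<lambda>j. ennreal (decay e n j) * G j))
        \<le> ennpow (ennreal S * (\<integral>\<^sup>+ j. ennpow (G j) p \<partial>?M)) (1 / p)"
      using 2 by (subst (1) \<open>q = ennreal p\<close>, subst lq_real) (auto simp: nn_integral_cmult intro!: ennpow_mono)
    then show ?thesis using 2 S(1) by (simp add: lq_real ennpow_cmult)
  qed
  moreover have "1 \<le> S powr (1 / p)" using S(1) 2 by (simp add: ge_one_powr_ge_zero)
  ultimately show ?thesis using that by blast
qed

lemma ennreal_le_trans_mult:
  assumes "a \<le> ennreal C * b" "b \<le> ennreal D * c" "0 \<le> C"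
  shows "a \<le> ennreal (C * D) * c"
proof -
  have "a \<le> ennreal C * (ennreal D * c)"
    using assms(1) mult_left_mono[OF assms(2), of "ennreal C"] by (simp add: order_trans)
  then show ?thesis using assms(3) by (simp add: ennreal_mult' mult.assoc)
qed

section \<open>Slowly varying sequences, defined by Potter's bound, and quasi-norms known on
  tails\<close>

definition sv_seq :: "(int \<Rightarrow> real) \<Rightarrow> bool" where
  "sv_seq \<xi> \<longleftrightarrow> (\<forall>k. 0 < \<xi> k) \<and>
     (\<forall>e>0. \<exists>C>0. \<forall>i j. \<xi> i \<le> C * exp (e * \<bar>of_int (i - j)\<bar>) * \<xi> j)"

lemma sv_seq_pos: "sv_seq \<xi> \<Longrightarrow> 0 < \<xi> k"
  by (simp add: sv_seq_def)

lemma sv_seqE: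
  assumes "sv_seq \<xi>" "0 < e"
  obtains C where "0 < C" "\<And>i j. \<xi> i \<le> C * exp (e * \<bar>of_int (i - j)\<bar>) * \<xi> j"
  using assms unfolding sv_seq_def by blast

definition low :: "int \<Rightarrow> (int \<Rightarrow> ennreal) \<Rightarrow> int \<Rightarrow> ennreal" where
  "low n g j = (if j \<le> n then g j else 0)"

definition tail :: "int \<Rightarrow> int \<Rightarrow> ennreal" where
  "tail n j = (if n \<le> j then 1 else 0)"

text \<open>Both sequence quasi-norms are covered, the one of the \<open>\<L>\<close>-space after the reversal
  \<open>n \<mapsto> - n\<close> of the indices.\<close>

locale tail_norm =
  fixes N :: "(int \<Rightarrow> ennreal) \<Rightarrow> ennreal" and \<xi> :: "int \<Rightarrow> real"
  assumes mono: "(\<And>j. g j \<le> h j) \<Longrightarrow> N g \<le> N h"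
    and cmult: "0 \<le> c \<Longrightarrow> N (\<lambda>j. ennreal c * g j) = ennreal c * N g"
    and add: "\<exists>C>0. \<forall>g h. N (\<lambda>j. g j + h j) \<le> ennreal C * (N g + N h)"
    and sv: "sv_seq \<xi>"
    and tail_le: "\<exists>C>0. \<forall>n. N (tail n) \<le> ennreal (C * \<xi> n)"
    and le_tail: "\<exists>C>0. \<forall>n. ennreal (\<xi> n) \<le> ennreal C * N (tail n)"
    and decay: "0 < e \<Longrightarrow> \<exists>C>0. \<forall>n. N (\<lambda>j. ennreal (decay e n j)) \<le> ennreal (C * \<xi> n)"
begin

lemma pos: "0 < \<xi> n" using sv by (rule sv_seq_pos)

text \<open>The majorant is c times the low part of \<open>h\<close> plus \<open>c * h n\<close>
  times the indicator of the tail. The two hypotheses on \<open>g\<close> are those that the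
  K-functional of one piece of a near-optimal decomposition satisfies, so this yields the upper half
  of the Holmstedt formula.\<close>

lemma le_low_plus_tail:
  assumes "0 < c"
  shows "\<exists>C>0. \<forall>g h n. (\<forall>j. 0 \<le> h j) \<longrightarrow> (\<forall>j\<le>n. g j \<le> c * h j) \<longrightarrow> (\<forall>j\<ge>n. g j \<le> c * h n) \<longrightarrow>
    N (\<lambda>j. ennreal (g j)) \<le> ennreal C * (N (low n (\<lambda>j. ennreal (h j))) + ennreal (\<xi> n * h n))"
proof -
  obtain C where C: "C > 0" "\<And>g h. N (\<lambda>j. g j + h j) \<le> ennreal C * (N g + N h)"
    using add by blast
  obtain D where D: "D > 0" "\<And>n. N (tail n) \<le> ennreal (D * \<xi> n)"
    using tail_le by blast
  show ?thesis
  proof (intro exI[of _ "C * c * max 1 D"] conjI allI impI)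
    fix g h :: "int \<Rightarrow> real" and n assume h: "\<forall>j. 0 \<le> h j" and g: "\<forall>j\<le>n. g j \<le> c * h j" "\<forall>j\<ge>n. g j \<le> c * h n"
    let ?h = "\<lambda>j. ennreal (h j)"
    have hc: "0 \<le> c * h j" for j using h assms by simp
    have "N (\<lambda>j. ennreal (g j)) \<le> N (\<lambda>j. ennreal c * low n ?h j + ennreal (c * h n) * tail n j)"
    proof (rule mono)
      fix j
      have "g j \<le> (if j \<le> n then c * h j else 0) + (if n \<le> j then c * h n else 0)"
        by (smt (verit) g hc)
      from ennreal_leI[OF this]
      show "ennreal (g j) \<le> ennreal c * low n ?h j + ennreal (c * h n) * tail n j"
        using hc[of j] hc[of n] assms
        by (subst (asm) ennreal_plus) (auto simp: low_def tail_def ennreal_mult')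
    qed
    also have "\<dots> \<le> ennreal C * (ennreal c * N (low n ?h) + ennreal (c * h n) * N (tail n))"
      using C(2)[of "\<lambda>j. ennreal c * low n ?h j" "\<lambda>j. ennreal (c * h n) * tail n j"] h assms
      by (simp add: cmult)
    also have "\<dots> \<le> ennreal C * (ennreal c * N (low n ?h) + ennreal (c * h n) * ennreal (D * \<xi> n))"
      by (intro mult_left_mono add_left_mono D) auto
    also have "\<dots> \<le> ennreal C * (ennreal (c * max 1 D) * N (low n ?h) + ennreal (c * max 1 D) * ennreal (\<xi> n * h n))"
    proof (intro mult_left_mono add_mono mult_right_mono)
      have "c \<le> c * max 1 D" using assms by simp
      then show "ennreal c \<le> ennreal (c * max 1 D)" by (rule ennreal_leI)
      have "D * (c * \<xi> n * h n) \<le> max 1 D * (c * \<xi> n * h n)"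
        using h assms pos[of n] by (intro mult_right_mono) auto
      then have "ennreal (c * h n * (D * \<xi> n)) \<le> ennreal (c * max 1 D * (\<xi> n * h n))"
        by (intro ennreal_leI) (simp only: mult_ac)
      then show "ennreal (c * h n) * ennreal (D * \<xi> n) \<le> ennreal (c * max 1 D) * ennreal (\<xi> n * h n)"
        using h assms by (simp add: ennreal_mult'[symmetric])
    qed auto
    also have "\<dots> = ennreal (C * c * max 1 D) * (N (low n ?h) + ennreal (\<xi> n * h n))"
      using C(1) assms by (simp add: distrib_left ennreal_mult' mult.assoc)
    finally show "N (\<lambda>j. ennreal (g j)) \<le> \<dots>" .
  qed (use C D assms in auto)
qed

text \<open>\<open>h\<close> dominates \<open>h n\<close> times the indicator of the tail. For
  monotone sequences this bounds every single entry by the norm.\<close>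

lemma tail_mult_le:
  "\<exists>C>0. \<forall>h n. (\<forall>j. 0 \<le> h j) \<longrightarrow> (\<forall>j\<ge>n. h n \<le> h j) \<longrightarrow>
     ennreal (\<xi> n * h n) \<le> ennreal C * N (\<lambda>j. ennreal (h j))"
proof -
  obtain D where D: "D > 0" "\<And>n. ennreal (\<xi> n) \<le> ennreal D * N (tail n)"
    using le_tail by blast
  show ?thesis
  proof (intro exI[of _ D] conjI allI impI)
    fix h :: "int \<Rightarrow> real" and n assume h: "\<forall>j. 0 \<le> h j" "\<forall>j\<ge>n. h n \<le> h j"
    have "ennreal (\<xi> n * h n) = ennreal (h n) * ennreal (\<xi> n)"
      using h by (simp add: ennreal_mult'' mult.commute)
    also have "\<dots> \<le> ennreal (h n) * (ennreal D * N (tail n))"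
      by (intro mult_left_mono D) auto
    also have "\<dots> = ennreal D * N (\<lambda>j. ennreal (h n) * tail n j)"
      using h by (simp add: cmult mult_ac)
    also have "\<dots> \<le> ennreal D * N (\<lambda>j. ennreal (h j))"
      using h by (intro mult_left_mono mono) (auto simp: tail_def intro!: ennreal_leI)
    finally show "ennreal (\<xi> n * h n) \<le> ennreal D * N (\<lambda>j. ennreal (h j))" .
  qed (use D in auto)
qed

lemma low_decay_le:
  assumes "0 < e"
  shows "\<exists>C>0. \<forall>g A n. 0 \<le> A \<longrightarrow> (\<forall>j\<le>n. g j \<le> A * exp (- e * of_int (n - j))) \<longrightarrow>
     N (low n (\<lambda>j. ennreal (g j))) \<le> ennreal (C * A * \<xi> n)"
proof -
  obtain D where D: "D > 0" "\<And>n. N (\<lambda>j. ennreal (decay e n j)) \<le> ennreal (D * \<xi> n)"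
    using decay[OF assms] by blast
  show ?thesis
  proof (intro exI[of _ D] conjI allI impI)
    fix g :: "int \<Rightarrow> real" and A n assume A: "0 \<le> A" and g: "\<forall>j\<le>n. g j \<le> A * exp (- e * of_int (n - j))"
    have "N (low n (\<lambda>j. ennreal (g j))) \<le> N (\<lambda>j. ennreal A * ennreal (decay e n j))"
      using g A by (intro mono) (auto simp: low_def decay_def ennreal_mult'[symmetric] intro!: ennreal_leI)
    also have "\<dots> \<le> ennreal A * ennreal (D * \<xi> n)"
      using A D by (simp add: cmult mult_left_mono)
    finally show "N (low n (\<lambda>j. ennreal (g j))) \<le> ennreal (D * A * \<xi> n)"
      using A by (simp add: ennreal_mult'[symmetric] mult_ac)
  qed (use D in auto)
qed

text \<open>\<open>N\<close> and the outer exponent \<open>r\<close> are unrelated, so the two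
  summations cannot be interchanged. Instead \<open>h j\<close> is bounded pointwise through an l_r
  norm \<open>M n\<close> with geometric weights; \<open>N\<close> then sees only a geometric
  sequence, and \<open>M\<close> is handled by \<open>lq_hardy\<close>, where both exponents are
  \<open>r\<close>. Of the rate e, one half is spent on \<open>M\<close>, one quarter on the slow
  variation of \<open>\<xi>\<close>, and one quarter remains as decay.\<close>

lemma hardy:
  assumes "0 < e" "0 < r" and w: "\<And>n. 0 < w n"
    and D: "0 < D" "\<And>j n. j \<le> n \<Longrightarrow> w n \<le> D * exp (- e * of_int (n - j)) * w j"
  shows "\<exists>C>0. \<forall>h. (\<forall>j. 0 \<le> h j) \<longrightarrow>
     lq r (\<lambda>n. ennreal (w n) * N (low n (\<lambda>j. ennreal (h j)))) \<le>
       ennreal C * lq r (\<lambda>n. ennreal (w n * \<xi> n * h n))"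
proof -
  obtain C1 where C1: "C1 > 0" "\<And>g A n. 0 \<le> A \<Longrightarrow> (\<forall>j\<le>n. g j \<le> A * exp (- (e/4) * of_int (n - j))) \<Longrightarrow>
     N (low n (\<lambda>j. ennreal (g j))) \<le> ennreal (C1 * A * \<xi> n)"
    using low_decay_le[of "e/4"] assms by auto
  obtain D' where D': "D' > 0" "\<And>i j. \<xi> i \<le> D' * exp (e/4 * \<bar>of_int (i - j)\<bar>) * \<xi> j"
    using sv_seqE[OF sv, of "e/4"] assms by auto
  obtain C2 where C2: "1 \<le> C2"
    "\<And>G. lq r (\<lambda>n. lq r (\<lambda>j. ennreal (decay (e/2) n j) * G j)) \<le> ennreal C2 * lq r G"
    using lq_hardy[of r "e/2"] assms by auto
  show ?thesis
  proof (intro exI[of _ "C1 * D * D' * C2"] conjI allI impI)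
    fix h :: "int \<Rightarrow> real" assume h: "\<forall>j. 0 \<le> h j"
    define G where "G j = ennreal (w j * \<xi> j * h j)" for j
    define M where "M n = lq r (\<lambda>j. ennreal (decay (e/2) n j) * G j)" for n
    have "ennreal (w n) * N (low n (\<lambda>j. ennreal (h j))) \<le> ennreal (C1 * D * D') * M n" for n
    proof (cases "M n")
      case (real m)
      have *: "h j \<le> m * D * D' / (w n * \<xi> n) * exp (- (e/4) * of_int (n - j))" if "j \<le> n" for j
      proof -
        let ?x = "of_int (n - j) :: real"
        have "ennreal (decay (e/2) n j) * G j \<le> ennreal m"
          unfolding real(2)[symmetric] M_def by (rule lq_ge[OF assms(2)])
        then have "exp (- (e/2) * ?x) * (w j * \<xi> j * h j) \<le> m"
          using that real(1) by (simp add: G_def decay_def ennreal_mult'[symmetric])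
        then have 1: "w j * \<xi> j * h j \<le> m * exp (e/2 * ?x)"
          by (simp add: exp_minus field_simps)
        have "w n * \<xi> n * h j \<le> (D * exp (- e * ?x) * w j) * (D' * exp (e/4 * ?x) * \<xi> j) * h j"
          using D(2)[OF that] D'(2)[of n j] h that w pos[of n] D D'
          by (intro mult_mono) (auto simp: less_imp_le)
        also have "\<dots> = D * D' * exp (- e * ?x) * exp (e/4 * ?x) * (w j * \<xi> j * h j)"
          by simp
        also have "\<dots> \<le> D * D' * exp (- e * ?x) * exp (e/4 * ?x) * (m * exp (e/2 * ?x))"
          using D D' by (intro mult_left_mono 1) auto
        also have "\<dots> = m * D * D' * (exp (- e * ?x) * exp (e/4 * ?x) * exp (e/2 * ?x))"
          by simp
        also have "\<dots> = m * D * D' * exp (- (e/4) * ?x)"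
          by (simp only: exp_add[symmetric]) (simp add: field_simps)
        finally show ?thesis
          using w[of n] pos[of n] by (simp add: field_simps)
      qed
      have "N (low n (\<lambda>j. ennreal (h j))) \<le> ennreal (C1 * (m * D * D' / (w n * \<xi> n)) * \<xi> n)"
        using * real D D' w[of n] pos[of n] by (intro C1) auto
      also have "C1 * (m * D * D' / (w n * \<xi> n)) * \<xi> n = C1 * D * D' * m / w n"
        using pos[of n] by simp
      finally have "ennreal (w n) * N (low n (\<lambda>j. ennreal (h j))) \<le> ennreal (w n) * ennreal (C1 * D * D' * m / w n)"
        by (rule mult_left_mono) auto
      also have "\<dots> = ennreal (C1 * D * D') * M n"
        using real w[of n] D D' C1 by (simp add: ennreal_mult'[symmetric])
      finally show ?thesis .
    next
      case top
      then show ?thesis using C1(1) D(1) D'(1) by (simp add: ennreal_mult_top)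
    qed
    then have "lq r (\<lambda>n. ennreal (w n) * N (low n (\<lambda>j. ennreal (h j)))) \<le> lq r (\<lambda>n. ennreal (C1 * D * D') * M n)"
      by (rule lq_mono)
    also have "\<dots> = ennreal (C1 * D * D') * lq r M"
      using C1 D D' assms by (intro lq_cmult) auto
    also have "\<dots> \<le> ennreal (C1 * D * D' * C2) * lq r G"
      using C2(2)[of G] C1 D D' by (intro ennreal_le_trans_mult[OF order.refl]) (auto simp: M_def[abs_def])
    finally show "lq r (\<lambda>n. ennreal (w n) * N (low n (\<lambda>j. ennreal (h j)))) \<le>
       ennreal (C1 * D * D' * C2) * lq r (\<lambda>n. ennreal (w n * \<xi> n * h n))" unfolding G_def .
  qed (use C1 C2 D D' in auto)
qed

end

text \<open>By monotonicity of the reflected sequence its norm Y bounds each entry: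
  \<open>\<kappa> j\<close> is at most a multiple of exp(j) Y / \<open>\<xi>' (- j)\<close>. The
  factor exp(j) beats slow variation, so \<open>\<kappa>\<close> decays geometrically to the left of
  n and \<open>N\<close> of its low part costs one value of \<open>\<xi>\<close>. For the
  quasi-norms of the two limiting spaces the resulting factor is \<rho>(exp n) or, with the roles
  interchanged and n replaced by - n, its reciprocal.\<close>

lemma cross_term_le:
  assumes "tail_norm N \<xi>" "tail_norm N' \<xi>'"
  shows "\<exists>C>0. \<forall>\<kappa> n. (\<forall>j. 0 \<le> \<kappa> j) \<longrightarrow> mono (\<lambda>j. exp (of_int j) * \<kappa> (- j)) \<longrightarrow>
     N (low n (\<lambda>j. ennreal (\<kappa> j))) \<le>
       ennreal (C * (exp (of_int n) * \<xi> n / \<xi>' (- n))) * N' (\<lambda>j. ennreal (exp (of_int j) * \<kappa> (- j)))"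
proof -
  interpret N: tail_norm N \<xi> by fact
  interpret N': tail_norm N' \<xi>' by fact
  obtain C1 where C1: "C1 > 0" "\<And>h n. (\<forall>j. 0 \<le> h j) \<Longrightarrow> (\<forall>j\<ge>n. h n \<le> h j) \<Longrightarrow>
     ennreal (\<xi>' n * h n) \<le> ennreal C1 * N' (\<lambda>j. ennreal (h j))"
    using N'.tail_mult_le by blast
  obtain C2 where C2: "C2 > 0" "\<And>g A n. 0 \<le> A \<Longrightarrow> (\<forall>j\<le>n. g j \<le> A * exp (- (1/2) * of_int (n - j))) \<Longrightarrow>
     N (low n (\<lambda>j. ennreal (g j))) \<le> ennreal (C2 * A * \<xi> n)"
    using N.low_decay_le[of "1/2"] by auto
  obtain D where D: "D > 0" "\<And>i j. \<xi>' i \<le> D * exp (1/2 * \<bar>of_int (i - j)\<bar>) * \<xi>' j"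
    using sv_seqE[OF N'.sv, of "1/2"] by auto
  show ?thesis
  proof (intro exI[of _ "C1 * C2 * D"] conjI allI impI)
    fix \<kappa> :: "int \<Rightarrow> real" and n
    assume \<kappa>: "\<forall>j. 0 \<le> \<kappa> j" and mono: "mono (\<lambda>j. exp (of_int j) * \<kappa> (- j))"
    define Y where "Y = N' (\<lambda>j. ennreal (exp (of_int j) * \<kappa> (- j)))"
    show "N (low n (\<lambda>j. ennreal (\<kappa> j))) \<le> ennreal (C1 * C2 * D * (exp (of_int n) * \<xi> n / \<xi>' (- n)))
      * N' (\<lambda>j. ennreal (exp (of_int j) * \<kappa> (- j)))"
      unfolding Y_def[symmetric]
    proof (cases Y)
      case (real y)
      have "\<kappa> j \<le> (C1 * y * D * exp (of_int n) / \<xi>' (- n)) * exp (- (1/2) * of_int (n - j))" if "j \<le> n" for j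
      proof -
        have "ennreal (\<xi>' (-j) * (exp (of_int (-j)) * \<kappa> (- (-j)))) \<le> ennreal C1 * Y"
          unfolding Y_def using \<kappa> mono by (intro C1(2)) (auto dest: monoD)
        then have 1: "\<xi>' (-j) * (exp (- of_int j) * \<kappa> j) \<le> C1 * y"
          using real C1 by (simp add: ennreal_mult'[symmetric])
        have "\<xi>' (-n) * \<kappa> j \<le> (D * exp (1/2 * of_int (n - j)) * \<xi>' (-j)) * \<kappa> j"
          using D(2)[of "-n" "-j"] \<kappa> that by (intro mult_right_mono) auto
        also have "\<dots> = D * exp (1/2 * of_int (n - j)) * exp (of_int j) * (\<xi>' (-j) * (exp (- of_int j) * \<kappa> j))"
          by (simp add: exp_minus)
        also have "\<dots> \<le> D * exp (1/2 * of_int (n - j)) * exp (of_int j) * (C1 * y)"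
          using D by (intro mult_left_mono 1) auto
        also have "\<dots> = C1 * y * D * (exp (1/2 * of_int (n - j)) * exp (of_int j))" by simp
        also have "\<dots> = C1 * y * D * (exp (of_int n) * exp (- (1/2) * of_int (n - j)))"
          by (simp only: exp_add[symmetric]) (simp add: field_simps)
        finally show ?thesis using N'.pos[of "-n"] by (simp add: field_simps)
      qed
      then have "N (low n (\<lambda>j. ennreal (\<kappa> j))) \<le> ennreal (C2 * (C1 * y * D * exp (of_int n) / \<xi>' (- n)) * \<xi> n)"
        using real C1 D N'.pos[of "-n"] by (intro C2) auto
      also have "\<dots> = ennreal (C1 * C2 * D * (exp (of_int n) * \<xi> n / \<xi>' (- n))) * Y"
        using real C1 C2 D N.pos[of n] N'.pos[of "-n"] by (simp add: ennreal_mult'[symmetric] mult_ac)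
      finally show "N (low n (\<lambda>j. ennreal (\<kappa> j))) \<le> ennreal (C1 * C2 * D * (exp (of_int n) * \<xi> n / \<xi>' (- n))) * Y" .
    next
      case top
      then show "N (low n (\<lambda>j. ennreal (\<kappa> j))) \<le> ennreal (C1 * C2 * D * (exp (of_int n) * \<xi> n / \<xi>' (- n))) * Y"
        using C1 C2 D N.pos[of n] N'.pos[of "-n"] by (simp add: ennreal_mult_top)
    qed
  qed (use C1 C2 D in auto)
qed

lemma le_mult_finite: "x \<le> ennreal c * y \<Longrightarrow> y < \<infinity> \<Longrightarrow> x < \<infinity>"
  by (metis ennreal_less_top ennreal_mult_less_top infinity_ennreal_def le_less_trans)

section \<open>The iterated sequence quasi-norm of the limiting spaces\<close>

definition dn :: "ennreal \<Rightarrow> (int \<Rightarrow> real) \<Rightarrow> ennreal \<Rightarrow> (int \<Rightarrow> real) \<Rightarrow> (int \<Rightarrow> ennreal) \<Rightarrow> ennreal" where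
  "dn r \<beta> q \<alpha> g = lq r (\<lambda>k. ennreal (\<beta> k) * lq q (\<lambda>j. if k \<le> j then ennreal (\<alpha> j) * g j else 0))"

lemma dn_mono: "(\<And>j. g j \<le> h j) \<Longrightarrow> dn r \<beta> q \<alpha> g \<le> dn r \<beta> q \<alpha> h"
  unfolding dn_def by (intro lq_mono mult_left_mono) (auto intro: mult_left_mono)

lemma dn_cmult:
  assumes "0 < r" "0 < q" "0 \<le> c"
  shows "dn r \<beta> q \<alpha> (\<lambda>j. ennreal c * g j) = ennreal c * dn r \<beta> q \<alpha> g"
proof -
  have "lq q (\<lambda>j. if k \<le> j then ennreal (\<alpha> j) * (ennreal c * g j) else 0)
     = ennreal c * lq q (\<lambda>j. if k \<le> j then ennreal (\<alpha> j) * g j else 0)" for k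
    using assms by (subst lq_cmult[symmetric]) (auto intro!: arg_cong[of _ _ "lq q"] simp: mult_ac)
  then have "dn r \<beta> q \<alpha> (\<lambda>j. ennreal c * g j)
     = lq r (\<lambda>k. ennreal c * (ennreal (\<beta> k) * lq q (\<lambda>j. if k \<le> j then ennreal (\<alpha> j) * g j else 0)))"
    by (simp add: dn_def mult_ac)
  then show ?thesis using assms by (simp add: lq_cmult dn_def)
qed

lemma dn_add:
  assumes "0 < r" "0 < q"
  shows "\<exists>C>0. \<forall>g h. dn r \<beta> q \<alpha> (\<lambda>j. g j + h j) \<le> ennreal C * (dn r \<beta> q \<alpha> g + dn r \<beta> q \<alpha> h)"
proof -
  obtain C where C: "1 \<le> C" "\<And>g h. lq q (\<lambda>k. g k + h k) \<le> ennreal C * (lq q g + lq q h)"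
    using lq_add[OF assms(2)] by blast
  obtain D where D: "1 \<le> D" "\<And>g h. lq r (\<lambda>k. g k + h k) \<le> ennreal D * (lq r g + lq r h)"
    using lq_add[OF assms(1)] by blast
  show ?thesis
  proof (intro exI[of _ "C * D"] conjI allI)
    fix g h
    let ?g = "\<lambda>k. lq q (\<lambda>j. if k \<le> j then ennreal (\<alpha> j) * g j else 0)"
    let ?h = "\<lambda>k. lq q (\<lambda>j. if k \<le> j then ennreal (\<alpha> j) * h j else 0)"
    have "lq q (\<lambda>j. if k \<le> j then ennreal (\<alpha> j) * (g j + h j) else 0) \<le> ennreal C * (?g k + ?h k)" for k
      by (rule order.trans[OF eq_refl C(2)])
        (auto intro!: arg_cong[of _ _ "lq q"] simp: distrib_left)
    then have "dn r \<beta> q \<alpha> (\<lambda>j. g j + h j) \<le> lq r (\<lambda>k. ennreal (\<beta> k) * (ennreal C * (?g k + ?h k)))"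
      unfolding dn_def by (intro lq_mono mult_left_mono) auto
    also have "\<dots> = ennreal C * lq r (\<lambda>k. ennreal (\<beta> k) * ?g k + ennreal (\<beta> k) * ?h k)"
      using assms C by (subst lq_cmult[symmetric]) (auto simp: distrib_left mult_ac)
    also have "\<dots> \<le> ennreal (C * D) * (dn r \<beta> q \<alpha> g + dn r \<beta> q \<alpha> h)"
      using D(2) C D unfolding dn_def by (intro ennreal_le_trans_mult[OF order.refl]) auto
    finally show "dn r \<beta> q \<alpha> (\<lambda>j. g j + h j) \<le> ennreal (C * D) * (dn r \<beta> q \<alpha> g + dn r \<beta> q \<alpha> h)" .
  qed (use C D in auto)
qed

text \<open>Translating both summation indices by i - j carries \<open>tail i\<close> into
  \<open>tail j\<close>; each of the two weights then costs exp(e/2 |i - j|).\<close>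

lemma dn_tail_le:
  assumes "0 < r" "0 < q" "sv_seq \<alpha>" "sv_seq \<beta>" "0 < e"
  shows "\<exists>C>0. \<forall>i j. dn r \<beta> q \<alpha> (tail i) \<le> ennreal (C * exp (e * \<bar>of_int (i - j)\<bar>)) * dn r \<beta> q \<alpha> (tail j)"
proof -
  obtain A where A: "A > 0" "\<And>i j. \<alpha> i \<le> A * exp (e/2 * \<bar>of_int (i - j)\<bar>) * \<alpha> j"
    using sv_seqE[OF assms(3), of "e/2"] assms by auto
  obtain B where B: "B > 0" "\<And>i j. \<beta> i \<le> B * exp (e/2 * \<bar>of_int (i - j)\<bar>) * \<beta> j"
    using sv_seqE[OF assms(4), of "e/2"] assms by auto
  show ?thesis
  proof (intro exI[of _ "A * B"] conjI allI)
    fix i j :: int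
    define m where "m = i - j"
    define E where "E = exp (e/2 * \<bar>of_int m\<bar>)"
    define L where "L k = lq q (\<lambda>l. if k \<le> l then ennreal (\<alpha> l) * tail j l else 0)" for k
    have a: "\<alpha> (l + m) \<le> A * E * \<alpha> l" "\<beta> (l + m) \<le> B * E * \<beta> l" for l
      using A(2)[of "l + m" l] B(2)[of "l + m" l] by (auto simp: E_def)
    have "lq q (\<lambda>l. if k + m \<le> l then ennreal (\<alpha> l) * tail i l else 0) \<le> ennreal (A * E) * L k" for k
    proof -
      have "lq q (\<lambda>l. if k + m \<le> l then ennreal (\<alpha> l) * tail i l else 0)
         = lq q (\<lambda>l. if k + m \<le> l + m then ennreal (\<alpha> (l + m)) * tail i (l + m) else 0)"
        by (rule lq_shift[symmetric])
      also have "\<dots> \<le> lq q (\<lambda>l. ennreal (A * E) * (if k \<le> l then ennreal (\<alpha> l) * tail j l else 0))"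
        using A(1) a by (intro lq_mono)
          (auto simp: tail_def m_def E_def ennreal_mult'[symmetric] intro!: ennreal_leI)
      also have "\<dots> = ennreal (A * E) * L k"
        unfolding L_def using A(1) assms by (intro lq_cmult) (auto simp: E_def)
      finally show ?thesis .
    qed
    then have "ennreal (\<beta> (k + m)) * lq q (\<lambda>l. if k + m \<le> l then ennreal (\<alpha> l) * tail i l else 0)
       \<le> ennreal (B * E * \<beta> k) * (ennreal (A * E) * L k)" for k
      by (intro mult_mono ennreal_leI a) auto
    then have "dn r \<beta> q \<alpha> (tail i) \<le> lq r (\<lambda>k. ennreal (B * E * \<beta> k) * (ennreal (A * E) * L k))"
      unfolding dn_def by (subst lq_shift[symmetric, of _ _ m], intro lq_mono)
    also have "\<dots> = lq r (\<lambda>k. ennreal (A * B * (E * E)) * (ennreal (\<beta> k) * L k))"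
      using A B less_imp_le[OF sv_seq_pos[OF assms(4)]]
      by (intro arg_cong[of _ _ "lq r"] ext) (simp add: E_def ennreal_mult' mult_ac)
    also have "\<dots> = ennreal (A * B * (E * E)) * dn r \<beta> q \<alpha> (tail j)"
      unfolding dn_def L_def using A B assms by (intro lq_cmult) (auto simp: E_def)
    also have "E * E = exp (e * \<bar>of_int m\<bar>)"
      by (simp add: E_def exp_add[symmetric])
    finally show "dn r \<beta> q \<alpha> (tail i) \<le> ennreal (A * B * exp (e * \<bar>of_int (i - j)\<bar>)) * dn r \<beta> q \<alpha> (tail j)"
      by (simp add: m_def)
  qed (use A B in auto)
qed

text \<open>Only the entry j = n of the inner norm is kept. This is precise enough for the
  comparison with sequences decaying to the left of n: their inner norm is at most a multiple of
  \<open>\<alpha> n\<close> for k <= n and vanishes for k > n.\<close>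

lemma dn_tail_ge:
  assumes "0 < r" "0 < q"
  shows "lq r (\<lambda>k. ennreal (\<beta> k) * (if k \<le> n then ennreal (\<alpha> n) else 0)) \<le> dn r \<beta> q \<alpha> (tail n)"
  unfolding dn_def
proof (intro lq_mono mult_left_mono)
  fix k
  show "(if k \<le> n then ennreal (\<alpha> n) else 0) \<le> lq q (\<lambda>j. if k \<le> j then ennreal (\<alpha> j) * tail n j else 0)"
    using lq_ge[OF assms(2), of "\<lambda>j. if k \<le> j then ennreal (\<alpha> j) * tail n j else 0" n]
    by (auto simp: tail_def)
qed auto

text \<open>\<open>X\<close> stands for a sampled function \<chi>, which is known only up to
  equivalence with the norms of the tails. Finiteness at one index spreads to all others by
  \<open>dn_tail_le\<close>, and so does slow variation. For a geometric sequence half of the rate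
  absorbs the slow variation of \<open>\<alpha>\<close>; the other half is summable in l_q, and
  \<open>dn_tail_ge\<close> closes the estimate.\<close>

lemma tail_norm_dn:
  assumes rq: "0 < r" "0 < q" and sv: "sv_seq \<alpha>" "sv_seq \<beta>"
    and fin: "dn r \<beta> q \<alpha> (tail m) < \<infinity>"
    and c: "0 < c" "\<And>n. dn r \<beta> q \<alpha> (tail n) \<le> ennreal c * X n" "\<And>n. X n \<le> ennreal c * dn r \<beta> q \<alpha> (tail n)"
  shows "tail_norm (dn r \<beta> q \<alpha>) (\<lambda>n. enn2real (X n))" "\<And>n. X n < \<infinity>"
proof -
  let ?N = "dn r \<beta> q \<alpha>"
  obtain D where D: "\<And>i j. ?N (tail i) \<le> ennreal (D * exp (1 * \<bar>of_int (i - j)\<bar>)) * ?N (tail j)"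
    using dn_tail_le[OF rq sv, of 1] by auto
  have N_fin: "?N (tail n) < \<infinity>" for n
    by (rule le_mult_finite[OF D fin])
  show X_fin: "X n < \<infinity>" for n
    by (rule le_mult_finite[OF c(3) N_fin])
  have X_eq: "ennreal (enn2real (X n)) = X n" for n
    using X_fin[of n] by simp
  \<comment> \<open>The single term k = j = n, of size \<open>\<beta> n * \<alpha> n\<close>, keeps
    the norm of the tail positive.\<close>
  have X_pos: "0 < enn2real (X n)" for n
  proof -
    have "0 < ennreal (\<beta> n) * ennreal (\<alpha> n)"
      using sv by (simp add: sv_seq_pos ennreal_zero_less_mult_iff)
    also have "\<dots> \<le> ?N (tail n)"
      using lq_ge[OF rq(1), of "\<lambda>k. ennreal (\<beta> k) * (if k \<le> n then ennreal (\<alpha> n) else 0)" n]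
      by (intro order.trans[OF _ dn_tail_ge[OF rq]]) simp
    also have "\<dots> \<le> ennreal c * X n" by (rule c)
    finally have "X n \<noteq> 0" by auto
    with X_eq[of n] show ?thesis by (metis ennreal_0 enn2real_nonneg less_eq_real_def)
  qed
  show "tail_norm ?N (\<lambda>n. enn2real (X n))"
  proof
    show "sv_seq (\<lambda>n. enn2real (X n))"
      unfolding sv_seq_def
    proof (intro conjI allI impI X_pos)
      fix e :: real assume "0 < e"
      then obtain C where C: "C > 0" "\<And>i j. ?N (tail i) \<le> ennreal (C * exp (e * \<bar>of_int (i - j)\<bar>)) * ?N (tail j)"
        using dn_tail_le[OF rq sv] by blast
      show "\<exists>C>0. \<forall>i j. enn2real (X i) \<le> C * exp (e * \<bar>real_of_int (i - j)\<bar>) * enn2real (X j)"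
      proof (intro exI[of _ "c * C * c"] conjI allI)
        fix i j
        have "X i \<le> ennreal (c * (C * exp (e * \<bar>of_int (i - j)\<bar>))) * ?N (tail j)"
          using c C by (intro ennreal_le_trans_mult[OF c(3) C(2)]) auto
        then have "X i \<le> ennreal (c * (C * exp (e * \<bar>of_int (i - j)\<bar>)) * c) * X j"
          using c C by (intro ennreal_le_trans_mult[OF _ c(2)]) auto
        then have "ennreal (enn2real (X i)) \<le> ennreal (c * (C * exp (e * \<bar>of_int (i - j)\<bar>)) * c * enn2real (X j))"
          using c C X_eq by (simp add: ennreal_mult' )
        then show "enn2real (X i) \<le> c * C * c * exp (e * \<bar>of_int (i - j)\<bar>) * enn2real (X j)"
          using c C by (subst (asm) ennreal_le_iff) (auto simp: mult_ac)
      qed (use c C in auto)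
    qed
    show "\<exists>C>0. \<forall>n. ?N (tail n) \<le> ennreal (C * enn2real (X n))"
      using c X_eq by (intro exI[of _ c]) (auto simp: ennreal_mult')
    show "\<exists>C>0. \<forall>n. ennreal (enn2real (X n)) \<le> ennreal C * ?N (tail n)"
      using c X_eq by (intro exI[of _ c]) auto
    show "\<exists>C>0. \<forall>n. ?N (\<lambda>j. ennreal (decay e n j)) \<le> ennreal (C * enn2real (X n))" if e: "0 < e" for e
    proof -
      obtain A where A: "A > 0" "\<And>i j. \<alpha> i \<le> A * exp (e/2 * \<bar>of_int (i - j)\<bar>) * \<alpha> j"
        using sv_seqE[OF sv(1), of "e/2"] e by auto
      obtain S where S: "1 \<le> S" "\<And>n. lq q (\<lambda>j. ennreal (decay (e/2) n j)) \<le> ennreal S"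
        using lq_decay[OF rq(2), of "e/2"] e by auto
      show ?thesis
      proof (intro exI[of _ "A * S * c"] conjI allI)
        fix n
        have \<alpha>: "0 < \<alpha> n" using sv by (simp add: sv_seq_pos)
        have 1: "\<alpha> j * decay e n j \<le> A * \<alpha> n * decay (e/2) n j" for j
        proof (cases "j \<le> n")
          case True
          then have "\<alpha> j * decay e n j \<le> A * exp (e/2 * of_int (n - j)) * \<alpha> n * exp (- e * of_int (n - j))"
            using A(2)[of j n] by (auto simp: decay_def abs_minus_commute intro!: mult_right_mono)
          also have "\<dots> = A * \<alpha> n * (exp (e/2 * of_int (n - j)) * exp (- e * of_int (n - j)))" by simp
          also have "\<dots> = A * \<alpha> n * decay (e/2) n j"
            using True by (simp only: exp_add[symmetric]) (simp add: decay_def field_simps)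
          finally show ?thesis .
        qed (simp add: decay_def)
        have 2: "lq q (\<lambda>j. if k \<le> j then ennreal (\<alpha> j) * ennreal (decay e n j) else 0)
           \<le> (if k \<le> n then ennreal (A * S * \<alpha> n) else 0)" for k
        proof -
          have "lq q (\<lambda>j. if k \<le> j then ennreal (\<alpha> j) * ennreal (decay e n j) else 0)
             \<le> lq q (\<lambda>j. ennreal (if k \<le> n then A * \<alpha> n else 0) * ennreal (decay (e/2) n j))"
          proof (rule lq_mono)
            fix j
            show "(if k \<le> j then ennreal (\<alpha> j) * ennreal (decay e n j) else 0)
              \<le> ennreal (if k \<le> n then A * \<alpha> n else 0) * ennreal (decay (e/2) n j)"
            proof (cases "k \<le> j \<and> j \<le> n")
              case True
              then show ?thesis using 1[of j] A \<alpha> by (auto simp: ennreal_mult'[symmetric] ennreal_mult''[symmetric] intro!: ennreal_leI)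
            qed (auto simp: decay_def)
          qed
          also have "\<dots> = ennreal (if k \<le> n then A * \<alpha> n else 0) * lq q (\<lambda>j. ennreal (decay (e/2) n j))"
            using A \<alpha> rq by (intro lq_cmult) auto
          also have "\<dots> \<le> ennreal (if k \<le> n then A * \<alpha> n else 0) * ennreal S"
            by (intro mult_left_mono S) auto
          finally show ?thesis using A \<alpha> S by (auto simp: ennreal_mult'[symmetric] mult_ac)
        qed
        have "?N (\<lambda>j. ennreal (decay e n j)) \<le> lq r (\<lambda>k. ennreal (\<beta> k) * (if k \<le> n then ennreal (A * S * \<alpha> n) else 0))"
          unfolding dn_def by (intro lq_mono mult_left_mono 2) auto
        also have "\<dots> = lq r (\<lambda>k. ennreal (A * S) * (ennreal (\<beta> k) * (if k \<le> n then ennreal (\<alpha> n) else 0)))"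
          using A S by (intro arg_cong[of _ _ "lq r"] ext) (auto simp: ennreal_mult' mult_ac)
        also have "\<dots> = ennreal (A * S) * lq r (\<lambda>k. ennreal (\<beta> k) * (if k \<le> n then ennreal (\<alpha> n) else 0))"
          using A S rq by (intro lq_cmult) auto
        also have "\<dots> \<le> ennreal (A * S) * ?N (tail n)"
          by (intro mult_left_mono dn_tail_ge rq) auto
        finally show "?N (\<lambda>j. ennreal (decay e n j)) \<le> ennreal (A * S * c * enn2real (X n))"
          using ennreal_le_trans_mult[OF _ c(2), of _ "A * S" n] A S c X_eq by (simp add: ennreal_mult')
      qed (use A S c in auto)
    qed
  qed (use rq in \<open>auto intro: dn_mono simp: dn_cmult dn_add\<close>)
qed

text \<open>Weights at k and k + m differ by a bounded factor. Sampling from below turns weak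
  inequalities between indices into strict ones; a fixed shift repairs this.\<close>

lemma lq_sv_shift:
  assumes "0 < r" "sv_seq \<beta>"
  shows "\<exists>C>0. \<forall>F. lq r (\<lambda>k. ennreal (\<beta> k) * F k) \<le> ennreal C * lq r (\<lambda>k. ennreal (\<beta> k) * F (k + m))"
proof -
  obtain B where B: "B > 0" "\<And>i j. \<beta> i \<le> B * exp (1 * \<bar>of_int (i - j)\<bar>) * \<beta> j"
    using sv_seqE[OF assms(2), of 1] by auto
  show ?thesis
  proof (intro exI[of _ "B * exp \<bar>of_int m\<bar>"] conjI allI)
    fix F
    have "lq r (\<lambda>k. ennreal (\<beta> k) * F k) = lq r (\<lambda>k. ennreal (\<beta> (k + m)) * F (k + m))"
      by (rule lq_shift[symmetric])
    also have "\<dots> \<le> lq r (\<lambda>k. ennreal (B * exp \<bar>of_int m\<bar>) * (ennreal (\<beta> k) * F (k + m)))"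
    proof (rule lq_mono)
      fix k
      have "ennreal (\<beta> (k + m)) \<le> ennreal (B * exp \<bar>of_int m\<bar>) * ennreal (\<beta> k)"
        using B(2)[of "k + m" k] B(1) by (simp add: ennreal_mult'[symmetric] ennreal_leI)
      from mult_right_mono[OF this, of "F (k + m)"]
      show "ennreal (\<beta> (k + m)) * F (k + m) \<le> ennreal (B * exp \<bar>of_int m\<bar>) * (ennreal (\<beta> k) * F (k + m))"
        by (simp add: mult.assoc)
    qed
    also have "\<dots> = ennreal (B * exp \<bar>of_int m\<bar>) * lq r (\<lambda>k. ennreal (\<beta> k) * F (k + m))"
      using assms B by (intro lq_cmult) auto
    finally show "lq r (\<lambda>k. ennreal (\<beta> k) * F k) \<le> \<dots>" .
  qed (use B in auto)
qed

section \<open>Sampling\<close>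

text \<open>The weight x^(-1/p) of the norms turns Lebesgue measure into dx/x, for which all cells
  have equal mass.\<close>

lemma ennpow_powr_mult:
  assumes "0 < p" "0 < x"
  shows "ennpow (ennreal (x powr (- (1 / p))) * y) p = ennreal (1 / x) * ennpow y p"
proof -
  have "(x powr (- (1 / p))) powr p = x powr (- 1)"
    unfolding powr_powr using assms by simp
  also have "\<dots> = 1 / x" using assms by (simp add: powr_minus_divide)
  finally show ?thesis
    using ennpow_cmult[of "x powr (- (1 / p))" p y] assms(1) by (simp only: powr_ge_zero)
qed

definition idx :: "real \<Rightarrow> int" where "idx t = \<lfloor>ln t\<rfloor>"

lemma idx_exp [simp]: "idx (exp (of_int k)) = k" by (simp add: idx_def)

lemma idx_eq_iff: "0 < t \<Longrightarrow> idx t = k \<longleftrightarrow> exp (of_int k) \<le> t \<and> t < exp (of_int k + 1)"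
  by (simp add: idx_def floor_eq_iff ln_ge_iff) (metis exp_less_cancel_iff exp_ln)

lemma idx_bounds: "0 < t \<Longrightarrow> exp (of_int (idx t)) \<le> t" "0 < t \<Longrightarrow> t < exp (of_int (idx t) + 1)"
  using idx_eq_iff[of t "idx t"] by auto

lemma idx_mono: "0 < s \<Longrightarrow> s \<le> t \<Longrightarrow> idx s \<le> idx t"
  by (auto simp: idx_def intro!: floor_mono)

lemma less_if_idx_less: "0 < s \<Longrightarrow> 0 < t \<Longrightarrow> idx s < idx t \<Longrightarrow> s < t"
  using idx_mono[of t s] by linarith

lemma ln_idx_dist: "\<bar>ln t - of_int (idx t)\<bar> \<le> 1"
  unfolding idx_def by linarith

text \<open>The cell [exp k, exp (k + 1)) has length exp(k) (e - 1), so the factor exp(- k) gives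
  every cell the mass e - 1.\<close>

lemma nn_integral_cells:
  "(\<integral>\<^sup>+ x. (\<integral>\<^sup>+ k. ennreal (exp (- of_int k)) * H k * indicator {exp (real_of_int k)..<exp (real_of_int k + 1)} x
      \<partial>count_space (UNIV::int set)) \<partial>lebesgue) = ennreal (exp 1 - 1) * (\<integral>\<^sup>+ k. H k \<partial>count_space UNIV)"
proof -
  have "(\<integral>\<^sup>+ x. ennreal (exp (- of_int k)) * H k * indicator {exp (real_of_int k)..<exp (real_of_int k + 1)} x \<partial>lebesgue)
     = ennreal (exp 1 - 1) * H k" for k :: int
  proof -
    have "(\<integral>\<^sup>+ x. ennreal (exp (- of_int k)) * H k * indicator {exp (real_of_int k)..<exp (real_of_int k + 1)} x \<partial>lebesgue)
       = ennreal (exp (- of_int k)) * H k * ennreal (exp (of_int k + 1) - exp (of_int k))"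
      by (subst nn_integral_cmult_indicator) auto
    also have "\<dots> = ennreal (exp (- of_int k) * (exp (of_int k + 1) - exp (of_int k))) * H k"
      by (subst ennreal_mult) (auto simp: mult_ac)
    also have "exp (- of_int k) * (exp (of_int k + 1) - exp (of_int k)) = exp (1::real) - 1"
      by (simp add: exp_add exp_minus field_simps)
    finally show ?thesis .
  qed
  then show ?thesis
    by (subst nn_integral_count_space_nn_integral)
      (auto simp: nn_integral_cmult intro!: borel_measurable_times_ennreal borel_measurable_indicator)
qed

lemma cell_sum:
  assumes "0 < x"
  shows "(\<integral>\<^sup>+ k. ennreal (exp (- of_int k)) * H k * indicator {exp (real_of_int k)..<exp (real_of_int k + 1)} x
      \<partial>count_space (UNIV::int set)) = ennreal (exp (- of_int (idx x))) * H (idx x)"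
proof -
  have "indicator {exp (real_of_int k)..<exp (real_of_int k + 1)} x = (indicator {idx x} k :: ennreal)" for k
    using idx_eq_iff[OF assms, of k] by (auto simp: indicator_def)
  then show ?thesis by (simp add: nn_integral_indicator_singleton')
qed

text \<open>\<open>g\<close> is dominated by a function that is, up to the weight, constant on
  cells, so monotonicity of the integral suffices and \<open>g\<close> may be nonmeasurable. The
  constant 2 bounds e - 1.\<close>

lemma Lq_le_lq:
  assumes q: "0 < q" and S: "S \<in> sets lebesgue" "S \<subseteq> {0<..}"
    and g: "\<And>t. t \<in> S \<Longrightarrow> g t \<le> ennreal (t powr (- recip q)) * h (idx t)"
  shows "Lq q S g \<le> ennreal (2 powr recip q) * lq q h"
  using q
proof (cases rule: exponent_cases)
  case 1
  have "g t \<le> lq top h" if "t \<in> S" for t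
    using g[OF that] S(2) that lq_ge[of top h "idx t"] 1 by auto
  then have "AE x in lebesgue_on S. g x \<le> lq top h"
    by (intro AE_I2) (simp add: space_restrict_space)
  then show ?thesis using 1 by (auto simp: Lq_def intro!: Inf_lower)
next
  case (2 p)
  have "(\<integral>\<^sup>+ x. ennpow (g x) p \<partial>lebesgue_on S) = (\<integral>\<^sup>+ x. ennpow (g x) p * indicator S x \<partial>lebesgue)"
    using S by (intro nn_integral_restrict_space) auto
  also have "\<dots> \<le> (\<integral>\<^sup>+ x. (\<integral>\<^sup>+ k. ennreal (exp (- of_int k)) * ennpow (h k) p * indicator {exp (real_of_int k)..<exp (real_of_int k + 1)} x
      \<partial>count_space (UNIV::int set)) \<partial>lebesgue)"
  proof (rule nn_integral_mono)
    fix x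
    show "ennpow (g x) p * indicator S x \<le> (\<integral>\<^sup>+ k. ennreal (exp (- of_int k)) * ennpow (h k) p * indicator {exp (real_of_int k)..<exp (real_of_int k + 1)} x
      \<partial>count_space (UNIV::int set))"
    proof (cases "x \<in> S")
      case True
      then have x: "0 < x" using S by auto
      have "ennpow (g x) p \<le> ennpow (ennreal (x powr (- recip q)) * h (idx x)) p"
        using g[OF True] 2 by (intro ennpow_mono) auto
      also have "\<dots> = ennreal (1 / x) * ennpow (h (idx x)) p"
        using 2 x by (simp add: ennpow_powr_mult)
      also have "\<dots> \<le> ennreal (exp (- of_int (idx x))) * ennpow (h (idx x)) p"
        using idx_bounds[OF x] x by (intro mult_right_mono ennreal_leI) (auto simp: exp_minus field_simps)
      finally show ?thesis using True by (simp add: cell_sum[OF x])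
    qed auto
  qed
  also have "\<dots> \<le> ennreal 2 * (\<integral>\<^sup>+ k. ennpow (h k) p \<partial>count_space UNIV)"
    unfolding nn_integral_cells using exp_le by (intro mult_right_mono ennreal_leI) auto
  finally have "Lq q S g \<le> ennpow (ennreal 2 * (\<integral>\<^sup>+ k. ennpow (h k) p \<partial>count_space UNIV)) (1/p)"
    using 2 by (auto simp: Lq_def intro!: ennpow_mono)
  then show ?thesis using 2 by (simp add: ennpow_cmult lq_real del: ennreal_numeral)
qed

text \<open>Condition \<open>out\<close> makes \<open>h\<close> vanish on each cell that is not
  contained in \<open>S\<close>; on the other cells \<open>g\<close> dominates a step function. For
  finite q a cell contributes at least the fraction (e - 1)/e >= 1/2 of its term, as 1/x >= exp(- k
  - 1) there; hence the factor 2.\<close>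

lemma lq_le_Lq:
  assumes q: "0 < q" and S: "S \<in> sets lebesgue" "S \<subseteq> {0<..}"
    and g: "\<And>t. t \<in> S \<Longrightarrow> ennreal (t powr (- recip q)) * h (idx t) \<le> g t"
    and out: "\<And>t. 0 < t \<Longrightarrow> t \<notin> S \<Longrightarrow> h (idx t) = 0"
  shows "lq q h \<le> ennreal (2 powr recip q) * Lq q S g"
  using q
proof (cases rule: exponent_cases)
  case 1
  have "lq top h \<le> z" if z: "AE x in lebesgue_on S. g x \<le> z" for z
    unfolding lq_top
  proof (rule SUP_least)
    fix k
    show "h k \<le> z"
    proof (rule ccontr)
      assume neg: "\<not> h k \<le> z"
      let ?D = "{exp (real_of_int k)..<exp (real_of_int k + 1)} :: real set"
      have D: "0 < x" "idx x = k" if "x \<in> ?D" for x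
      proof -
        show "0 < x" using that by (auto intro: less_le_trans[OF exp_gt_zero])
        then show "idx x = k" using that by (simp add: idx_eq_iff)
      qed
      have *: "x \<in> S" "\<not> g x \<le> z" if "x \<in> ?D" for x
      proof -
        show "x \<in> S" using out[of x] D[OF that] neg by (metis zero_le)
        then show "\<not> g x \<le> z" using g[of x] D[OF that] neg 1 by auto
      qed
      have "AE x in lebesgue. x \<in> S \<longrightarrow> g x \<le> z"
        using z S by (subst (asm) AE_restrict_space_iff) auto
      \<comment> \<open>The bound \<open>z\<close> would fail on a whole cell, and cells have
        positive measure.\<close>
      then have "AE x in lebesgue. x \<notin> ?D"
        by eventually_elim (use * in blast)
      then have "emeasure lebesgue ?D = 0"
        by (subst (asm) AE_iff_measurable[of ?D]) auto
      then show False by simp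
    qed
  qed
  then show ?thesis using 1 by (auto simp: Lq_def intro!: Inf_greatest)
next
  case (2 p)
  let ?H = "\<lambda>k. ennreal (exp (- 1)) * ennpow (h k) p"
  have "ennreal (exp 1 - 1) * (\<integral>\<^sup>+ k. ?H k \<partial>count_space UNIV) =
     (\<integral>\<^sup>+ x. (\<integral>\<^sup>+ k. ennreal (exp (- of_int k)) * ?H k * indicator {exp (real_of_int k)..<exp (real_of_int k + 1)} x
      \<partial>count_space (UNIV::int set)) \<partial>lebesgue)"
    by (rule nn_integral_cells[symmetric])
  also have "\<dots> \<le> (\<integral>\<^sup>+ x. ennpow (g x) p * indicator S x \<partial>lebesgue)"
  proof (rule nn_integral_mono)
    fix x
    show "(\<integral>\<^sup>+ k. ennreal (exp (- of_int k)) * ?H k * indicator {exp (real_of_int k)..<exp (real_of_int k + 1)} x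
      \<partial>count_space (UNIV::int set)) \<le> ennpow (g x) p * indicator S x"
    proof (cases "0 < x")
      case x: True
      show ?thesis
      proof (cases "x \<in> S")
        case True
        have "ennreal (exp (- of_int (idx x))) * ?H (idx x) \<le> ennreal (1 / x) * ennpow (h (idx x)) p"
        proof -
          have "exp (- of_int (idx x)) * exp (- 1) \<le> 1 / x"
            using idx_bounds(2)[OF x] x by (simp add: exp_add exp_minus field_simps)
          from mult_right_mono[OF ennreal_leI[OF this], of "ennpow (h (idx x)) p"]
          show ?thesis by (simp add: ennreal_mult' mult.assoc)
        qed
        also have "ennreal (1 / x) * ennpow (h (idx x)) p = ennpow (ennreal (x powr (- recip q)) * h (idx x)) p"
          using 2 x by (simp add: ennpow_powr_mult)
        also have "\<dots> \<le> ennpow (g x) p"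
          using g[OF True] 2 by (intro ennpow_mono) auto
        finally show ?thesis using True by (simp add: cell_sum[OF x])
      qed (use out[OF x] in \<open>simp add: cell_sum[OF x]\<close>)
    next
      case False
      then have "indicator {exp (real_of_int k)..<exp (real_of_int k + 1)} x = (0::ennreal)" for k :: int
        using exp_gt_zero[of "of_int k :: real"] by (auto simp: indicator_def simp del: exp_gt_zero)
      then show ?thesis by simp
    qed
  qed
  also have "(\<integral>\<^sup>+ x. ennpow (g x) p * indicator S x \<partial>lebesgue) = (\<integral>\<^sup>+ x. ennpow (g x) p \<partial>lebesgue_on S)"
    using S by (intro nn_integral_restrict_space[symmetric]) auto
  finally have *: "ennreal ((exp 1 - 1) * exp (- 1)) * (\<integral>\<^sup>+ k. ennpow (h k) p \<partial>count_space UNIV)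
     \<le> (\<integral>\<^sup>+ x. ennpow (g x) p \<partial>lebesgue_on S)"
    by (simp add: nn_integral_cmult ennreal_mult mult.assoc)
  have "1 \<le> 2 * ((exp 1 - 1) * exp (- (1::real)))"
    using exp_ge_add_one_self[of "1::real"] by (simp add: exp_minus field_simps)
  from mult_right_mono[OF ennreal_leI[OF this] zero_le, of "\<integral>\<^sup>+ k. ennpow (h k) p \<partial>count_space UNIV"]
  have "(\<integral>\<^sup>+ k. ennpow (h k) p \<partial>count_space UNIV) \<le> ennreal 2 * (ennreal ((exp 1 - 1) * exp (- 1)) *
     (\<integral>\<^sup>+ k. ennpow (h k) p \<partial>count_space UNIV))"
    by (simp only: ennreal_mult' mult.assoc ennreal_1 mult_1)
  also have "\<dots> \<le> ennreal 2 * (\<integral>\<^sup>+ x. ennpow (g x) p \<partial>lebesgue_on S)"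
    by (intro mult_left_mono *) auto
  finally have "lq q h \<le> ennpow (ennreal 2 * (\<integral>\<^sup>+ x. ennpow (g x) p \<partial>lebesgue_on S)) (1/p)"
    using 2 by (auto simp: lq_real intro!: ennpow_mono)
  then show ?thesis using 2 by (simp add: ennpow_cmult Lq_def del: ennreal_numeral)
qed

lemma ennreal_inverse_cancel:
  assumes "0 < c"
  shows "ennreal (inverse c) * (ennreal c * x) = x" "ennreal c * (ennreal (inverse c) * x) = x"
  using assms by (simp_all add: mult.assoc[symmetric] ennreal_mult'[symmetric])

section \<open>Slow variation on the half-line and regularity on cells\<close>

text \<open>In contrast to \<^const>\<open>SV\<close>, no measurability is required: it may fail for \<open>a \<circ> \<rho>\<close>, and sampling
  does not need it.\<close>

definition svf :: "(real \<Rightarrow> real) \<Rightarrow> bool" where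
  "svf f \<longleftrightarrow> (\<forall>t>0. 0 < f t) \<and>
     (\<forall>e>0. \<exists>C>0. \<forall>s>0. \<forall>t>0. f s \<le> C * exp (e * \<bar>ln s - ln t\<bar>) * f t)"

lemma svf_pos: "svf f \<Longrightarrow> 0 < t \<Longrightarrow> 0 < f t"
  by (simp add: svf_def)

lemma svfE:
  assumes "svf f" "0 < e"
  obtains C where "0 < C" "\<And>s t. 0 < s \<Longrightarrow> 0 < t \<Longrightarrow> f s \<le> C * exp (e * \<bar>ln s - ln t\<bar>) * f t"
proof -
  from assms have "\<exists>C>0. \<forall>s>0. \<forall>t>0. f s \<le> C * exp (e * \<bar>ln s - ln t\<bar>) * f t"
    by (simp add: svf_def)
  then obtain C where C: "0 < C" "\<forall>s>0. \<forall>t>0. f s \<le> C * exp (e * \<bar>ln s - ln t\<bar>) * f t"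
    by (elim exE conjE)
  show ?thesis by (rule that[OF C(1)]) (rule C(2)[rule_format])
qed

lemma equiv_pos_mono:
  assumes "equiv_pos f g" "\<forall>t>0. 0 < f t"
  obtains C where "0 < C" "\<And>s t. 0 < s \<Longrightarrow> 0 < t \<Longrightarrow> g s \<le> g t \<Longrightarrow> f s \<le> C * f t"
proof -
  obtain C where C: "C > 0" "\<And>t. 0 < t \<Longrightarrow> inverse C * g t \<le> f t \<and> f t \<le> C * g t"
    using assms unfolding equiv_pos_def by blast
  have "f s \<le> (C * C) * f t" if "0 < s" "0 < t" "g s \<le> g t" for s t
  proof -
    have "f s \<le> C * g s" using C(2)[OF that(1)] by simp
    also have "\<dots> \<le> C * g t" using C(1) that by simp
    also have "g t \<le> C * f t" using C(2)[OF that(2)] C(1) by (simp add: field_simps)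
    finally show ?thesis using C(1) by (simp add: mult.assoc)
  qed
  then show ?thesis using that[of "C * C"] C(1) by simp
qed

text \<open>For s <= t the increasing equivalent of t^e b(t) gives the bound, for s > t the
  decreasing equivalent of t^(-e) b(t); together they are Potter's bound.\<close>

lemma SV_svf:
  assumes "b \<in> SV" shows "svf b"
  unfolding svf_def
proof (intro conjI allI impI)
  show pos: "0 < b t" if "0 < t" for t using assms that by (simp add: SV_def)
  fix e :: real assume "0 < e"
  then obtain g h where g: "mono_on {0<..} g" "equiv_pos (\<lambda>t. t powr e * b t) g"
    and h: "antimono_on {0<..} h" "equiv_pos (\<lambda>t. t powr (- e) * b t) h"
    using assms unfolding SV_def by blast
  obtain C where C: "0 < C" "\<And>s t. 0 < s \<Longrightarrow> 0 < t \<Longrightarrow> g s \<le> g t \<Longrightarrow> s powr e * b s \<le> C * (t powr e * b t)"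
    using equiv_pos_mono[OF g(2)] pos by auto
  obtain D where D: "0 < D" "\<And>s t. 0 < s \<Longrightarrow> 0 < t \<Longrightarrow> h s \<le> h t \<Longrightarrow> s powr (- e) * b s \<le> D * (t powr (- e) * b t)"
    using equiv_pos_mono[OF h(2)] pos by auto
  have quot: "t powr x * y / (s powr x) = exp (x * (ln t - ln s)) * y" if "0 < s" "0 < t" for s t x y :: real
    using that by (simp add: powr_def exp_diff right_diff_distrib)
  have "b s \<le> max C D * exp (e * \<bar>ln s - ln t\<bar>) * b t" if st: "0 < s" "0 < t" for s t
  proof (cases "s \<le> t")
    case True
    then have "s powr e * b s \<le> C * (t powr e * b t)"
      using g(1) st by (intro C) (auto simp: monotone_on_def)
    then have "b s \<le> C * (t powr e * b t / s powr e)"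
      using st by (simp add: field_simps)
    also have "\<dots> = C * (exp (e * \<bar>ln s - ln t\<bar>) * b t)"
      using True st by (simp add: quot)
    also have "\<dots> \<le> max C D * (exp (e * \<bar>ln s - ln t\<bar>) * b t)"
      using pos[OF st(2)] by (intro mult_right_mono) auto
    finally show ?thesis by (simp add: mult.assoc)
  next
    case False
    then have "s powr (- e) * b s \<le> D * (t powr (- e) * b t)"
      using h(1) st by (intro D) (auto simp: monotone_on_def)
    from divide_right_mono[OF this, of "s powr (- e)"]
    have "b s \<le> D * (t powr (- e) * b t / s powr (- e))"
      using st nonzero_mult_div_cancel_left[of "s powr (- e)" "b s"] by (simp only: times_divide_eq_right) simp
    also have "\<dots> = D * (exp (e * \<bar>ln s - ln t\<bar>) * b t)"
      using False st by (subst quot) (auto simp: algebra_simps)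
    also have "\<dots> \<le> max C D * (exp (e * \<bar>ln s - ln t\<bar>) * b t)"
      using pos[OF st(2)] by (intro mult_right_mono) auto
    finally show ?thesis by (simp add: mult.assoc)
  qed
  then show "\<exists>C>0. \<forall>s>0. \<forall>t>0. b s \<le> C * exp (e * \<bar>ln s - ln t\<bar>) * b t"
    using C(1) by (intro exI[of _ "max C D"]) auto
qed

text \<open>Comparability with the value at the left endpoint of the cell, which is what sampling
  requires. The constant is a parameter because the functions K(t, f) share it for all f, and
  estimates must be uniform in f.\<close>

definition reg :: "real \<Rightarrow> (real \<Rightarrow> real) \<Rightarrow> bool" where
  "reg c \<phi> \<longleftrightarrow> 0 < c \<and> (\<forall>t>0. 0 \<le> \<phi> t \<and> \<phi> t \<le> c * \<phi> (exp (of_int (idx t))) \<and> \<phi> (exp (of_int (idx t))) \<le> c * \<phi> t)"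

lemma svf_reg:
  assumes "svf f" obtains c where "reg c f"
proof -
  obtain C where C: "0 < C" "\<And>s t. 0 < s \<Longrightarrow> 0 < t \<Longrightarrow> f s \<le> C * exp (1 * \<bar>ln s - ln t\<bar>) * f t"
    using svfE[OF assms, of 1] by auto
  have *: "f s \<le> C * exp 1 * f t" if "0 < s" "0 < t" "\<bar>ln s - ln t\<bar> \<le> 1" for s t
  proof -
    have "f s \<le> C * exp (1 * \<bar>ln s - ln t\<bar>) * f t" using C that by auto
    also have "\<dots> \<le> C * exp 1 * f t"
      using C that svf_pos[OF assms that(2)] by (intro mult_right_mono mult_left_mono) auto
    finally show ?thesis .
  qed
  have "reg (C * exp 1) f"
    unfolding reg_def using C svf_pos[OF assms] ln_idx_dist
    by (auto intro!: * less_imp_le[OF svf_pos[OF assms]] simp: abs_minus_commute)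
  then show ?thesis by (rule that)
qed

lemma reg_mult: "reg c f \<Longrightarrow> reg d g \<Longrightarrow> reg (c * d) (\<lambda>t. f t * g t)"
  unfolding reg_def
proof (intro conjI allI impI; (elim conjE)?)
  fix t :: real assume 0: "0 < c" "0 < d" and t: "0 < t"
    and f: "\<forall>t>0. 0 \<le> f t \<and> f t \<le> c * f (exp (of_int (idx t))) \<and> f (exp (of_int (idx t))) \<le> c * f t"
    and g: "\<forall>t>0. 0 \<le> g t \<and> g t \<le> d * g (exp (of_int (idx t))) \<and> g (exp (of_int (idx t))) \<le> d * g t"
  let ?s = "exp (of_int (idx t))"
  show "0 \<le> f t * g t" using f g t by simp
  have "f t * g t \<le> (c * f ?s) * (d * g ?s)"
    using f g t 0 by (intro mult_mono) auto
  then show "f t * g t \<le> c * d * (f ?s * g ?s)" by (simp add: mult_ac)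
  have "f ?s * g ?s \<le> (c * f t) * (d * g t)"
    using f g t 0 by (intro mult_mono) auto
  then show "f ?s * g ?s \<le> c * d * (f t * g t)" by (simp add: mult_ac)
qed auto

section \<open>Sampling on half-lines in both directions\<close>

text \<open>The two directions \<open>\<sigma> = \<plusminus>1\<close> on the half-line serve the \<open>\<R>\<close>- and the \<open>\<L>\<close>-constructions
  at the same time.\<close>

definition after :: "int \<Rightarrow> real \<Rightarrow> real set" where
  "after \<sigma> s = {u. 0 < u \<and> of_int \<sigma> * s < of_int \<sigma> * u}"

definition before :: "int \<Rightarrow> real \<Rightarrow> real set" where
  "before \<sigma> s = {u. 0 < u \<and> of_int \<sigma> * u < of_int \<sigma> * s}"

definition ix :: "int \<Rightarrow> real \<Rightarrow> int" where "ix \<sigma> t = \<sigma> * idx t"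

text \<open>Reversal acts on the index only: for \<sigma> = - 1 the sample point of a cell is still
  its left endpoint.\<close>

definition pt :: "int \<Rightarrow> int \<Rightarrow> real" where "pt \<sigma> k = exp (of_int (\<sigma> * k))"

lemma pt_pos [simp]: "0 < pt \<sigma> k" by (simp add: pt_def)

lemma after_before:
  "0 < s \<Longrightarrow> after 1 s = {s<..}" "0 < s \<Longrightarrow> after (- 1) s = {0<..<s}"
  "before 1 s = {0<..<s}" "0 < s \<Longrightarrow> before (- 1) s = {s<..}"
  by (auto simp: after_def before_def)

locale direction =
  fixes \<sigma> :: int
  assumes dir: "\<sigma> = 1 \<or> \<sigma> = - 1"
begin

lemma dir_square: "\<sigma> * \<sigma> = 1" "\<sigma> * (\<sigma> * k) = k"
  using dir by auto

lemma pt_ix: "pt \<sigma> (ix \<sigma> t) = exp (of_int (idx t))"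
  using dir by (auto simp: pt_def ix_def)

lemma ix_pt [simp]: "ix \<sigma> (pt \<sigma> k) = k"
  unfolding pt_def ix_def idx_exp by (simp add: dir_square)

lemma after_sets [measurable, simp]: "0 < s \<Longrightarrow> after \<sigma> s \<in> sets lebesgue" "after \<sigma> s \<subseteq> {0<..}"
  and before_sets [measurable, simp]: "0 < s \<Longrightarrow> before \<sigma> s \<in> sets lebesgue" "before \<sigma> s \<subseteq> {0<..}"
  using dir by (auto simp: after_before) (auto simp: after_def before_def)

lemma after_ix: "0 < s \<Longrightarrow> u \<in> after \<sigma> s \<Longrightarrow> ix \<sigma> s \<le> ix \<sigma> u"
  using dir by (auto simp: after_def ix_def intro!: idx_mono)

lemma before_ix: "0 < s \<Longrightarrow> u \<in> before \<sigma> s \<Longrightarrow> ix \<sigma> u \<le> ix \<sigma> s"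
  using dir by (auto simp: before_def ix_def intro!: idx_mono)

lemma ix_less:
  assumes "0 < s" "0 < u" "ix \<sigma> s < ix \<sigma> u" shows "u \<in> after \<sigma> s" "s \<in> before \<sigma> u"
  using dir assms less_if_idx_less[of s u] less_if_idx_less[of u s]
  by (auto simp: after_def before_def ix_def)

lemma lq_dir: "lq q (\<lambda>k. h (\<sigma> * k)) = lq q h"
  using dir lq_uminus[of q h] by auto

lemma Lq_le_lq_dir:
  assumes "0 < q" "S \<in> sets lebesgue" "S \<subseteq> {0<..}"
    and "\<And>t. t \<in> S \<Longrightarrow> g t \<le> ennreal (t powr (- recip q)) * h (ix \<sigma> t)"
  shows "Lq q S g \<le> ennreal (2 powr recip q) * lq q h"
  using Lq_le_lq[of q S g "\<lambda>k. h (\<sigma> * k)"] assms by (simp add: lq_dir ix_def)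

lemma lq_le_Lq_dir:
  assumes "0 < q" "S \<in> sets lebesgue" "S \<subseteq> {0<..}"
    and "\<And>t. t \<in> S \<Longrightarrow> ennreal (t powr (- recip q)) * h (ix \<sigma> t) \<le> g t"
    and "\<And>t. 0 < t \<Longrightarrow> t \<notin> S \<Longrightarrow> h (ix \<sigma> t) = 0"
  shows "lq q h \<le> ennreal (2 powr recip q) * Lq q S g"
  using lq_le_Lq[of q S "\<lambda>k. h (\<sigma> * k)" g] assms by (simp add: lq_dir ix_def)

lemma reg_pt:
  assumes "reg c \<phi>" "0 < t"
  shows "0 \<le> \<phi> t" "\<phi> t \<le> c * \<phi> (pt \<sigma> (ix \<sigma> t))" "\<phi> (pt \<sigma> (ix \<sigma> t)) \<le> c * \<phi> t" "0 < c"
  using assms by (auto simp: reg_def pt_ix)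

text \<open>Here \<open>P\<close> must hold for every cell that meets \<open>S\<close>, whereas in
  \<open>Lq_wt_ge\<close> it may select only cells contained in \<open>S\<close>. This asymmetry is
  the source of the weak index inequalities in upper estimates and the strict ones in lower
  estimates.\<close>

lemma Lq_wt_le:
  assumes "0 < q" "S \<in> sets lebesgue" "S \<subseteq> {0<..}" "reg c \<phi>" "\<And>u. u \<in> S \<Longrightarrow> P (ix \<sigma> u)"
  shows "Lq q S (wt q \<phi>) \<le> ennreal (2 powr recip q * c) * lq q (\<lambda>j. if P j then ennreal (\<phi> (pt \<sigma> j)) else 0)"
proof -
  have c: "0 < c" using assms(4) by (simp add: reg_def)
  have "Lq q S (wt q \<phi>) \<le> ennreal (2 powr recip q) *
      lq q (\<lambda>j. ennreal c * (if P j then ennreal (\<phi> (pt \<sigma> j)) else 0))"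
  proof (rule Lq_le_lq_dir)
    fix t assume t: "t \<in> S"
    then have "0 < t" using assms(3) by auto
    then have "wt q \<phi> t \<le> ennreal (t powr - recip q * (c * \<phi> (pt \<sigma> (ix \<sigma> t))))"
      unfolding wt_def using reg_pt[OF assms(4)] by (intro ennreal_leI mult_left_mono) auto
    then show "wt q \<phi> t \<le> ennreal (t powr - recip q) *
         (ennreal c * (if P (ix \<sigma> t) then ennreal (\<phi> (pt \<sigma> (ix \<sigma> t))) else 0))"
      using c assms(5)[OF t] by (simp add: ennreal_mult')
  qed fact+
  then show ?thesis using c assms(1) by (simp add: lq_cmult ennreal_mult' mult.assoc)
qed

lemma Lq_wt_ge:
  assumes "0 < q" "S \<in> sets lebesgue" "S \<subseteq> {0<..}" "reg c \<phi>"
    and "\<And>u. 0 < u \<Longrightarrow> P (ix \<sigma> u) \<Longrightarrow> u \<in> S"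
  shows "lq q (\<lambda>j. if P j then ennreal (\<phi> (pt \<sigma> j)) else 0) \<le> ennreal (2 powr recip q * c) * Lq q S (wt q \<phi>)"
proof -
  let ?h = "\<lambda>j. ennreal (inverse c) * (if P j then ennreal (\<phi> (pt \<sigma> j)) else 0)"
  have c: "0 < c" using assms(4) by (simp add: reg_def)
  have *: "lq q ?h \<le> ennreal (2 powr recip q) * Lq q S (wt q \<phi>)"
  proof (rule lq_le_Lq_dir)
    fix t assume t: "t \<in> S"
    then have "0 < t" using assms(3) by auto
    then have "ennreal (t powr - recip q * (inverse c * \<phi> (pt \<sigma> (ix \<sigma> t)))) \<le> wt q \<phi> t"
      unfolding wt_def using reg_pt[OF assms(4)] c by (intro ennreal_leI mult_left_mono) (auto simp: field_simps)
    then show "ennreal (t powr - recip q) * ?h (ix \<sigma> t) \<le> wt q \<phi> t"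
      using c by (auto simp: ennreal_mult')
  qed (use assms in auto)
  have "lq q (\<lambda>j. if P j then ennreal (\<phi> (pt \<sigma> j)) else 0) = ennreal c * lq q ?h"
    using c assms(1) unfolding lq_cmult[OF assms(1) less_imp_le[OF c], symmetric]
    by (simp add: mult.assoc[symmetric] ennreal_mult'[symmetric])
  also have "\<dots> \<le> ennreal c * (ennreal (2 powr recip q) * Lq q S (wt q \<phi>))"
    by (intro mult_left_mono *) auto
  finally show ?thesis using c by (simp add: ennreal_mult' mult_ac)
qed

text \<open>The inner norm is sampled with a constant independent of s, then the outer one. The
  general ranges \<open>T\<close> and \<open>S\<close> cover the full norm, the truncated norm and
  the first summand of \<chi> at once.\<close>

lemma double_le:
  assumes "0 < r" "0 < q" "T \<in> sets lebesgue" "T \<subseteq> {0<..}" "reg D b" "reg c \<phi>"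
    and S: "\<And>s. s \<in> T \<Longrightarrow> S s \<in> sets lebesgue" "\<And>s. s \<in> T \<Longrightarrow> S s \<subseteq> {0<..}"
    and Q: "\<And>s. s \<in> T \<Longrightarrow> Q (ix \<sigma> s)" and P: "\<And>s u. s \<in> T \<Longrightarrow> u \<in> S s \<Longrightarrow> P (ix \<sigma> s) (ix \<sigma> u)"
  shows "Lq r T (\<lambda>s. wt r b s * Lq q (S s) (wt q \<phi>)) \<le> ennreal (2 powr recip r * D * (2 powr recip q * c)) *
    lq r (\<lambda>k. if Q k then ennreal (b (pt \<sigma> k)) * lq q (\<lambda>j. if P k j then ennreal (\<phi> (pt \<sigma> j)) else 0) else 0)"
proof -
  let ?L = "\<lambda>k. lq q (\<lambda>j. if P k j then ennreal (\<phi> (pt \<sigma> j)) else 0)"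
  let ?A = "2 powr recip q * c"
  have c: "0 < c" "0 < D" using assms by (simp_all add: reg_def)
  have "Lq r T (\<lambda>s. wt r b s * Lq q (S s) (wt q \<phi>)) \<le> ennreal (2 powr recip r) *
     lq r (\<lambda>k. ennreal (D * ?A) * (if Q k then ennreal (b (pt \<sigma> k)) * ?L k else 0))"
  proof (rule Lq_le_lq_dir)
    fix s assume s: "s \<in> T"
    then have "0 < s" using assms(4) by auto
    then have "wt r b s \<le> ennreal (s powr - recip r * (D * b (pt \<sigma> (ix \<sigma> s))))"
      unfolding wt_def using reg_pt[OF assms(5)] by (intro ennreal_leI mult_left_mono) auto
    moreover have "Lq q (S s) (wt q \<phi>) \<le> ennreal ?A * ?L (ix \<sigma> s)"
      using assms s by (intro Lq_wt_le) auto
    ultimately have "wt r b s * Lq q (S s) (wt q \<phi>) \<le>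
        ennreal (s powr - recip r * (D * b (pt \<sigma> (ix \<sigma> s)))) * (ennreal ?A * ?L (ix \<sigma> s))"
      by (rule mult_mono) auto
    also have "\<dots> = ennreal (s powr - recip r) * (ennreal (D * ?A) * (ennreal (b (pt \<sigma> (ix \<sigma> s))) * ?L (ix \<sigma> s)))"
      using c by (simp add: ennreal_mult' mult_ac)
    finally show "wt r b s * Lq q (S s) (wt q \<phi>) \<le> ennreal (s powr - recip r) * (ennreal (D * ?A) *
       (if Q (ix \<sigma> s) then ennreal (b (pt \<sigma> (ix \<sigma> s))) * ?L (ix \<sigma> s) else 0))"
      using Q[OF s] by simp
  qed fact+
  then show ?thesis using c assms(1) by (simp add: lq_cmult ennreal_mult' mult.assoc)
qed

lemma double_ge:
  assumes "0 < r" "0 < q" "T \<in> sets lebesgue" "T \<subseteq> {0<..}" "reg D b" "reg c \<phi>"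
    and S: "\<And>s. s \<in> T \<Longrightarrow> S s \<in> sets lebesgue" "\<And>s. s \<in> T \<Longrightarrow> S s \<subseteq> {0<..}"
    and Q: "\<And>s. 0 < s \<Longrightarrow> Q (ix \<sigma> s) \<Longrightarrow> s \<in> T"
    and P: "\<And>s u. s \<in> T \<Longrightarrow> 0 < u \<Longrightarrow> P (ix \<sigma> s) (ix \<sigma> u) \<Longrightarrow> u \<in> S s"
  shows "lq r (\<lambda>k. if Q k then ennreal (b (pt \<sigma> k)) * lq q (\<lambda>j. if P k j then ennreal (\<phi> (pt \<sigma> j)) else 0) else 0)
     \<le> ennreal (2 powr recip r * D * (2 powr recip q * c)) * Lq r T (\<lambda>s. wt r b s * Lq q (S s) (wt q \<phi>))"
proof -
  let ?L = "\<lambda>k. lq q (\<lambda>j. if P k j then ennreal (\<phi> (pt \<sigma> j)) else 0)"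
  let ?A = "2 powr recip q * c"
  have c: "0 < c" "0 < D" using assms by (simp_all add: reg_def)
  let ?F = "\<lambda>k. if Q k then ennreal (b (pt \<sigma> k)) * ?L k else 0"
  have *: "lq r (\<lambda>k. ennreal (inverse (D * ?A)) * ?F k)
     \<le> ennreal (2 powr recip r) * Lq r T (\<lambda>s. wt r b s * Lq q (S s) (wt q \<phi>))"
  proof (rule lq_le_Lq_dir)
    fix s assume s: "s \<in> T"
    then have s0: "0 < s" using assms(4) by auto
    then have "ennreal (inverse D * b (pt \<sigma> (ix \<sigma> s))) \<le> ennreal (b s)"
      using reg_pt[OF assms(5)] c by (intro ennreal_leI) (auto simp: field_simps)
    moreover have "ennreal (inverse ?A) * ?L (ix \<sigma> s) \<le> Lq q (S s) (wt q \<phi>)"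
    proof -
      have "?L (ix \<sigma> s) \<le> ennreal ?A * Lq q (S s) (wt q \<phi>)"
        using assms s by (intro Lq_wt_ge) auto
      then have "ennreal (inverse ?A) * ?L (ix \<sigma> s) \<le> ennreal (inverse ?A) * (ennreal ?A * Lq q (S s) (wt q \<phi>))"
        by (rule mult_left_mono) auto
      also have "\<dots> = Lq q (S s) (wt q \<phi>)"
        using c by (intro ennreal_inverse_cancel) auto
      finally show ?thesis .
    qed
    ultimately have 1: "ennreal (s powr - recip r) * (ennreal (inverse D * b (pt \<sigma> (ix \<sigma> s))) * (ennreal (inverse ?A) * ?L (ix \<sigma> s)))
      \<le> ennreal (s powr - recip r) * (ennreal (b s) * Lq q (S s) (wt q \<phi>))"
      by (intro mult_left_mono mult_mono) auto
    have "ennreal (inverse (D * ?A)) * ?F (ix \<sigma> s) \<le> ennreal (inverse D * b (pt \<sigma> (ix \<sigma> s))) * (ennreal (inverse ?A) * ?L (ix \<sigma> s))"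
      using c unfolding inverse_mult_distrib[of D] by (auto simp: ennreal_mult' mult_ac)
    from mult_left_mono[OF this zero_le, of "ennreal (s powr - recip r)"]
    have "ennreal (s powr - recip r) * (ennreal (inverse (D * ?A)) * ?F (ix \<sigma> s)) \<le> ennreal (s powr - recip r) * (ennreal (b s) * Lq q (S s) (wt q \<phi>))"
      using 1 by (rule order.trans)
    moreover have "wt r b s * y = ennreal (s powr - recip r) * (ennreal (b s) * y)" for y
      by (simp add: wt_def ennreal_mult' mult.assoc)
    ultimately show "ennreal (s powr - recip r) * (ennreal (inverse (D * ?A)) * ?F (ix \<sigma> s)) \<le> wt r b s * Lq q (S s) (wt q \<phi>)"
      by (simp only:)
  qed (use assms in auto)
  have "lq r ?F = ennreal (D * ?A) * lq r (\<lambda>k. ennreal (inverse (D * ?A)) * ?F k)"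
  proof -
    have "ennreal (D * ?A) * (ennreal (inverse (D * ?A)) * x) = x" for x
      using c by (intro ennreal_inverse_cancel) auto
    then show ?thesis
      using c assms(1) by (subst lq_cmult[symmetric]) auto
  qed
  also have "\<dots> \<le> ennreal (D * ?A) * (ennreal (2 powr recip r) * Lq r T (\<lambda>s. wt r b s * Lq q (S s) (wt q \<phi>)))"
    by (intro mult_left_mono *) auto
  finally show ?thesis using c by (simp add: ennreal_mult' mult_ac)
qed

end

lemma after_pos: "u \<in> after \<sigma> s \<Longrightarrow> 0 < u" and before_pos: "u \<in> before \<sigma> s \<Longrightarrow> 0 < u"
  by (simp_all add: after_def before_def)

lemma reg_weaken:
  assumes "reg d \<kappa>" "d \<le> d'" shows "reg d' \<kappa>"
proof -
  have "d * x \<le> d' * x" if "0 \<le> x" for x using assms(2) that by (rule mult_right_mono)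
  then show ?thesis using assms unfolding reg_def by (meson exp_gt_zero order.trans less_le_trans)
qed

text \<open>The factor may be infinite, as the inner norm of a tail is until its finiteness has been
  derived. Then both sides are infinite unless \<open>g\<close> vanishes.\<close>

lemma lq_multc:
  assumes "0 < q" shows "lq q (\<lambda>k. g k * B) = lq q g * B"
proof (cases B)
  case (real x)
  then show ?thesis using lq_cmult[OF assms, of x g] by (simp add: mult.commute)
next
  case top
  show ?thesis
  proof (cases "\<forall>k. g k = 0")
    case True
    then have "g = (\<lambda>_. 0)" by (intro ext) simp
    then show ?thesis using lq_cmult[OF assms, of 0 "\<lambda>_. 0"] by simp
  next
    case False
    then obtain k where "g k \<noteq> 0" by blast
    then have "lq q g \<noteq> 0" "top \<le> lq q (\<lambda>k. g k * B)"
      using lq_ge[OF assms, of g k] lq_ge[OF assms, of "\<lambda>k. g k * B" k] top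
      by (auto simp: ennreal_mult_top)
    then show ?thesis using top by (auto simp: top_unique ennreal_mult_top)
  qed
qed

text \<open>The bracket is what sampling from below retains of \<chi>, with strict inequalities in
  place of weak ones. The outer sum is split into k <= n + 1 and k >= n + 2; shifting the outer
  index by 2 and by 1 produces exactly k < n and n < k.\<close>

lemma dn_tail_split:
  assumes "0 < r" "0 < q" "sv_seq \<beta>"
  shows "\<exists>C>0. \<forall>n. dn r \<beta> q \<alpha> (tail (n + 2)) \<le> ennreal C *
    (lq r (\<lambda>k. if k < n then ennreal (\<beta> k) else 0) * lq q (\<lambda>j. if n + 1 < j then ennreal (\<alpha> j) else 0) +
     lq r (\<lambda>k. if n < k then ennreal (\<beta> k) * lq q (\<lambda>j. if k < j then ennreal (\<alpha> j) else 0) else 0))"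
proof -
  obtain A where A: "1 \<le> A" "\<And>g h. lq r (\<lambda>k. g k + h k) \<le> ennreal A * (lq r g + lq r h)"
    using lq_add[OF assms(1)] by blast
  obtain C1 where C1: "C1 > 0" "\<And>F. lq r (\<lambda>k. ennreal (\<beta> k) * F k) \<le> ennreal C1 * lq r (\<lambda>k. ennreal (\<beta> k) * F (k + 1))"
    using lq_sv_shift[OF assms(1,3), of 1] by blast
  obtain C2 where C2: "C2 > 0" "\<And>F. lq r (\<lambda>k. ennreal (\<beta> k) * F k) \<le> ennreal C2 * lq r (\<lambda>k. ennreal (\<beta> k) * F (k + 2))"
    using lq_sv_shift[OF assms(1,3), of 2] by blast
  let ?C = "max C1 C2"
  show ?thesis
  proof (intro exI[of _ "A * ?C"] conjI allI)
    fix n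
    define B where "B = lq q (\<lambda>j. if n + 1 < j then ennreal (\<alpha> j) else 0)"
    define L where "L k = lq q (\<lambda>j. if k \<le> j then ennreal (\<alpha> j) else 0)" for k
    have L: "L (k + 1) = lq q (\<lambda>j. if k < j then ennreal (\<alpha> j) else 0)" for k
      unfolding L_def by (intro arg_cong[of _ _ "lq q"] ext) auto
    define F1 where "F1 k = (if k \<le> n + 1 then B else 0)" for k
    define F2 where "F2 k = (if n + 2 \<le> k then L k else 0)" for k
    have "dn r \<beta> q \<alpha> (tail (n + 2)) \<le> lq r (\<lambda>k. ennreal (\<beta> k) * F1 k + ennreal (\<beta> k) * F2 k)"
      unfolding dn_def
    proof (rule lq_mono)
      fix k
      have "lq q (\<lambda>j. if k \<le> j then ennreal (\<alpha> j) * tail (n + 2) j else 0) \<le> F1 k + F2 k"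
      proof (cases "k \<le> n + 1")
        case True
        then show ?thesis by (auto simp: F1_def F2_def B_def tail_def intro!: lq_mono)
      next
        case False
        then show ?thesis by (auto simp: F1_def F2_def L_def tail_def intro!: lq_mono)
      qed
      from mult_left_mono[OF this zero_le, of "ennreal (\<beta> k)"]
      show "ennreal (\<beta> k) * lq q (\<lambda>j. if k \<le> j then ennreal (\<alpha> j) * tail (n + 2) j else 0)
         \<le> ennreal (\<beta> k) * F1 k + ennreal (\<beta> k) * F2 k" by (simp add: distrib_left)
    qed
    also have "\<dots> \<le> ennreal A * (lq r (\<lambda>k. ennreal (\<beta> k) * F1 k) + lq r (\<lambda>k. ennreal (\<beta> k) * F2 k))"
      by (rule A)
    also have "\<dots> \<le> ennreal A * (ennreal ?C * lq r (\<lambda>k. ennreal (\<beta> k) * F1 (k + 2)) + ennreal ?C * lq r (\<lambda>k. ennreal (\<beta> k) * F2 (k + 1)))"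
      using C1 C2
      by (intro mult_left_mono add_mono order.trans[OF C1(2)] order.trans[OF C2(2)] mult_right_mono ennreal_leI) auto
    also have "lq r (\<lambda>k. ennreal (\<beta> k) * F1 (k + 2)) = lq r (\<lambda>k. if k < n then ennreal (\<beta> k) else 0) * B"
      unfolding lq_multc[OF assms(1), symmetric] F1_def by (intro arg_cong[of _ _ "lq r"] ext) auto
    also have "lq r (\<lambda>k. ennreal (\<beta> k) * F2 (k + 1)) = lq r (\<lambda>k. if n < k then ennreal (\<beta> k) * L (k + 1) else 0)"
      unfolding F2_def by (intro arg_cong[of _ _ "lq r"] ext) auto
    finally show "dn r \<beta> q \<alpha> (tail (n + 2)) \<le> ennreal (A * ?C) *
      (lq r (\<lambda>k. if k < n then ennreal (\<beta> k) else 0) * lq q (\<lambda>j. if n + 1 < j then ennreal (\<alpha> j) else 0) +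
       lq r (\<lambda>k. if n < k then ennreal (\<beta> k) * lq q (\<lambda>j. if k < j then ennreal (\<alpha> j) else 0) else 0))"
      unfolding L B_def[symmetric] using A C1 C2 by (simp add: ennreal_mult' mult.assoc distrib_left)
  qed (use A C1 C2 in auto)
qed

section \<open>Common form of \<open>\<chi>\<^sub>0\<close> (\<sigma> = 1) and
  \<open>\<chi>\<^sub>1\<close> (\<sigma> = - 1), and sampling of the iterated norms\<close>

definition gchi :: "int \<Rightarrow> ennreal \<Rightarrow> (real \<Rightarrow> real) \<Rightarrow> ennreal \<Rightarrow> (real \<Rightarrow> real) \<Rightarrow> real \<Rightarrow> ennreal" where
  "gchi \<sigma> r b q a t =
     Lq r (after \<sigma> t) (\<lambda>s. wt r b s * Lq q (after \<sigma> s) (wt q a)) +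
     Lq r (before \<sigma> t) (wt r b) * Lq q (after \<sigma> t) (wt q a)"

locale direction_weights = direction +
  fixes r q :: ennreal and b a :: "real \<Rightarrow> real"
  assumes rq: "0 < r" "0 < q" and svf_b: "svf b" and svf_a: "svf a"
begin

abbreviation "\<beta> \<equiv> \<lambda>k. b (pt \<sigma> k)"
abbreviation "\<alpha> \<equiv> \<lambda>k. a (pt \<sigma> k)"
abbreviation "N \<equiv> dn r \<beta> q \<alpha>"

abbreviation "smp \<equiv> \<lambda>\<kappa> j. ennreal (\<kappa> (pt \<sigma> j))"

abbreviation "full \<equiv> \<lambda>\<kappa>. Lq r {0<..} (\<lambda>s. wt r b s * Lq q (after \<sigma> s) (wt q (\<lambda>t. a t * \<kappa> t)))"

abbreviation "trunc \<equiv> \<lambda>\<kappa> t. Lq r (before \<sigma> t)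
  (\<lambda>s. wt r b s * Lq q (after \<sigma> s \<inter> before \<sigma> t) (wt q (\<lambda>t. a t * \<kappa> t)))"

text \<open>Fixed once and for all, so that the constants below depend on the weights and not on the
  function being sampled.\<close>

definition "cb = (SOME c. reg c b)"
definition "ca = (SOME c. reg c a)"

lemma reg_b: "reg cb b" and reg_a: "reg ca a"
  unfolding cb_def ca_def by (rule svf_reg[OF svf_b], erule someI) (rule svf_reg[OF svf_a], erule someI)

lemma const_pos: "0 < ca" "0 < cb"
  using reg_a reg_b by (auto simp: reg_def)

lemma reg_mult_a: "reg d \<kappa> \<Longrightarrow> reg (ca * max 1 d) (\<lambda>t. a t * \<kappa> t)"
  using reg_mult[OF reg_a reg_weaken] by auto

lemma svf_sv_seq: assumes "svf f" shows "sv_seq (\<lambda>k. f (pt \<sigma> k))"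
  unfolding sv_seq_def
proof (intro conjI allI impI)
  fix e :: real assume "0 < e"
  then obtain C where C: "0 < C" "\<And>s t. 0 < s \<Longrightarrow> 0 < t \<Longrightarrow> f s \<le> C * exp (e * \<bar>ln s - ln t\<bar>) * f t"
    using svfE[OF assms] by blast
  have "\<bar>ln (pt \<sigma> i) - ln (pt \<sigma> j)\<bar> = \<bar>of_int (i - j)\<bar>" for i j
    using dir by (auto simp: pt_def)
  then show "\<exists>C>0. \<forall>i j. f (pt \<sigma> i) \<le> C * exp (e * \<bar>of_int (i - j)\<bar>) * f (pt \<sigma> j)"
    using C(1) C(2)[OF pt_pos pt_pos] by (intro exI[of _ C]) metis
qed (simp add: svf_pos[OF assms])

lemma sv: "sv_seq \<beta>" "sv_seq \<alpha>"
  using svf_sv_seq svf_a svf_b by auto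

text \<open>Both summands of \<chi> are parts of \<open>N (tail n)\<close>: the first is the range k
  >= n of the outer index, the second the range k <= n, where the inner norm does not depend on k
  and factors out.\<close>

lemma gchi_le: "\<exists>C>0. \<forall>t>0. gchi \<sigma> r b q a t \<le> ennreal C * N (tail (ix \<sigma> t))"
proof -
  let ?C = "2 powr recip r * cb * (2 powr recip q * ca)"
  show ?thesis
  proof (intro exI[of _ "2 * ?C"] conjI allI impI)
    fix t :: real assume t: "0 < t"
    let ?n = "ix \<sigma> t"
    let ?L = "\<lambda>k. lq q (\<lambda>j. if k \<le> j then ennreal (\<alpha> j) * tail ?n j else 0)"
    have "Lq r (after \<sigma> t) (\<lambda>s. wt r b s * Lq q (after \<sigma> s) (wt q a)) \<le> ennreal ?C *
       lq r (\<lambda>k. if ?n \<le> k then ennreal (\<beta> k) * lq q (\<lambda>j. if k \<le> j then ennreal (\<alpha> j) else 0) else 0)"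
      using t by (intro double_le rq reg_b reg_a after_ix after_sets) (auto intro: after_pos)
    also have "\<dots> \<le> ennreal ?C * N (tail ?n)"
      unfolding dn_def by (intro mult_left_mono lq_mono) (auto simp: tail_def intro!: mult_left_mono lq_mono)
    finally have 1: "Lq r (after \<sigma> t) (\<lambda>s. wt r b s * Lq q (after \<sigma> s) (wt q a)) \<le> ennreal ?C * N (tail ?n)" .
    have "Lq r (before \<sigma> t) (wt r b) * Lq q (after \<sigma> t) (wt q a) \<le>
      (ennreal (2 powr recip r * cb) * lq r (\<lambda>k. if k \<le> ?n then ennreal (\<beta> k) else 0)) *
      (ennreal (2 powr recip q * ca) * lq q (\<lambda>j. if ?n \<le> j then ennreal (\<alpha> j) else 0))"
      using t by (intro mult_mono Lq_wt_le rq reg_b reg_a after_ix before_ix after_sets before_sets) auto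
    also have "\<dots> = ennreal ?C * lq r (\<lambda>k. (if k \<le> ?n then ennreal (\<beta> k) else 0) * lq q (\<lambda>j. if ?n \<le> j then ennreal (\<alpha> j) else 0))"
      unfolding lq_multc[OF rq(1)] using const_pos by (simp add: ennreal_mult' mult_ac)
    also have "\<dots> \<le> ennreal ?C * N (tail ?n)"
      unfolding dn_def by (intro mult_left_mono lq_mono) (auto simp: tail_def intro!: mult_left_mono lq_mono)
    finally have "gchi \<sigma> r b q a t \<le> ennreal ?C * N (tail ?n) + ennreal ?C * N (tail ?n)"
      unfolding gchi_def by (intro add_mono 1)
    also have "\<dots> = ennreal (2 * ?C) * N (tail ?n)"
    proof -
      have "ennreal (2 * x) = ennreal x + ennreal x" if "0 \<le> x" for x
        using that by (metis ennreal_plus mult_2)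
      from this[of ?C] show ?thesis using const_pos by (simp add: distrib_right del: ennreal_plus)
    qed
    finally show "gchi \<sigma> r b q a t \<le> ennreal (2 * ?C) * N (tail ?n)" .
  qed (use const_pos in auto)
qed

text \<open>Sampling from below loses boundary cells and reaches only \<open>tail (n + 2)\<close>;
  \<open>dn_tail_le\<close> returns to \<open>tail n\<close> at the cost of exp 2. Finiteness comes
  out of the same estimate at t = 1.\<close>

lemma gchi_ge: "\<exists>C>0. \<forall>t>0. N (tail (ix \<sigma> t)) \<le> ennreal C * gchi \<sigma> r b q a t"
  and N_tail_finite: "Lq r (before \<sigma> 1) (wt r b) < \<infinity> \<Longrightarrow>
    Lq r (after \<sigma> 1) (\<lambda>s. wt r b s * Lq q (after \<sigma> s) (wt q a)) < \<infinity> \<Longrightarrow> N (tail 2) < \<infinity>"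
proof -
  let ?C = "2 powr recip r * cb * (2 powr recip q * ca)"
  define L1 where "L1 n = lq r (\<lambda>k. if k < n then ennreal (\<beta> k) else 0)" for n
  define L2 where "L2 n = lq q (\<lambda>j. if n < j then ennreal (\<alpha> j) else 0)" for n
  define L3 where "L3 n = lq r (\<lambda>k. if n < k then ennreal (\<beta> k) * lq q (\<lambda>j. if k < j then ennreal (\<alpha> j) else 0) else 0)" for n
  obtain A where A: "A > 0" "\<And>n. N (tail (n + 2)) \<le> ennreal A * (L1 n * L2 (n + 1) + L3 n)"
    using dn_tail_split[OF rq sv(1), of \<alpha>] unfolding L1_def L2_def L3_def by blast
  obtain B where B: "B > 0" "\<And>i j. N (tail i) \<le> ennreal (B * exp (1 * \<bar>of_int (i - j)\<bar>)) * N (tail j)"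
    using dn_tail_le[OF rq sv(2,1), of 1] by auto
  have L1: "L1 (ix \<sigma> t) \<le> ennreal (2 powr recip r * cb) * Lq r (before \<sigma> t) (wt r b)" if "0 < t" for t
    unfolding L1_def using that by (intro Lq_wt_ge rq reg_b before_sets ix_less) auto
  have L2: "L2 (ix \<sigma> t) \<le> ennreal (2 powr recip q * ca) * Lq q (after \<sigma> t) (wt q a)" if "0 < t" for t
    unfolding L2_def using that by (intro Lq_wt_ge rq reg_a after_sets ix_less) auto
  have L3: "L3 (ix \<sigma> t) \<le> ennreal ?C * Lq r (after \<sigma> t) (\<lambda>s. wt r b s * Lq q (after \<sigma> s) (wt q a))" if "0 < t" for t
    unfolding L3_def using that
    by (intro double_ge rq reg_b reg_a ix_less after_sets) (auto intro: after_pos)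
  have L2_mono: "L2 (n + 1) \<le> L2 n" for n
    unfolding L2_def by (intro lq_mono) auto
  show "\<exists>C>0. \<forall>t>0. N (tail (ix \<sigma> t)) \<le> ennreal C * gchi \<sigma> r b q a t"
  proof (intro exI[of _ "B * exp 2 * (A * ?C)"] conjI allI impI)
    fix t :: real assume t: "0 < t"
    let ?n = "ix \<sigma> t"
    have "N (tail (?n + 2)) \<le> ennreal A * (L1 ?n * L2 ?n + L3 ?n)"
      by (intro order.trans[OF A(2)] mult_left_mono add_right_mono L2_mono) auto
    also have "\<dots> \<le> ennreal A * ((ennreal (2 powr recip r * cb) * Lq r (before \<sigma> t) (wt r b)) *
        (ennreal (2 powr recip q * ca) * Lq q (after \<sigma> t) (wt q a)) +
        ennreal ?C * Lq r (after \<sigma> t) (\<lambda>s. wt r b s * Lq q (after \<sigma> s) (wt q a)))"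
      by (intro mult_left_mono add_mono mult_mono L1 L2 L3 t) auto
    also have "\<dots> = ennreal (A * ?C) * gchi \<sigma> r b q a t"
      unfolding gchi_def using const_pos A(1) by (simp add: ennreal_mult' mult_ac distrib_left add.commute)
    finally have *: "N (tail (?n + 2)) \<le> ennreal (A * ?C) * gchi \<sigma> r b q a t" .
    have "N (tail ?n) \<le> ennreal (B * exp 2) * N (tail (?n + 2))"
      using B(2)[of ?n "?n + 2"] by simp
    from ennreal_le_trans_mult[OF this *]
    show "N (tail ?n) \<le> ennreal (B * exp 2 * (A * ?C)) * gchi \<sigma> r b q a t"
      using B(1) by simp
  qed (use A B const_pos in auto)
  assume fin: "Lq r (before \<sigma> 1) (wt r b) < \<infinity>"
    "Lq r (after \<sigma> 1) (\<lambda>s. wt r b s * Lq q (after \<sigma> s) (wt q a)) < \<infinity>"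
  have ix1: "ix \<sigma> 1 = 0" by (simp add: ix_def idx_def)
  have f1: "L1 0 < \<infinity>" using le_mult_finite[OF L1[of 1] fin(1)] ix1 by simp
  have f3: "L3 0 < \<infinity>" using le_mult_finite[OF L3[of 1] fin(2)] ix1 by simp
  \<comment> \<open>Finiteness of the inner norm over j > 1 is read off from the term k = 1 of
    \<open>L3 0\<close>, whose weight is positive.\<close>
  have "ennreal (\<beta> 1) * L2 1 \<le> L3 0"
    using lq_ge[OF rq(1), of "\<lambda>k. if 0 < k then ennreal (\<beta> k) * lq q (\<lambda>j. if k < j then ennreal (\<alpha> j) else 0) else 0" 1]
    by (simp add: L2_def L3_def)
  with f3 have "ennreal (\<beta> 1) * L2 1 < \<infinity>" by (rule le_less_trans[rotated])
  moreover have "0 < \<beta> 1" by (simp add: svf_pos[OF svf_b])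
  ultimately have f2: "L2 1 < \<infinity>"
    by (auto simp: ennreal_mult_less_top)
  show "N (tail 2) < \<infinity>"
    using le_mult_finite[OF A(2)[of 0]] f1 f2 f3 by (simp add: ennreal_mult_less_top)
qed

lemma gchi_facts:
  assumes "Lq r (before \<sigma> 1) (wt r b) < \<infinity>"
    "Lq r (after \<sigma> 1) (\<lambda>s. wt r b s * Lq q (after \<sigma> s) (wt q a)) < \<infinity>"
  shows "tail_norm N (\<lambda>n. enn2real (gchi \<sigma> r b q a (pt \<sigma> n)))"
    and "svf (\<lambda>t. enn2real (gchi \<sigma> r b q a t))"
proof -
  let ?X = "\<lambda>t. gchi \<sigma> r b q a t"
  obtain C where C: "C > 0" "\<And>t. 0 < t \<Longrightarrow> ?X t \<le> ennreal C * N (tail (ix \<sigma> t))"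
    using gchi_le by blast
  obtain D where D: "D > 0" "\<And>t. 0 < t \<Longrightarrow> N (tail (ix \<sigma> t)) \<le> ennreal D * ?X t"
    using gchi_ge by blast
  have le: "ennreal C * N x \<le> ennreal (max C D) * N x" "ennreal D * y \<le> ennreal (max C D) * y" for x y
    by (auto intro!: mult_right_mono ennreal_leI)
  note tn = tail_norm_dn[OF rq sv(2,1) N_tail_finite[OF assms], of "max C D" "\<lambda>n. ?X (pt \<sigma> n)"]
  show tail: "tail_norm N (\<lambda>n. enn2real (?X (pt \<sigma> n)))"
  proof (rule tn(1))
    show "N (tail n) \<le> ennreal (max C D) * ?X (pt \<sigma> n)" for n
      using order.trans[OF D(2)[OF pt_pos] le(2)] by (metis ix_pt)
    show "?X (pt \<sigma> n) \<le> ennreal (max C D) * N (tail n)" for n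
      using order.trans[OF C(2)[OF pt_pos] le(1)] by (metis ix_pt)
  qed (use C in auto)
  have N_fin: "N (tail n) < \<infinity>" and N_pos: "0 < N (tail n)" for n
  proof -
    interpret T: tail_norm N "\<lambda>n. enn2real (?X (pt \<sigma> n))" by fact
    show "N (tail n) < \<infinity>"
      using T.tail_le by (auto intro: le_less_trans)
    obtain E where E: "ennreal (enn2real (?X (pt \<sigma> n))) \<le> ennreal E * N (tail n)"
      using T.le_tail by blast
    show "0 < N (tail n)"
      using E T.pos[of n] by (cases "N (tail n) = 0") (auto simp: zero_less_iff_neq_zero ennreal_eq_0_iff)
  qed
  have X_fin: "?X t < \<infinity>" and X_pos: "0 < enn2real (?X t)" if "0 < t" for t
  proof -
    show "?X t < \<infinity>" by (rule le_mult_finite[OF C(2)[OF that] N_fin])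
    moreover have "?X t \<noteq> 0" using D(2)[OF that] N_pos[of "ix \<sigma> t"] by auto
    ultimately show "0 < enn2real (?X t)"
      by (simp add: enn2real_positive_iff zero_less_iff_neq_zero)
  qed
  show "svf (\<lambda>t. enn2real (?X t))"
    unfolding svf_def
  proof (intro conjI allI impI X_pos)
    fix e :: real assume e: "0 < e"
    obtain B where B: "B > 0" "\<And>i j. N (tail i) \<le> ennreal (B * exp (e * \<bar>of_int (i - j)\<bar>)) * N (tail j)"
      using dn_tail_le[OF rq sv(2,1) e] by auto
    have "enn2real (?X s) \<le> C * B * exp e * D * exp (e * \<bar>ln s - ln t\<bar>) * enn2real (?X t)"
      if st: "0 < s" "0 < t" for s t
    proof -
      let ?E = "exp (e * \<bar>of_int (ix \<sigma> s - ix \<sigma> t)\<bar>)"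
      have "?X s \<le> ennreal (C * (B * ?E)) * N (tail (ix \<sigma> t))"
        using C B by (intro ennreal_le_trans_mult[OF C(2)[OF st(1)] B(2)]) auto
      then have "?X s \<le> ennreal (C * (B * ?E) * D) * ?X t"
        using C B by (intro ennreal_le_trans_mult[OF _ D(2)[OF st(2)]]) auto
      also have "?X t = ennreal (enn2real (?X t))" using X_fin[OF st(2)] by simp
      finally have "ennreal (enn2real (?X s)) \<le> ennreal (C * (B * ?E) * D * enn2real (?X t))"
        using X_fin[OF st(1)] C B D by (simp add: ennreal_mult')
      then have "enn2real (?X s) \<le> C * (B * ?E) * D * enn2real (?X t)"
        using C B D by (subst (asm) ennreal_le_iff) auto
      \<comment> \<open>Passing to cell indices changes the logarithmic distance by at most 1, which
        costs the factor exp e.\<close>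
      also have "\<bar>of_int (ix \<sigma> s - ix \<sigma> t)\<bar> \<le> 1 + \<bar>ln s - ln t\<bar>"
      proof -
        have "\<bar>real_of_int (ix \<sigma> s - ix \<sigma> t)\<bar> = \<bar>real_of_int (idx s - idx t)\<bar>"
          using dir by (auto simp: ix_def)
        then show ?thesis unfolding idx_def by linarith
      qed
      then have "?E \<le> exp (e * (1 + \<bar>ln s - ln t\<bar>))" using e by simp
      then have "C * (B * ?E) * D * enn2real (?X t) \<le> C * (B * exp (e * (1 + \<bar>ln s - ln t\<bar>))) * D * enn2real (?X t)"
        using C B D by (intro mult_right_mono mult_left_mono) auto
      finally show ?thesis by (simp add: distrib_left exp_add mult_ac)
    qed
    then show "\<exists>C>0. \<forall>s>0. \<forall>t>0. enn2real (?X s) \<le> C * exp (e * \<bar>ln s - ln t\<bar>) * enn2real (?X t)"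
      using C B D by (intro exI[of _ "C * B * exp e * D"]) auto
  qed
qed

lemma dn_sample:
  "(\<And>j. 0 \<le> \<kappa> (pt \<sigma> j)) \<Longrightarrow> N (\<lambda>j. if P j then ennreal (\<kappa> (pt \<sigma> j)) else 0) =
    lq r (\<lambda>k. ennreal (\<beta> k) * lq q (\<lambda>j. if k \<le> j \<and> P j then ennreal (a (pt \<sigma> j) * \<kappa> (pt \<sigma> j)) else 0))"
  unfolding dn_def
  by (intro arg_cong[of _ _ "lq r"] ext arg_cong2[of _ _ _ _ "(*)"] arg_cong[of _ _ "lq q"] refl)
    (auto simp: ennreal_mult'')

lemma norm_le:
  "\<exists>C>0. \<forall>\<kappa>. reg d \<kappa> \<longrightarrow> full \<kappa>
     \<le> ennreal C * N (smp \<kappa>)"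
proof -
  let ?C = "2 powr recip r * cb * (2 powr recip q * (ca * max 1 d))"
  show ?thesis
  proof (intro exI[of _ ?C] conjI allI impI)
    fix \<kappa> assume \<kappa>: "reg d \<kappa>"
    note reg = reg_mult_a[OF \<kappa>]
    have "full \<kappa> \<le> ennreal ?C *
      lq r (\<lambda>k. if True then ennreal (\<beta> k) * lq q (\<lambda>j. if k \<le> j then ennreal (a (pt \<sigma> j) * \<kappa> (pt \<sigma> j)) else 0) else 0)"
      by (intro double_le rq reg_b reg after_sets) (auto intro: after_ix)
    also have "\<dots> = ennreal ?C * N (smp \<kappa>)"
      using dn_sample[of \<kappa> "\<lambda>_. True"] \<kappa> by (simp add: reg_def)
    finally show "full \<kappa> \<le> \<dots>" .
  qed (use const_pos in auto)
qed

text \<open>A cell is sure to lie in \<open>after \<sigma> s\<close> only if its index is strictly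
  larger than that of s. The diagonal j = k lost in this way is regained by a shift of the outer
  index.\<close>

lemma norm_ge:
  "\<exists>C>0. \<forall>\<kappa>. reg d \<kappa> \<longrightarrow> N (smp \<kappa>) \<le> ennreal C *
     full \<kappa>"
proof -
  obtain C1 where C1: "C1 > 0" "\<And>F. lq r (\<lambda>k. ennreal (\<beta> k) * F k) \<le> ennreal C1 * lq r (\<lambda>k. ennreal (\<beta> k) * F (k + 1))"
    using lq_sv_shift[OF rq(1) sv(1), of 1] by blast
  let ?C = "2 powr recip r * cb * (2 powr recip q * (ca * max 1 d))"
  show ?thesis
  proof (intro exI[of _ "C1 * ?C"] conjI allI impI)
    fix \<kappa> assume \<kappa>: "reg d \<kappa>"
    note reg = reg_mult_a[OF \<kappa>]
    have "N (smp \<kappa>) = lq r (\<lambda>k. ennreal (\<beta> k) * lq q (\<lambda>j. if k \<le> j then ennreal (a (pt \<sigma> j) * \<kappa> (pt \<sigma> j)) else 0))"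
      using dn_sample[of \<kappa> "\<lambda>_. True"] \<kappa> by (simp add: reg_def)
    also have "\<dots> \<le> ennreal C1 * lq r (\<lambda>k. ennreal (\<beta> k) * lq q (\<lambda>j. if k + 1 \<le> j then ennreal (a (pt \<sigma> j) * \<kappa> (pt \<sigma> j)) else 0))"
      by (rule C1)
    finally have "N (smp \<kappa>) \<le> ennreal C1 *
      lq r (\<lambda>k. if True then ennreal (\<beta> k) * lq q (\<lambda>j. if k + 1 \<le> j then ennreal (a (pt \<sigma> j) * \<kappa> (pt \<sigma> j)) else 0) else 0)"
      by simp
    also have "lq r (\<lambda>k. if True then ennreal (\<beta> k) * lq q (\<lambda>j. if k + 1 \<le> j then ennreal (a (pt \<sigma> j) * \<kappa> (pt \<sigma> j)) else 0) else 0)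
      \<le> ennreal ?C * full \<kappa>"
      by (intro double_ge rq reg_b reg after_sets ix_less) auto
    finally show "N (smp \<kappa>) \<le> ennreal (C1 * ?C) *
       full \<kappa>"
      using C1(1) by (simp add: mult_left_mono ennreal_mult' mult.assoc)
  qed (use const_pos C1 in auto)
qed

lemma inner_le:
  "\<exists>C>0. \<forall>\<kappa> t. reg d \<kappa> \<longrightarrow> 0 < t \<longrightarrow>
     trunc \<kappa> t
     \<le> ennreal C * N (low (ix \<sigma> t) (smp \<kappa>))"
proof -
  let ?C = "2 powr recip r * cb * (2 powr recip q * (ca * max 1 d))"
  show ?thesis
  proof (intro exI[of _ ?C] conjI allI impI)
    fix \<kappa> t assume \<kappa>: "reg d \<kappa>" and t: "0 < (t::real)"
    note reg = reg_mult_a[OF \<kappa>]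
    let ?n = "ix \<sigma> t"
    have "trunc \<kappa> t \<le> ennreal ?C *
      lq r (\<lambda>k. if True then ennreal (\<beta> k) * lq q (\<lambda>j. if k \<le> j \<and> j \<le> ?n then ennreal (a (pt \<sigma> j) * \<kappa> (pt \<sigma> j)) else 0) else 0)"
      using t by (intro double_le rq reg_b reg sets.Int after_sets before_sets)
        (auto intro: after_ix before_ix before_pos)
    also have "\<dots> = ennreal ?C * N (low ?n (smp \<kappa>))"
      using dn_sample[of \<kappa> "\<lambda>j. j \<le> ?n"] \<kappa> by (simp add: reg_def low_def[abs_def])
    finally show "trunc \<kappa> t \<le> \<dots>" .
  qed (use const_pos in auto)
qed

text \<open>The truncation is sampled with strict inequalities at both ends. The inner end is
  repaired by a shift of k; at the outer end the index \<open>ix \<sigma> t - 1\<close> remains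
  until the outermost norm is taken.\<close>

lemma inner_ge:
  "\<exists>C>0. \<forall>\<kappa> t. reg d \<kappa> \<longrightarrow> 0 < t \<longrightarrow>
     N (low (ix \<sigma> t - 1) (smp \<kappa>)) \<le> ennreal C *
     trunc \<kappa> t"
proof -
  obtain C1 where C1: "C1 > 0" "\<And>F. lq r (\<lambda>k. ennreal (\<beta> k) * F k) \<le> ennreal C1 * lq r (\<lambda>k. ennreal (\<beta> k) * F (k + 1))"
    using lq_sv_shift[OF rq(1) sv(1), of 1] by blast
  let ?C = "2 powr recip r * cb * (2 powr recip q * (ca * max 1 d))"
  show ?thesis
  proof (intro exI[of _ "C1 * ?C"] conjI allI impI)
    fix \<kappa> t assume \<kappa>: "reg d \<kappa>" and t: "0 < (t::real)"
    note reg = reg_mult_a[OF \<kappa>]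
    let ?n = "ix \<sigma> t"
    let ?h = "\<lambda>j. ennreal (a (pt \<sigma> j) * \<kappa> (pt \<sigma> j))"
    have zero: "lq q (\<lambda>_. 0) = 0" using lq_cmult[OF rq(2), of 0 "\<lambda>_. 0"] by simp
    have "N (low (?n - 1) (smp \<kappa>)) = lq r (\<lambda>k. ennreal (\<beta> k) * lq q (\<lambda>j. if k \<le> j \<and> j \<le> ?n - 1 then ?h j else 0))"
      using dn_sample[of \<kappa> "\<lambda>j. j \<le> ?n - 1"] \<kappa> by (simp add: reg_def low_def[abs_def])
    also have "\<dots> \<le> ennreal C1 * lq r (\<lambda>k. ennreal (\<beta> k) * lq q (\<lambda>j. if k + 1 \<le> j \<and> j \<le> ?n - 1 then ?h j else 0))"
      by (rule C1)
    \<comment> \<open>For k >= \<open>ix \<sigma> t\<close> the inner range is empty, so the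
      restriction of k that the outer range \<open>before \<sigma> t\<close> demands costs
      nothing.\<close>
    also have "lq r (\<lambda>k. ennreal (\<beta> k) * lq q (\<lambda>j. if k + 1 \<le> j \<and> j \<le> ?n - 1 then ?h j else 0))
       = lq r (\<lambda>k. if k < ?n then ennreal (\<beta> k) * lq q (\<lambda>j. if k < j \<and> j < ?n then ?h j else 0) else 0)"
    proof (intro arg_cong[of _ _ "lq r"] ext)
      fix k
      show "ennreal (\<beta> k) * lq q (\<lambda>j. if k + 1 \<le> j \<and> j \<le> ?n - 1 then ?h j else 0)
        = (if k < ?n then ennreal (\<beta> k) * lq q (\<lambda>j. if k < j \<and> j < ?n then ?h j else 0) else 0)"
      proof (cases "k < ?n")
        case True
        have "(k + 1 \<le> j \<and> j \<le> ?n - 1) = (k < j \<and> j < ?n)" for j by auto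
        then show ?thesis using True by simp
      next
        case False
        then have *: "(\<lambda>j. if k + 1 \<le> j \<and> j \<le> ?n - 1 then ?h j else 0) = (\<lambda>_. 0)" by auto
        show ?thesis unfolding * zero using False by simp
      qed
    qed
    also have "\<dots> \<le> ennreal ?C * trunc \<kappa> t"
      using t by (intro double_ge rq reg_b reg sets.Int after_sets before_sets)
        (auto intro: ix_less before_pos)
    finally show "N (low (?n - 1) (smp \<kappa>)) \<le> ennreal (C1 * ?C) *
       trunc \<kappa> t"
      using C1(1) by (simp add: mult_left_mono ennreal_mult' mult.assoc)
  qed (use const_pos C1 in auto)
qed

lemma outer_le:
  assumes "0 < p" "svf w"
  shows "\<exists>C>0. \<forall>\<kappa>. reg d \<kappa> \<longrightarrow> Lq p {0<..} (\<lambda>t. wt p w t *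
     trunc \<kappa> t)
     \<le> ennreal C * lq p (\<lambda>n. ennreal (w (pt \<sigma> n)) * N (low n (smp \<kappa>)))"
proof -
  obtain D where D: "reg D w" using svf_reg[OF assms(2)] .
  then have "0 < D" by (simp add: reg_def)
  define I where "I \<kappa> t = trunc \<kappa> t" for \<kappa> t
  define H where "H \<kappa> n = N (low n (smp \<kappa>))" for \<kappa> n
  obtain C where C: "0 < C" "\<And>\<kappa> t. reg d \<kappa> \<Longrightarrow> 0 < t \<Longrightarrow> I \<kappa> t \<le> ennreal C * H \<kappa> (ix \<sigma> t)"
    using inner_le[of d] unfolding I_def H_def by blast
  have "Lq p {0<..} (\<lambda>t. wt p w t * I \<kappa> t) \<le> ennreal (2 powr recip p * (D * C)) * lq p (\<lambda>n. ennreal (w (pt \<sigma> n)) * H \<kappa> n)"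
    if \<kappa>: "reg d \<kappa>" for \<kappa>
  proof -
    have "Lq p {0<..} (\<lambda>t. wt p w t * I \<kappa> t) \<le> ennreal (2 powr recip p) * lq p (\<lambda>n. ennreal (D * C) * (ennreal (w (pt \<sigma> n)) * H \<kappa> n))"
    proof (rule Lq_le_lq_dir)
      fix t :: real assume "t \<in> {0<..}"
      then have t: "0 < t" by simp
      have "wt p w t \<le> ennreal (t powr - recip p * (D * w (pt \<sigma> (ix \<sigma> t))))"
        unfolding wt_def using reg_pt[OF D t] by (intro ennreal_leI mult_left_mono) auto
      then have "wt p w t * I \<kappa> t \<le> ennreal (t powr - recip p * (D * w (pt \<sigma> (ix \<sigma> t)))) * (ennreal C * H \<kappa> (ix \<sigma> t))"
        by (intro mult_mono C \<kappa> t) auto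
      also have "\<dots> = ennreal (t powr - recip p) * (ennreal (D * C) * (ennreal (w (pt \<sigma> (ix \<sigma> t))) * H \<kappa> (ix \<sigma> t)))"
        using C(1) \<open>0 < D\<close> by (simp add: ennreal_mult' mult_ac)
      finally show "wt p w t * I \<kappa> t \<le> \<dots>" .
    qed (use assms in auto)
    then show ?thesis using C(1) \<open>0 < D\<close> assms by (simp add: lq_cmult ennreal_mult' mult.assoc)
  qed
  then show ?thesis unfolding I_def H_def using C(1) \<open>0 < D\<close> by (intro exI[of _ "2 powr recip p * (D * C)"]) auto
qed

lemma outer_ge:
  assumes "0 < p" "svf w"
  shows "\<exists>C>0. \<forall>\<kappa>. reg d \<kappa> \<longrightarrow>
     lq p (\<lambda>n. ennreal (w (pt \<sigma> n)) * N (low n (smp \<kappa>))) \<le> ennreal C *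
     Lq p {0<..} (\<lambda>t. wt p w t *
     trunc \<kappa> t)"
proof -
  obtain D where D: "reg D w" using svf_reg[OF assms(2)] .
  then have "0 < D" by (simp add: reg_def)
  define I where "I \<kappa> t = trunc \<kappa> t" for \<kappa> t
  define H where "H \<kappa> n = N (low n (smp \<kappa>))" for \<kappa> n
  obtain C where C: "0 < C" "\<And>\<kappa> t. reg d \<kappa> \<Longrightarrow> 0 < t \<Longrightarrow> H \<kappa> (ix \<sigma> t - 1) \<le> ennreal C * I \<kappa> t"
    using inner_ge[of d] unfolding I_def H_def by blast
  \<comment> \<open>The shift by - 1 makes up for the index \<open>ix \<sigma> t - 1\<close> left
    over by \<open>inner_ge\<close>.\<close>
  obtain C1 where C1: "C1 > 0" "\<And>F. lq p (\<lambda>k. ennreal (w (pt \<sigma> k)) * F k) \<le> ennreal C1 * lq p (\<lambda>k. ennreal (w (pt \<sigma> k)) * F (k + (- 1)))"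
    using lq_sv_shift[OF assms(1) svf_sv_seq[OF assms(2)], of "- 1"] by blast
  let ?c = "D * C"
  have c: "0 < ?c" using C(1) \<open>0 < D\<close> by simp
  have "lq p (\<lambda>n. ennreal (w (pt \<sigma> n)) * H \<kappa> n) \<le> ennreal (C1 * (?c * 2 powr recip p)) * Lq p {0<..} (\<lambda>t. wt p w t * I \<kappa> t)"
    if \<kappa>: "reg d \<kappa>" for \<kappa>
  proof -
    let ?h = "\<lambda>n. ennreal (inverse ?c) * (ennreal (w (pt \<sigma> n)) * H \<kappa> (n - 1))"
    have *: "lq p ?h \<le> ennreal (2 powr recip p) * Lq p {0<..} (\<lambda>t. wt p w t * I \<kappa> t)"
    proof (rule lq_le_Lq_dir)
      fix t :: real assume "t \<in> {0<..}"
      then have t: "0 < t" by simp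
      have "ennreal (t powr - recip p * (inverse D * w (pt \<sigma> (ix \<sigma> t)))) \<le> wt p w t"
        unfolding wt_def using reg_pt[OF D t] by (intro ennreal_leI mult_left_mono) (auto simp: field_simps)
      moreover have "ennreal (inverse C) * H \<kappa> (ix \<sigma> t - 1) \<le> I \<kappa> t"
        using mult_left_mono[OF C(2)[OF \<kappa> t] zero_le, of "ennreal (inverse C)"]
        by (simp only: ennreal_inverse_cancel[OF C(1)])
      ultimately have "ennreal (t powr - recip p * (inverse D * w (pt \<sigma> (ix \<sigma> t)))) * (ennreal (inverse C) * H \<kappa> (ix \<sigma> t - 1)) \<le> wt p w t * I \<kappa> t"
        by (rule mult_mono) auto
      also have "ennreal (t powr - recip p * (inverse D * w (pt \<sigma> (ix \<sigma> t)))) * (ennreal (inverse C) * H \<kappa> (ix \<sigma> t - 1))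
         = ennreal (t powr - recip p) * ?h (ix \<sigma> t)"
        using C(1) \<open>0 < D\<close> by (simp add: ennreal_mult' mult_ac)
      finally show "ennreal (t powr - recip p) * ?h (ix \<sigma> t) \<le> wt p w t * I \<kappa> t" .
    qed (use assms in auto)
    have "lq p (\<lambda>n. ennreal (w (pt \<sigma> n)) * H \<kappa> n) \<le> ennreal C1 * lq p (\<lambda>n. ennreal (w (pt \<sigma> n)) * H \<kappa> (n - 1))"
      using C1(2)[of "H \<kappa>"] by simp
    also have "lq p (\<lambda>n. ennreal (w (pt \<sigma> n)) * H \<kappa> (n - 1)) = ennreal ?c * lq p ?h"
      unfolding lq_cmult[OF assms(1) less_imp_le[OF c], symmetric] by (simp only: ennreal_inverse_cancel[OF c])
    also have "\<dots> \<le> ennreal ?c * (ennreal (2 powr recip p) * Lq p {0<..} (\<lambda>t. wt p w t * I \<kappa> t))"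
      by (intro mult_left_mono *) auto
    finally show ?thesis using C1(1) C(1) \<open>0 < D\<close> by (simp add: mult_left_mono ennreal_mult' mult.assoc)
  qed
  then show ?thesis unfolding I_def H_def using C1 c by (intro exI[of _ "C1 * (?c * 2 powr recip p)"]) auto
qed

end

section \<open>Change of variable along a quasi-isometry of the integers\<close>

text \<open>Here \<open>m n\<close> is the index of the cell containing \<open>\<rho> (e\<^sup>n)\<close>. As \<open>\<rho>\<close> need not be monotone, the
  substitution \<open>u = \<rho> t\<close> rests on \<open>m\<close> being of bounded multiplicity and nearly onto.\<close>

lemma lq_change:
  fixes m :: "int \<Rightarrow> int"
  assumes "0 < r" and m: "\<And>n k. \<bar>of_int (m n - m k) - of_int (n - k)\<bar> \<le> L + \<bar>of_int (n - k)\<bar> / (2::real)"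
  obtains C M where "1 \<le> C" "0 \<le> M" "\<And>H. lq r (\<lambda>n. H (m n)) \<le> ennreal C * lq r H"
    "\<And>H D. 0 \<le> D \<Longrightarrow> (\<And>k k'. \<bar>real_of_int (k - k')\<bar> \<le> M \<Longrightarrow> H k \<le> ennreal D * H k') \<Longrightarrow>
       lq r H \<le> ennreal (D * C) * lq r (\<lambda>n. H (m n))"
proof -
  have L: "0 \<le> L" using m[of 0 0] by simp
  have fibre: "finite {n. \<phi> n = (k::int)} \<and> card {n. \<phi> n = k} \<le> nat (2 * \<lceil>B\<rceil> + 1)"
    if B: "\<And>n n'. \<phi> n = \<phi> n' \<Longrightarrow> \<bar>of_int (n - n')\<bar> \<le> (B::real)" for \<phi> :: "int \<Rightarrow> int" and B k
  proof (cases "\<exists>n0. \<phi> n0 = k")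
    case True
    then obtain n0 where n0: "\<phi> n0 = k" by blast
    have sub: "{n. \<phi> n = k} \<subseteq> {n0 - \<lceil>B\<rceil>..n0 + \<lceil>B\<rceil>}"
    proof
      fix n assume "n \<in> {n. \<phi> n = k}"
      then have "\<bar>of_int (n - n0)\<bar> \<le> B" using n0 by (intro B) auto
      then have "real_of_int \<bar>n - n0\<bar> \<le> B" by simp
      then have "\<bar>n - n0\<bar> \<le> \<lceil>B\<rceil>" by (simp add: le_ceiling_iff)
      then show "n \<in> {n0 - \<lceil>B\<rceil>..n0 + \<lceil>B\<rceil>}" by auto
    qed
    from card_mono[OF _ sub] finite_subset[OF sub] show ?thesis by simp
  next
    case False
    then have "{n. \<phi> n = k} = {}" by auto
    then show ?thesis by simp
  qed
  \<comment> \<open>Discrete intermediate value argument: \<open>m\<close> grows at least at half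
    speed, so it passes k between - n1 and n1, and its increments are at most L + 2.\<close>
  have near: "\<exists>n. \<bar>of_int (m n - k)\<bar> \<le> L + 2" for k
  proof -
    define P where "P n \<longleftrightarrow> k \<le> m n" for n
    define n1 where "n1 = 2 * (\<bar>k - m 0\<bar> + \<lceil>L\<rceil>) + 2"
    have n1: "n1 \<ge> 0" "real_of_int n1 \<ge> 2 * \<bar>real_of_int (k - m 0)\<bar> + 2 * L + 2"
      using L le_of_int_ceiling[of L] unfolding n1_def by (auto simp del: le_of_int_ceiling)
    have P1: "P n1"
    proof -
      have "real_of_int (m n1 - m 0) \<ge> real_of_int n1 / 2 - L" using m[of n1 0] n1 by auto
      then have "real_of_int (k - m 0) + 1 / 2 \<le> real_of_int (m n1 - m 0)"
        using n1(2) abs_ge_self[of "real_of_int (k - m 0)"] by (simp add: field_simps)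
      then show ?thesis unfolding P_def by linarith
    qed
    have P2: "\<not> P (- n1)"
    proof -
      have "real_of_int (m (- n1) - m 0) \<le> - real_of_int n1 / 2 + L" using m[of "- n1" 0] n1 by auto
      then have "real_of_int (m (- n1) - m 0) < real_of_int (k - m 0)" 
        using n1(2) abs_ge_minus_self[of "real_of_int (k - m 0)"] by (simp add: field_simps)
      then show ?thesis unfolding P_def of_int_less_iff by simp
    qed
    have "\<exists>n. P n \<and> \<not> P (n - 1)"
    proof (rule ccontr)
      assume no: "\<nexists>n. P n \<and> \<not> P (n - 1)"
      have "P n" if "n \<le> n1" for n
        using that by (induction rule: int_le_induct) (use P1 no in auto)
      then show False using P2 n1 by auto
    qed
    then obtain n where n: "k \<le> m n" "m (n - 1) < k" unfolding P_def by auto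
    have "real_of_int (m n - m (n - 1)) \<le> L + 2" using m[of n "n - 1"] by auto
    then have "\<bar>of_int (m n - k)\<bar> \<le> L + 2" using n by linarith
    then show ?thesis by blast
  qed
  \<comment> \<open>\<open>\<psi>\<close> is a right inverse of \<open>m\<close> up to the error L +
    2. Equal values of \<open>\<psi>\<close> force nearby arguments, so its multiplicity is bounded
    too, and a norm over all k can be pulled back to the indices \<open>m n\<close>.\<close>
  then obtain \<psi> where \<psi>: "\<And>k. \<bar>of_int (m (\<psi> k) - k)\<bar> \<le> L + 2" by metis
  have "\<bar>of_int (n - n')\<bar> \<le> 2 * L" if "m n = m n'" for n n'
    using m[of n n'] that abs_minus_commute[of "real_of_int n" "real_of_int n'"] by simp
  note f1 = fibre[of m "2 * L", OF this]
  have "\<bar>of_int (k - k')\<bar> \<le> 2 * (L + 2)" if "\<psi> k = \<psi> k'" for k k'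
    using \<psi>[of k] \<psi>[of k'] that by auto
  note f2 = fibre[of \<psi> "2 * (L + 2)", OF this]
  obtain C1 where C1: "1 \<le> C1" "\<And>H. lq r (\<lambda>n. H (m n)) \<le> ennreal C1 * lq r H"
    using lq_fibres[OF assms(1), of m] f1 by blast
  obtain C2 where C2: "1 \<le> C2" "\<And>H. lq r (\<lambda>k. H (\<psi> k)) \<le> ennreal C2 * lq r H"
    using lq_fibres[OF assms(1), of \<psi>] f2 by blast
  have up: "ennreal C1 * x \<le> ennreal (max C1 C2) * x" "ennreal C2 * x \<le> ennreal (max C1 C2) * x" for x
    by (auto intro!: mult_right_mono ennreal_leI)
  show ?thesis
  proof (rule that[of "max C1 C2" "L + 2"])
    show "lq r (\<lambda>n. H (m n)) \<le> ennreal (max C1 C2) * lq r H" for H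
      using C1(2) up(1) by (rule order.trans)
    fix H D assume D: "0 \<le> D" and H: "\<And>k k'. \<bar>of_int (k - k')\<bar> \<le> L + 2 \<Longrightarrow> H k \<le> ennreal D * H k'"
    have "lq r H \<le> lq r (\<lambda>k. ennreal D * H (m (\<psi> k)))"
      using \<psi> by (intro lq_mono H) (simp add: abs_minus_commute)
    also have "\<dots> = ennreal D * lq r (\<lambda>k. H (m (\<psi> k)))"
      by (rule lq_cmult[OF assms(1) D])
    finally show "lq r H \<le> ennreal (D * max C1 C2) * lq r (\<lambda>n. H (m n))"
      using order.trans[OF C2(2)[of "\<lambda>n. H (m n)"] up(2)] D by (rule ennreal_le_trans_mult)
  qed (use C1 L in auto)
qed

section \<open>Calculus of slowly varying functions on the logarithmic scale\<close>

lemma svf_ln: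
  assumes "svf f" "0 < e"
  obtains L where "\<And>s t. 0 < s \<Longrightarrow> 0 < t \<Longrightarrow> \<bar>ln (f s) - ln (f t)\<bar> \<le> L + e * \<bar>ln s - ln t\<bar>"
proof -
  obtain C where C: "0 < C" "\<And>s t. 0 < s \<Longrightarrow> 0 < t \<Longrightarrow> f s \<le> C * exp (e * \<bar>ln s - ln t\<bar>) * f t"
    using svfE[OF assms] by blast
  have "ln (f s) - ln (f t) \<le> ln C + e * \<bar>ln s - ln t\<bar>" if "0 < s" "0 < t" for s t
  proof -
    have pos: "0 < f s" "0 < f t" using that svf_pos[OF assms(1)] by auto
    have "ln (f s) \<le> ln (C * exp (e * \<bar>ln s - ln t\<bar>) * f t)"
      using C(2)[OF that] pos by simp
    also have "\<dots> = ln C + e * \<bar>ln s - ln t\<bar> + ln (f t)"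
      using C(1) pos by (simp add: ln_mult)
    finally show ?thesis by simp
  qed
  then have "\<bar>ln (f s) - ln (f t)\<bar> \<le> ln C + e * \<bar>ln s - ln t\<bar>" if "0 < s" "0 < t" for s t
    using that abs_minus_commute[of "ln s" "ln t"] by (smt (verit))
  then show ?thesis by (rule that)
qed

lemma svf_lnI:
  assumes pos: "\<And>t. 0 < t \<Longrightarrow> 0 < f t"
    and L: "\<And>e. 0 < e \<Longrightarrow> \<exists>L. \<forall>s>0. \<forall>t>0. ln (f s) - ln (f t) \<le> L + e * \<bar>ln s - ln t\<bar>"
  shows "svf f"
  unfolding svf_def
proof (intro conjI allI impI pos)
  fix e :: real assume "0 < e"
  from assms(2)[OF this] obtain L where L': "\<forall>s>0. \<forall>t>0. ln (f s) - ln (f t) \<le> L + e * \<bar>ln s - ln t\<bar>"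
    by (elim exE)
  note L = L'[rule_format]
  have "f s \<le> exp L * exp (e * \<bar>ln s - ln t\<bar>) * f t" if "0 < s" "0 < t" for s t
  proof -
    have "exp (ln (f s)) \<le> exp (L + e * \<bar>ln s - ln t\<bar> + ln (f t))"
      using L[OF that] by simp
    then show ?thesis using pos[OF that(1)] pos[OF that(2)] by (simp add: exp_add)
  qed
  then show "\<exists>C>0. \<forall>s>0. \<forall>t>0. f s \<le> C * exp (e * \<bar>ln s - ln t\<bar>) * f t"
    by (intro exI[of _ "exp L"]) auto
qed

lemma svf_mult:
  assumes "svf f" "svf g" shows "svf (\<lambda>t. f t * g t)"
proof (rule svf_lnI)
  fix e :: real assume "0 < e"
  then have e: "0 < e / 2" by simp
  obtain L1 where L1: "\<And>s t. 0 < s \<Longrightarrow> 0 < t \<Longrightarrow> \<bar>ln (f s) - ln (f t)\<bar> \<le> L1 + e/2 * \<bar>ln s - ln t\<bar>"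
    using svf_ln[OF assms(1) e] by blast
  obtain L2 where L2: "\<And>s t. 0 < s \<Longrightarrow> 0 < t \<Longrightarrow> \<bar>ln (g s) - ln (g t)\<bar> \<le> L2 + e/2 * \<bar>ln s - ln t\<bar>"
    using svf_ln[OF assms(2) e] by blast
  have "ln (f s * g s) - ln (f t * g t) \<le> L1 + L2 + e * \<bar>ln s - ln t\<bar>" if "0 < s" "0 < t" for s t
    using L1[OF that] L2[OF that] svf_pos[OF assms(1) that(1)] svf_pos[OF assms(1) that(2)]
      svf_pos[OF assms(2) that(1)] svf_pos[OF assms(2) that(2)] by (simp add: ln_mult)
  then show "\<exists>L. \<forall>s>0. \<forall>t>0. ln (f s * g s) - ln (f t * g t) \<le> L + e * \<bar>ln s - ln t\<bar>" by blast
qed (simp add: svf_pos assms)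

lemma svf_powr:
  assumes "svf f" shows "svf (\<lambda>t. f t powr p)"
proof (rule svf_lnI)
  fix e :: real assume "0 < e"
  then have e: "0 < e / (\<bar>p\<bar> + 1)" by simp
  obtain L where L: "\<And>s t. 0 < s \<Longrightarrow> 0 < t \<Longrightarrow> \<bar>ln (f s) - ln (f t)\<bar> \<le> L + e / (\<bar>p\<bar> + 1) * \<bar>ln s - ln t\<bar>"
    using svf_ln[OF assms e] by blast
  have "ln (f s powr p) - ln (f t powr p) \<le> \<bar>p\<bar> * L + e * \<bar>ln s - ln t\<bar>" if "0 < s" "0 < t" for s t
  proof -
    have pos: "0 < f s" "0 < f t" using that svf_pos[OF assms] by auto
    have "ln (f s powr p) - ln (f t powr p) = p * (ln (f s) - ln (f t))"
      using pos by (simp add: ln_powr right_diff_distrib)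
    also have "\<dots> \<le> \<bar>p\<bar> * \<bar>ln (f s) - ln (f t)\<bar>"
      by (metis abs_ge_self abs_mult)
    also have "\<dots> \<le> \<bar>p\<bar> * (L + e / (\<bar>p\<bar> + 1) * \<bar>ln s - ln t\<bar>)"
      by (intro mult_left_mono L that) auto
    also have "\<dots> = \<bar>p\<bar> * L + (\<bar>p\<bar> / (\<bar>p\<bar> + 1)) * (e * \<bar>ln s - ln t\<bar>)"
      by (simp add: distrib_left)
    also have "\<dots> \<le> \<bar>p\<bar> * L + 1 * (e * \<bar>ln s - ln t\<bar>)"
      using \<open>0 < e\<close> by (intro add_left_mono mult_right_mono) auto
    finally show ?thesis by simp
  qed
  then show "\<exists>L. \<forall>s>0. \<forall>t>0. ln (f s powr p) - ln (f t powr p) \<le> L + e * \<bar>ln s - ln t\<bar>" by blast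
qed (use svf_pos[OF assms] in \<open>fastforce\<close>)

text \<open>Meant for \<open>g\<close> = \<rho>, which at large distances is Lipschitz with slope at
  most 2 on the logarithmic scale; the rate of \<open>f\<close> is halved to compensate.\<close>

lemma svf_compose:
  assumes "svf f" and pos: "\<And>t. 0 < t \<Longrightarrow> 0 < g t"
    and g: "\<And>s t. 0 < s \<Longrightarrow> 0 < t \<Longrightarrow> \<bar>ln (g s) - ln (g t)\<bar> \<le> L + 2 * \<bar>ln s - ln t\<bar>"
  shows "svf (\<lambda>t. f (g t))"
proof (rule svf_lnI)
  fix e :: real assume "0 < e"
  then have e: "0 < e / 2" by simp
  obtain L' where L': "\<And>s t. 0 < s \<Longrightarrow> 0 < t \<Longrightarrow> \<bar>ln (f s) - ln (f t)\<bar> \<le> L' + e/2 * \<bar>ln s - ln t\<bar>"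
    using svf_ln[OF assms(1) e] by blast
  have "ln (f (g s)) - ln (f (g t)) \<le> L' + e/2 * L + e * \<bar>ln s - ln t\<bar>" if "0 < s" "0 < t" for s t
  proof -
    have "ln (f (g s)) - ln (f (g t)) \<le> L' + e/2 * \<bar>ln (g s) - ln (g t)\<bar>"
      using L'[OF pos[OF that(1)] pos[OF that(2)]] by simp
    also have "\<dots> \<le> L' + e/2 * (L + 2 * \<bar>ln s - ln t\<bar>)"
      using e g[OF that] by (intro add_left_mono mult_left_mono) auto
    finally show ?thesis by (simp add: field_simps)
  qed
  then show "\<exists>L. \<forall>s>0. \<forall>t>0. ln (f (g s)) - ln (f (g t)) \<le> L + e * \<bar>ln s - ln t\<bar>" by blast
qed (use pos svf_pos[OF assms(1)] in auto)

lemma reg_powr: "reg (exp \<bar>x\<bar>) (\<lambda>t. t powr x)"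
  unfolding reg_def
proof (intro conjI allI impI)
  fix t :: real assume t: "0 < t"
  have d: "\<bar>x * ln t - x * of_int (idx t)\<bar> \<le> \<bar>x\<bar>"
    using mult_left_mono[OF ln_idx_dist[of t], of "\<bar>x\<bar>"] by (simp add: abs_mult[symmetric] right_diff_distrib)
  show "t powr x \<le> exp \<bar>x\<bar> * exp (of_int (idx t)) powr x"
    "exp (of_int (idx t)) powr x \<le> exp \<bar>x\<bar> * t powr x"
    using t d by (auto simp: powr_def exp_add[symmetric] mult.commute)
qed auto

section \<open>The K-functional and a Holmstedt formula\<close>

text \<open>Monotonicity of K(t, f) and of K(t, f)/t comes from nonnegativity alone. At this
  generality both facts apply to the limiting pair as well as to the given couple.\<close>

locale nonneg_couple =
  fixes X0 X1 :: "'a::real_vector qspace"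
  assumes nonneg: "x \<in> carr X0 \<Longrightarrow> 0 \<le> qnrm X0 x" "x \<in> carr X1 \<Longrightarrow> 0 \<le> qnrm X1 x"
begin

abbreviation "K \<equiv> K_fun X0 X1"

lemma K_le:
  assumes "f0 \<in> carr X0" "f1 \<in> carr X1" "0 \<le> t"
  shows "K t (f0 + f1) \<le> qnrm X0 f0 + t * qnrm X1 f1"
  unfolding K_fun_def using assms nonneg
  by (intro cInf_lower bdd_belowI[of _ 0]) (auto intro!: exI add_nonneg_nonneg mult_nonneg_nonneg)

text \<open>Membership of \<open>f\<close> in the sum keeps the set of values nonempty; the infimum
  of an empty set of reals would be arbitrary.\<close>

lemma K_greatest:
  assumes "f \<in> sum_carr X0 X1"
    and "\<And>f0 f1. f0 \<in> carr X0 \<Longrightarrow> f1 \<in> carr X1 \<Longrightarrow> f = f0 + f1 \<Longrightarrow> z \<le> qnrm X0 f0 + t * qnrm X1 f1"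
  shows "z \<le> K t f"
  unfolding K_fun_def using assms by (intro cInf_greatest) (auto simp: sum_carr_def)

lemma K_nonneg: "f \<in> sum_carr X0 X1 \<Longrightarrow> 0 \<le> t \<Longrightarrow> 0 \<le> K t f"
  using nonneg by (intro K_greatest) auto

lemma K_approx:
  assumes "f \<in> sum_carr X0 X1" "K t f < z"
  obtains f0 f1 where "f0 \<in> carr X0" "f1 \<in> carr X1" "f = f0 + f1" "qnrm X0 f0 + t * qnrm X1 f1 < z"
  using K_greatest[OF assms(1), of z t] assms(2) by (meson not_le)

lemma K_mono: "f \<in> sum_carr X0 X1 \<Longrightarrow> 0 \<le> s \<Longrightarrow> s \<le> t \<Longrightarrow> K s f \<le> K t f"
proof (rule K_greatest)
  fix f0 f1 assume *: "0 \<le> s" "s \<le> t" "f0 \<in> carr X0" "f1 \<in> carr X1" "f = f0 + f1"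
  then have "K s f \<le> qnrm X0 f0 + s * qnrm X1 f1" by (simp add: K_le)
  also have "s * qnrm X1 f1 \<le> t * qnrm X1 f1" using * nonneg by (intro mult_right_mono) auto
  finally show "K s f \<le> qnrm X0 f0 + t * qnrm X1 f1" by simp
qed

text \<open>Evaluating each decomposition at t and bounding s/t by 1 in the first term shows that
  K(t, f)/t is nonincreasing.\<close>

lemma K_quot:
  assumes "f \<in> sum_carr X0 X1" "0 < s" "s \<le> t" shows "K t f \<le> t / s * K s f"
proof -
  have "s / t * K t f \<le> K s f"
  proof (rule K_greatest[OF assms(1)])
    fix f0 f1 assume *: "f0 \<in> carr X0" "f1 \<in> carr X1" "f = f0 + f1"
    then have "s / t * K t f \<le> s / t * (qnrm X0 f0 + t * qnrm X1 f1)"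
      using assms by (intro mult_left_mono) (auto simp: K_le)
    also have "\<dots> = s / t * qnrm X0 f0 + s * qnrm X1 f1" using assms by (simp add: distrib_left)
    also have "s / t * qnrm X0 f0 \<le> 1 * qnrm X0 f0"
      using assms nonneg(1)[OF *(1)] by (intro mult_right_mono) auto
    finally show "s / t * K t f \<le> qnrm X0 f0 + s * qnrm X1 f1" by simp
  qed
  then show ?thesis using assms by (simp add: field_simps)
qed

lemma reg_K:
  assumes "f \<in> sum_carr X0 X1" shows "reg (exp 1) (\<lambda>t. K t f)"
  unfolding reg_def
proof (intro conjI allI impI)
  fix t :: real assume t: "0 < t"
  let ?s = "exp (of_int (idx t)) :: real"
  show nn: "0 \<le> K t f" using assms t by (simp add: K_nonneg)
  have "K t f \<le> t / ?s * K ?s f" using assms t idx_bounds(1)[OF t] by (intro K_quot) auto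
  also have "\<dots> \<le> exp 1 * K ?s f"
    using idx_bounds(2)[OF t] assms by (intro mult_right_mono K_nonneg) (auto simp: field_simps exp_add)
  finally show "K t f \<le> exp 1 * K ?s f" .
  have "K ?s f \<le> 1 * K t f" using assms idx_bounds(1)[OF t] by (simp add: K_mono)
  also have "\<dots> \<le> exp 1 * K t f" using nn by (intro mult_right_mono) auto
  finally show "K ?s f \<le> exp 1 * K t f" .
qed simp

lemma reg_powr_K: "f \<in> sum_carr X0 X1 \<Longrightarrow> reg (exp \<bar>\<theta>\<bar> * exp 1) (\<lambda>t. t powr (- \<theta>) * K t f)"
  using reg_mult[OF reg_powr[of "- \<theta>"] reg_K] by simp

end

lemma K_wt_eq: "K_wt X0 X1 \<theta> q a f = wt q (\<lambda>t. a t * (t powr (- \<theta>) * K_fun X0 X1 t f))"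
proof
  fix u :: real
  have "u powr (- \<theta> - recip q) = u powr (- \<theta>) * u powr (- recip q)"
    by (simp only: diff_conv_add_uminus powr_add)
  then show "K_wt X0 X1 \<theta> q a f u = wt q (\<lambda>t. a t * (t powr (- \<theta>) * K_fun X0 X1 t f)) u"
    by (simp add: K_wt_def wt_def mult_ac)
qed

lemma Lq_cong:
  assumes "\<And>x. x \<in> S \<Longrightarrow> g x = h x" shows "Lq q S g = Lq q S h"
proof -
  have "(\<integral>\<^sup>+ x. ennpow (g x) (enn2real q) \<partial>lebesgue_on S) = (\<integral>\<^sup>+ x. ennpow (h x) (enn2real q) \<partial>lebesgue_on S)"
    using assms by (intro nn_integral_cong) (simp add: space_restrict_space)
  moreover have "(AE x in lebesgue_on S. g x \<le> z) = (AE x in lebesgue_on S. h x \<le> z)" for z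
    using assms by (intro AE_cong) (simp add: space_restrict_space)
  ultimately show ?thesis by (simp add: Lq_def)
qed

section \<open>The K-functional of a compatible quasi-normed couple\<close>

locale quasi_couple =
  fixes A0 A1 :: "'a::hausdorff_tvs qspace"
  assumes qn: "quasi_normed A0" "quasi_normed A1" and compat: "compatible_couple A0 A1"
begin

lemma carr: "subspace (carr A0)" "subspace (carr A1)"
  using qn by (auto simp: quasi_normed_def)

lemma qnrm_zero: "qnrm A0 0 = 0" "qnrm A1 0 = 0"
  using qn subspace_0[OF carr(1)] subspace_0[OF carr(2)] by (auto simp: quasi_normed_def)

lemma qnrm_minus: "x \<in> carr A0 \<Longrightarrow> qnrm A0 (- x) = qnrm A0 x" "x \<in> carr A1 \<Longrightarrow> qnrm A1 (- x) = qnrm A1 x"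
proof -
  have "qnrm A0 ((- 1) *\<^sub>R x) = \<bar>- 1\<bar> * qnrm A0 x" if "x \<in> carr A0" using qn(1) that unfolding quasi_normed_def by blast
  then show "x \<in> carr A0 \<Longrightarrow> qnrm A0 (- x) = qnrm A0 x" by simp
  have "qnrm A1 ((- 1) *\<^sub>R x) = \<bar>- 1\<bar> * qnrm A1 x" if "x \<in> carr A1" using qn(2) that unfolding quasi_normed_def by blast
  then show "x \<in> carr A1 \<Longrightarrow> qnrm A1 (- x) = qnrm A1 x" by simp
qed

sublocale A: nonneg_couple A0 A1
  using qn by unfold_locales (auto simp: quasi_normed_def)

abbreviation "S \<equiv> sum_carr A0 A1"
abbreviation "K \<equiv> K_fun A0 A1"

lemma in_S: "x \<in> carr A0 \<Longrightarrow> x \<in> S" "x \<in> carr A1 \<Longrightarrow> x \<in> S"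
  using subspace_0[OF carr(1)] subspace_0[OF carr(2)] unfolding sum_carr_def
  by (fastforce intro: exI[of _ 0])+

lemma S_add: assumes "f \<in> S" "g \<in> S" shows "f + g \<in> S"
proof -
  obtain f0 f1 g0 g1 where "f = f0 + f1" "g = g0 + g1" "f0 \<in> carr A0" "g0 \<in> carr A0" "f1 \<in> carr A1" "g1 \<in> carr A1"
    using assms unfolding sum_carr_def by blast
  then have "f + g = (f0 + g0) + (f1 + g1)" "f0 + g0 \<in> carr A0" "f1 + g1 \<in> carr A1"
    using carr by (auto intro: subspace_add)
  then show ?thesis unfolding sum_carr_def by blast
qed

lemma K_carr: "0 \<le> t \<Longrightarrow> x \<in> carr A0 \<Longrightarrow> K t x \<le> qnrm A0 x"
  "0 \<le> t \<Longrightarrow> x \<in> carr A1 \<Longrightarrow> K t x \<le> t * qnrm A1 x"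
  using A.K_le[of x 0 t] A.K_le[of 0 x t] subspace_0[OF carr(1)] subspace_0[OF carr(2)]
  by (auto simp: qnrm_zero)

text \<open>Decompositions of \<open>f\<close> and \<open>g\<close> add up to one of f + g, and the
  infimum is taken over one after the other. The larger of the two quasi-triangle constants works
  for every t.\<close>

lemma K_add:
  obtains C where "1 \<le> C"
    "\<And>f g t. f \<in> S \<Longrightarrow> g \<in> S \<Longrightarrow> 0 \<le> t \<Longrightarrow> K t (f + g) \<le> C * (K t f + K t g)"
proof -
  have "\<exists>C\<ge>1. \<forall>x\<in>carr A0. \<forall>y\<in>carr A0. qnrm A0 (x + y) \<le> C * (qnrm A0 x + qnrm A0 y)"
    using qn by (simp add: quasi_normed_def)
  then obtain C0 where C0: "1 \<le> C0"
    "\<forall>x\<in>carr A0. \<forall>y\<in>carr A0. qnrm A0 (x + y) \<le> C0 * (qnrm A0 x + qnrm A0 y)"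
    by (elim exE conjE)
  have "\<exists>C\<ge>1. \<forall>x\<in>carr A1. \<forall>y\<in>carr A1. qnrm A1 (x + y) \<le> C * (qnrm A1 x + qnrm A1 y)"
    using qn by (simp add: quasi_normed_def)
  then obtain C1 where C1: "1 \<le> C1"
    "\<forall>x\<in>carr A1. \<forall>y\<in>carr A1. qnrm A1 (x + y) \<le> C1 * (qnrm A1 x + qnrm A1 y)"
    by (elim exE conjE)
  define C where "C = max C0 C1"
  have C: "1 \<le> C" using C0(1) by (simp add: C_def)
  have "K t (f + g) \<le> C * (K t f + K t g)" if f: "f \<in> S" and g: "g \<in> S" and t: "0 \<le> t" for f g t
  proof -
    have *: "K t (f + g) / C - (qnrm A0 g0 + t * qnrm A1 g1) \<le> qnrm A0 f0 + t * qnrm A1 f1"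
      if f: "f0 \<in> carr A0" "f1 \<in> carr A1" "f = f0 + f1" and g: "g0 \<in> carr A0" "g1 \<in> carr A1" "g = g0 + g1" for f0 f1 g0 g1
    proof -
      have "K t (f + g) = K t ((f0 + g0) + (f1 + g1))" using f g by (simp add: algebra_simps)
      also have "\<dots> \<le> qnrm A0 (f0 + g0) + t * qnrm A1 (f1 + g1)"
        using f g carr t by (intro A.K_le) (auto intro: subspace_add)
      also have "\<dots> \<le> C0 * (qnrm A0 f0 + qnrm A0 g0) + t * (C1 * (qnrm A1 f1 + qnrm A1 g1))"
        using f g t by (intro add_mono mult_left_mono C0(2)[rule_format] C1(2)[rule_format]) auto
      also have "\<dots> \<le> C * (qnrm A0 f0 + qnrm A0 g0) + t * (C * (qnrm A1 f1 + qnrm A1 g1))"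
        using f g t A.nonneg by (intro add_mono mult_left_mono mult_right_mono add_nonneg_nonneg) (auto simp: C_def)
      finally have "K t (f + g) / C \<le> qnrm A0 f0 + qnrm A0 g0 + t * (qnrm A1 f1 + qnrm A1 g1)"
        using C by (simp add: field_simps)
      then show ?thesis by (simp add: algebra_simps)
    qed
    have "K t (f + g) / C - (qnrm A0 g0 + t * qnrm A1 g1) \<le> K t f"
      if "g0 \<in> carr A0" "g1 \<in> carr A1" "g = g0 + g1" for g0 g1
      using that * by (intro A.K_greatest[OF f]) auto
    then have "K t (f + g) / C - K t f \<le> K t g"
      by (intro A.K_greatest[OF g]) (smt (verit))
    then show ?thesis using C by (simp add: field_simps)
  qed
  with C show ?thesis by (rule that)
qed

text \<open>If K(t, f) = 0, then f = f0 + f1 with both norms arbitrarily small, which puts f into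
  every neighbourhood of 0. Here the Hausdorff property of the ambient space and the compatibility
  of the couple enter.\<close>

lemma K_pos:
  assumes "f \<in> S" "f \<noteq> 0" "0 < t" shows "0 < K t f"
proof (rule ccontr)
  assume "\<not> 0 < K t f"
  then have K0: "K t f < z" if "0 < z" for z using that by linarith
  obtain U where U: "open U" "0 \<in> U" "f \<notin> U"
    using t1_space[of 0 f] assms(2) by auto
  have "((\<lambda>x. fst x + snd x) \<longlongrightarrow> 0 + 0) (nhds (0::'a) \<times>\<^sub>F nhds 0)"
    by (rule tendsto_add_Pair)
  then have "\<forall>\<^sub>F x in nhds (0::'a) \<times>\<^sub>F nhds 0. fst x + snd x \<in> U"
    using U(1,2) by (auto dest: topological_tendstoD)
  then obtain P Q where P: "eventually P (nhds (0::'a))" and Q: "eventually Q (nhds (0::'a))"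
    and PQ: "\<And>x y. P x \<Longrightarrow> Q y \<Longrightarrow> x + y \<in> U"
    unfolding eventually_prod_filter by auto
  obtain V W where V: "open V" "0 \<in> V" "\<And>x. x \<in> V \<Longrightarrow> P x" and W: "open W" "0 \<in> W" "\<And>x. x \<in> W \<Longrightarrow> Q x"
    using P Q unfolding eventually_nhds by blast
  have "embedded_in_ambient A0" using compat by (simp add: compatible_couple_def)
  from this[unfolded embedded_in_ambient_def, rule_format, of V] V(1,2)
  have "\<exists>d>0. \<forall>x\<in>carr A0. qnrm A0 x < d \<longrightarrow> x \<in> V" by simp
  then obtain d where d: "0 < d" "\<forall>x\<in>carr A0. qnrm A0 x < d \<longrightarrow> x \<in> V"
    by (elim exE conjE)
  have "embedded_in_ambient A1" using compat by (simp add: compatible_couple_def)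
  from this[unfolded embedded_in_ambient_def, rule_format, of W] W(1,2)
  have "\<exists>d>0. \<forall>x\<in>carr A1. qnrm A1 x < d \<longrightarrow> x \<in> W" by simp
  then obtain e where e: "0 < e" "\<forall>x\<in>carr A1. qnrm A1 x < e \<longrightarrow> x \<in> W"
    by (elim exE conjE)
  have "0 < min d (t * e)" using d e assms by simp
  from K0[OF this] obtain f0 f1 where f: "f0 \<in> carr A0" "f1 \<in> carr A1" "f = f0 + f1"
    and lt: "qnrm A0 f0 + t * qnrm A1 f1 < min d (t * e)"
    by (rule A.K_approx[OF assms(1)])
  have "0 \<le> qnrm A0 f0" "0 \<le> t * qnrm A1 f1" using f A.nonneg assms by auto
  then have "qnrm A0 f0 < d" "t * qnrm A1 f1 < t * e" using lt by linarith+
  then have "f0 \<in> V" "f1 \<in> W" using d e f assms by auto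
  then have "f \<in> U" using PQ V W f by auto
  then show False using U by simp
qed

text \<open>For f \<noteq> 0 positivity of K leaves room for K(t, f) < 2 K(t, f), so the infimum is
  attained up to the factor 2 without an additive error.\<close>

lemma near_optimal:
  assumes "f \<in> S" "0 < t"
  obtains f0 f1 where "f0 \<in> carr A0" "f1 \<in> carr A1" "f = f0 + f1"
    "qnrm A0 f0 \<le> 2 * K t f" "t * qnrm A1 f1 \<le> 2 * K t f"
proof (cases "f = 0")
  case True
  then show ?thesis
    using that[of 0 0] subspace_0[OF carr(1)] subspace_0[OF carr(2)] A.K_nonneg[OF assms(1)] assms(2)
    by (auto simp: qnrm_zero)
next
  case False
  then have "K t f < 2 * K t f" using K_pos[OF assms(1) _ assms(2)] by simp
  then obtain f0 f1 where f: "f0 \<in> carr A0" "f1 \<in> carr A1" "f = f0 + f1" "qnrm A0 f0 + t * qnrm A1 f1 < 2 * K t f"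
    by (rule A.K_approx[OF assms(1)])
  moreover have "0 \<le> qnrm A0 f0" "0 \<le> t * qnrm A1 f1" using f A.nonneg assms by auto
  ultimately show ?thesis by (intro that[of f0 f1]) auto
qed

end

section \<open>The limiting spaces and the two halves of the Holmstedt formula\<close>

locale interpolation_setting = quasi_couple A0 A1
  for A0 A1 :: "'a::hausdorff_tvs qspace" +
  fixes q0 r0 q1 r1 :: ennreal and a0 b0 a1 b1 :: "real \<Rightarrow> real"
  assumes exps: "0 < q0" "0 < r0" "0 < q1" "0 < r1"
    and svfs: "svf a0" "svf b0" "svf a1" "svf b1"
    and fin: "Lq r1 {1<..} (wt r1 b1) < \<infinity>"
      "Lq r1 {0<..<1} (\<lambda>s. wt r1 b1 s * Lq q1 {0<..<s} (wt q1 a1)) < \<infinity>"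
      "Lq r0 {0<..<1} (wt r0 b0) < \<infinity>"
      "Lq r0 {1<..} (\<lambda>s. wt r0 b0 s * Lq q0 {s<..} (wt q0 a0)) < \<infinity>"
begin

sublocale R: direction_weights 1 r0 q0 b0 a0
  using exps svfs by unfold_locales auto

sublocale L: direction_weights "- 1" r1 q1 b1 a1
  using exps svfs by unfold_locales auto

abbreviation "N0 \<equiv> dn r0 (\<lambda>k. b0 (pt 1 k)) q0 (\<lambda>k. a0 (pt 1 k))"
abbreviation "N1 \<equiv> dn r1 (\<lambda>k. b1 (pt (- 1) k)) q1 (\<lambda>k. a1 (pt (- 1) k))"
abbreviation "Chi0 \<equiv> chi0 r0 b0 q0 a0"
abbreviation "Chi1 \<equiv> chi1 r1 b1 q1 a1"
abbreviation "\<rho> \<equiv> rho Chi0 Chi1"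

definition c0 :: "real \<Rightarrow> real" where "c0 t = enn2real (Chi0 t)"
definition c1 :: "real \<Rightarrow> real" where "c1 t = enn2real (Chi1 t)"
text \<open>\<open>x1\<close> and \<open>kd\<close> are the counterparts of \<open>x0\<close> and \<open>ka\<close> for the reversed couple \<open>(A1, A0)\<close>, as
  \<open>K (t, f; A1, A0) = t K (1 / t, f; A0, A1)\<close>.\<close>

definition x0 :: "int \<Rightarrow> real" where "x0 n = c0 (pt 1 n)"
definition x1 :: "int \<Rightarrow> real" where "x1 n = c1 (pt (- 1) n)"
definition ka :: "'a \<Rightarrow> int \<Rightarrow> real" where "ka f n = K (pt 1 n) f"
definition kd :: "'a \<Rightarrow> int \<Rightarrow> real" where "kd f n = exp (of_int n) * K (pt (- 1) n) f"

lemma chi_gchi: "0 < t \<Longrightarrow> Chi0 t = gchi 1 r0 b0 q0 a0 t" "0 < t \<Longrightarrow> Chi1 t = gchi (- 1) r1 b1 q1 a1 t"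
  unfolding chi0_def chi1_def gchi_def
  by (auto simp: after_before intro!: arg_cong2[of _ _ _ _ "(+)"] Lq_cong)

lemma tail0: "tail_norm N0 x0" and svf_c0: "svf c0"
proof -
  have "Lq r0 (after 1 1) (\<lambda>s. wt r0 b0 s * Lq q0 (after 1 s) (wt q0 a0)) =
    Lq r0 {1<..} (\<lambda>s. wt r0 b0 s * Lq q0 {s<..} (wt q0 a0))"
    by (auto simp: after_before intro!: Lq_cong)
  with fin have *: "Lq r0 (before 1 1) (wt r0 b0) < \<infinity>"
    "Lq r0 (after 1 1) (\<lambda>s. wt r0 b0 s * Lq q0 (after 1 s) (wt q0 a0)) < \<infinity>"
    by (auto simp: after_before)
  show "tail_norm N0 x0" using R.gchi_facts(1)[OF *] by (simp add: x0_def[abs_def] c0_def chi_gchi)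
  show "svf c0" using R.gchi_facts(2)[OF *] by (simp add: svf_def c0_def chi_gchi)
qed

lemma tail1: "tail_norm N1 x1" and svf_c1: "svf c1"
proof -
  have "Lq r1 (after (- 1) 1) (\<lambda>s. wt r1 b1 s * Lq q1 (after (- 1) s) (wt q1 a1)) =
    Lq r1 {0<..<1} (\<lambda>s. wt r1 b1 s * Lq q1 {0<..<s} (wt q1 a1))"
    by (auto simp: after_before intro!: Lq_cong)
  with fin have *: "Lq r1 (before (- 1) 1) (wt r1 b1) < \<infinity>"
    "Lq r1 (after (- 1) 1) (\<lambda>s. wt r1 b1 s * Lq q1 (after (- 1) s) (wt q1 a1)) < \<infinity>"
    by (auto simp: after_before)
  show "tail_norm N1 x1" using L.gchi_facts(1)[OF *] by (simp add: x1_def[abs_def] c1_def chi_gchi)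
  show "svf c1" using L.gchi_facts(2)[OF *] by (simp add: svf_def c1_def chi_gchi)
qed

sublocale T0: tail_norm N0 x0 by (rule tail0)
sublocale T1: tail_norm N1 x1 by (rule tail1)

lemma pt_simps: "pt 1 n = exp (of_int n)" "pt (- 1) n = exp (- of_int n)" "pt (- 1) (- n) = exp (of_int n)"
  by (simp_all add: pt_def)

lemma kd_ka: "kd f n = exp (of_int n) * ka f (- n)" "ka f n = exp (of_int n) * kd f (- n)"
  by (simp_all add: kd_def ka_def pt_simps exp_minus)

lemma ka_nonneg: "f \<in> S \<Longrightarrow> 0 \<le> ka f n" and kd_nonneg: "f \<in> S \<Longrightarrow> 0 \<le> kd f n"
  by (simp_all add: ka_def kd_def A.K_nonneg less_imp_le[OF pt_pos])

lemma ka_mono: "f \<in> S \<Longrightarrow> i \<le> j \<Longrightarrow> ka f i \<le> ka f j"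
  by (simp add: ka_def pt_simps A.K_mono)

lemma kd_mono: "f \<in> S \<Longrightarrow> i \<le> j \<Longrightarrow> kd f i \<le> kd f j"
  using A.K_quot[of f "exp (- of_int j)" "exp (- of_int i)"]
  by (simp add: kd_def pt_simps exp_minus field_simps)

definition rn :: "int \<Rightarrow> real" where "rn n = exp (of_int n) * x0 n / x1 (- n)"

lemma rn_pos: "0 < rn n" using T0.pos T1.pos by (simp add: rn_def)

lemma rn_rho: "rn n = \<rho> (exp (of_int n))"
  by (simp add: rn_def rho_def x0_def x1_def c0_def c1_def pt_simps)

lemma rn_kd: "rn n * (x1 (- n) * kd f (- n)) = x0 n * ka f n"
  using T1.pos[of "- n"] kd_ka(2)[of f n] by (simp add: rn_def)

definition n0 :: "'a \<Rightarrow> ennreal" where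
  "n0 f = Lq r0 {0<..} (\<lambda>t. wt r0 b0 t * Lq q0 {t<..} (K_wt A0 A1 0 q0 a0 f))"
definition n1 :: "'a \<Rightarrow> ennreal" where
  "n1 f = Lq r1 {0<..} (\<lambda>t. wt r1 b1 t * Lq q1 {0<..<t} (K_wt A0 A1 1 q1 a1 f))"

abbreviation "X0 \<equiv> R_space A0 A1 0 r0 b0 q0 a0"
abbreviation "X1 \<equiv> L_space A0 A1 1 r1 b1 q1 a1"

abbreviation "SX \<equiv> sum_carr X0 X1"
abbreviation "KX \<equiv> K_fun X0 X1"

lemma X0_eq: "X0 = finite_part S n0" and X1_eq: "X1 = finite_part S n1"
  by (simp_all add: R_space_def L_space_def n0_def[abs_def] n1_def[abs_def])

lemma sample_ka: "(\<lambda>t. t powr (- 0) * K t f) (pt 1 j) = ka f j"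
  and sample_kd: "(\<lambda>t. t powr (- 1) * K t f) (pt (- 1) j) = kd f j"
  by (simp_all add: ka_def kd_def pt_simps powr_def)

lemma n0_equiv:
  "\<exists>C>0. \<forall>f\<in>S. n0 f \<le> ennreal C * N0 (\<lambda>j. ennreal (ka f j))"
  "\<exists>C>0. \<forall>f\<in>S. N0 (\<lambda>j. ennreal (ka f j)) \<le> ennreal C * n0 f"
proof -
  let ?d = "exp \<bar>0\<bar> * exp (1::real)"
  have eq: "n0 f = Lq r0 {0<..} (\<lambda>s. wt r0 b0 s * Lq q0 (after 1 s) (wt q0 (\<lambda>t. a0 t * (t powr (- 0) * K t f))))" for f
    unfolding n0_def K_wt_eq by (intro Lq_cong) (simp add: after_before)
  have reg: "reg ?d (\<lambda>t. t powr (- 0) * K t f)" if "f \<in> S" for f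
    using A.reg_powr_K[OF that, of 0] .
  show "\<exists>C>0. \<forall>f\<in>S. n0 f \<le> ennreal C * N0 (\<lambda>j. ennreal (ka f j))"
    using R.norm_le[of ?d] reg unfolding eq sample_ka[symmetric] by meson
  show "\<exists>C>0. \<forall>f\<in>S. N0 (\<lambda>j. ennreal (ka f j)) \<le> ennreal C * n0 f"
    using R.norm_ge[of ?d] reg unfolding eq sample_ka[symmetric] by meson
qed

lemma n1_equiv:
  "\<exists>C>0. \<forall>f\<in>S. n1 f \<le> ennreal C * N1 (\<lambda>j. ennreal (kd f j))"
  "\<exists>C>0. \<forall>f\<in>S. N1 (\<lambda>j. ennreal (kd f j)) \<le> ennreal C * n1 f"
proof -
  let ?d = "exp \<bar>1\<bar> * exp (1::real)"
  have eq: "n1 f = Lq r1 {0<..} (\<lambda>s. wt r1 b1 s * Lq q1 (after (- 1) s) (wt q1 (\<lambda>t. a1 t * (t powr (- 1) * K t f))))" for f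
    unfolding n1_def K_wt_eq by (intro Lq_cong) (simp add: after_before)
  have reg: "reg ?d (\<lambda>t. t powr (- 1) * K t f)" if "f \<in> S" for f
    using A.reg_powr_K[OF that, of 1] .
  show "\<exists>C>0. \<forall>f\<in>S. n1 f \<le> ennreal C * N1 (\<lambda>j. ennreal (kd f j))"
    using L.norm_le[of ?d] reg unfolding eq sample_kd[symmetric] by meson
  show "\<exists>C>0. \<forall>f\<in>S. N1 (\<lambda>j. ennreal (kd f j)) \<le> ennreal C * n1 f"
    using L.norm_ge[of ?d] reg unfolding eq sample_kd[symmetric] by meson
qed

definition H0 :: "'a \<Rightarrow> int \<Rightarrow> ennreal" where "H0 f n = N0 (low n (\<lambda>j. ennreal (ka f j)))"
text \<open>In the reversed order the low part up to - n is the part j >= n of the original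
  order.\<close>

definition H1 :: "'a \<Rightarrow> int \<Rightarrow> ennreal" where "H1 f n = N1 (low (- n) (\<lambda>j. ennreal (kd f j)))"
definition H :: "'a \<Rightarrow> int \<Rightarrow> ennreal" where
  "H f n = H0 f n + ennreal (x0 n * ka f n) + ennreal (rn n) * H1 f n"

sublocale X: nonneg_couple X0 X1
  by unfold_locales (auto simp: X0_eq X1_eq finite_part_def)

lemma sum_X_subset: "SX \<subseteq> S"
proof
  fix f assume "f \<in> SX"
  then obtain f0 f1 where "f = f0 + f1" "f0 \<in> S" "f1 \<in> S"
    unfolding sum_carr_def X0_eq X1_eq finite_part_def by auto
  then show "f \<in> S" using S_add by simp
qed

text \<open>A near-optimal decomposition for (A0, A1) at t = exp n is good enough for the limiting
  pair at \<rho>(t): K(u, f0) is controlled by K(u, f) for u <= t and by K(t, f) beyond, and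
  symmetrically for K(u, f1)/u. Finiteness of \<open>H f n\<close> puts the pieces into
  \<open>X0\<close> and \<open>X1\<close>, so membership of \<open>f\<close> in their sum is part of
  the conclusion.\<close>

lemma holmstedt_upper:
  "\<exists>C>0. \<forall>f\<in>S. \<forall>n. H f n < \<infinity> \<longrightarrow> f \<in> SX \<and> ennreal (KX (rn n) f) \<le> ennreal C * H f n"
proof -
  obtain Q where Q: "1 \<le> Q" "\<And>f g t. f \<in> S \<Longrightarrow> g \<in> S \<Longrightarrow> 0 \<le> t \<Longrightarrow> K t (f + g) \<le> Q * (K t f + K t g)"
    using K_add by blast
  have Q0: "0 < 3 * Q" using Q by simp
  obtain C0 where C0: "C0 > 0" "\<And>g h n. (\<forall>j. 0 \<le> h j) \<Longrightarrow> (\<forall>j\<le>n. g j \<le> 3 * Q * h j) \<Longrightarrow> (\<forall>j\<ge>n. g j \<le> 3 * Q * h n) \<Longrightarrow>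
    N0 (\<lambda>j. ennreal (g j)) \<le> ennreal C0 * (N0 (low n (\<lambda>j. ennreal (h j))) + ennreal (x0 n * h n))"
    using T0.le_low_plus_tail[OF Q0] by blast
  obtain C1 where C1: "C1 > 0" "\<And>g h n. (\<forall>j. 0 \<le> h j) \<Longrightarrow> (\<forall>j\<le>n. g j \<le> 3 * Q * h j) \<Longrightarrow> (\<forall>j\<ge>n. g j \<le> 3 * Q * h n) \<Longrightarrow>
    N1 (\<lambda>j. ennreal (g j)) \<le> ennreal C1 * (N1 (low n (\<lambda>j. ennreal (h j))) + ennreal (x1 n * h n))"
    using T1.le_low_plus_tail[OF Q0] by blast
  obtain D0 where D0: "D0 > 0" "\<And>f. f \<in> S \<Longrightarrow> n0 f \<le> ennreal D0 * N0 (\<lambda>j. ennreal (ka f j))"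
    using n0_equiv(1) by blast
  obtain D1 where D1: "D1 > 0" "\<And>f. f \<in> S \<Longrightarrow> n1 f \<le> ennreal D1 * N1 (\<lambda>j. ennreal (kd f j))"
    using n1_equiv(1) by blast
  define C where "C = D0 * C0 + D1 * C1"
  have C: "0 < C" "D0 * C0 \<le> C" "D1 * C1 \<le> C" using C0(1) C1(1) D0(1) D1(1) by (auto simp: C_def add_pos_pos)
  show ?thesis
  proof (intro exI[of _ "2 * C"] conjI ballI allI impI)
    fix f n assume f: "f \<in> S" and fin: "H f n < \<infinity>"
    define t where "t = exp (of_int n :: real)"
    have t: "0 < t" by (simp add: t_def)
    obtain f0 f1 where f01: "f0 \<in> carr A0" "f1 \<in> carr A1" "f = f0 + f1"
      and opt: "qnrm A0 f0 \<le> 2 * K t f" "t * qnrm A1 f1 \<le> 2 * K t f"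
      using near_optimal[OF f t] by blast
    have nn: "0 \<le> K u f" if "0 < u" for u using that f A.K_nonneg by simp
    have f0S: "f0 \<in> S" "f1 \<in> S" "- f0 \<in> carr A0" "- f1 \<in> carr A1" "- f0 \<in> S" "- f1 \<in> S"
      using f01 carr by (auto intro: in_S subspace_neg)
    \<comment> \<open>K(u, f1) <= (u/t) 2 K(t, f) <= 2 K(u, f), as K(u, f)/u is nonincreasing. The
      quasi-triangle inequality for f0 = f - f1 then gives (1 + 2) Q.\<close>
    have ks: "K u f0 \<le> 3 * Q * K u f" if "0 < u" "u \<le> t" for u
    proof -
      have "K u (f + - f1) \<le> Q * (K u f + K u (- f1))" using that f f0S by (intro Q) auto
      also have "K u (- f1) \<le> u * qnrm A1 f1"
        using K_carr(2)[of u "- f1"] f0S(4) f01(2) that by (simp add: qnrm_minus)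
      also have "u * qnrm A1 f1 = u / t * (t * qnrm A1 f1)" using t by simp
      also have "\<dots> \<le> u / t * (2 * K t f)" using that t opt by (intro mult_left_mono) auto
      also have "\<dots> \<le> 2 * K u f" using A.K_quot[OF f that] that t by (simp add: field_simps)
      finally show ?thesis using f01(3) Q by simp
    qed
    have kb: "K u f0 \<le> 3 * Q * K t f" if "0 < u" for u
    proof -
      have "K u f0 \<le> 2 * K t f" using K_carr(1)[of u f0] that f01 opt by simp
      also have "\<dots> \<le> 3 * Q * K t f" using Q nn[OF t] by (intro mult_right_mono) auto
      finally show ?thesis .
    qed
    have ds: "K u f1 \<le> 3 * Q * K u f" if "t \<le> u" for u
    proof -
      have u: "0 < u" using that t by simp
      have "K u (f + - f0) \<le> Q * (K u f + K u (- f0))" using u f f0S by (intro Q) auto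
      also have "K u (- f0) \<le> qnrm A0 f0"
        using K_carr(1)[of u "- f0"] f0S(3) f01(1) u by (simp add: qnrm_minus)
      also have "\<dots> \<le> 2 * K u f" using opt A.K_mono[OF f _ that] t by simp
      finally show ?thesis using f01(3) Q by (simp add: algebra_simps)
    qed
    have db: "K u f1 / u \<le> 3 * Q * (K t f / t)" if "0 < u" for u
    proof -
      have "K u f1 / u \<le> qnrm A1 f1" using K_carr(2)[of u f1] that f01 by (simp add: field_simps)
      also have "\<dots> \<le> 2 * (K t f / t)" using opt t by (simp add: field_simps)
      also have "\<dots> \<le> 3 * Q * (K t f / t)" using Q nn[OF t] t by (intro mult_right_mono) auto
      finally show ?thesis .
    qed
    have N0: "N0 (\<lambda>j. ennreal (ka f0 j)) \<le> ennreal C0 * (H0 f n + ennreal (x0 n * ka f n))"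
      unfolding H0_def
    proof (rule C0(2))
      show "\<forall>j\<le>n. ka f0 j \<le> 3 * Q * ka f j" using ks by (simp add: ka_def pt_simps t_def)
      show "\<forall>j\<ge>n. ka f0 j \<le> 3 * Q * ka f n" using kb by (simp add: ka_def pt_simps t_def)
    qed (simp add: ka_nonneg f)
    have N1: "N1 (\<lambda>j. ennreal (kd f1 j)) \<le> ennreal C1 * (H1 f n + ennreal (x1 (- n) * kd f (- n)))"
      unfolding H1_def
    proof (rule C1(2))
      show "\<forall>j\<le>- n. kd f1 j \<le> 3 * Q * kd f j"
      proof (intro allI impI)
        fix j assume "j \<le> - n"
        then have "t \<le> exp (- of_int j)" unfolding t_def exp_le_cancel_iff
          by (metis minus_le_iff of_int_le_iff of_int_minus le_minus_iff)
        from ds[OF this] show "kd f1 j \<le> 3 * Q * kd f j" by (simp add: kd_def pt_simps mult.left_commute)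
      qed
      show "\<forall>j\<ge>- n. kd f1 j \<le> 3 * Q * kd f (- n)"
        using db[of "exp (- of_int j)" for j] by (simp add: kd_def pt_simps t_def exp_minus field_simps)
    qed (simp add: kd_nonneg f)
    have h0: "n0 f0 \<le> ennreal C * (H0 f n + ennreal (x0 n * ka f n))"
    proof -
      have "n0 f0 \<le> ennreal (D0 * C0) * (H0 f n + ennreal (x0 n * ka f n))"
        using D0 f0S N0 by (intro ennreal_le_trans_mult[OF D0(2)]) auto
      also have "\<dots> \<le> ennreal C * (H0 f n + ennreal (x0 n * ka f n))"
        using C by (intro mult_right_mono ennreal_leI) auto
      finally show ?thesis .
    qed
    have h1: "n1 f1 \<le> ennreal C * (H1 f n + ennreal (x1 (- n) * kd f (- n)))"
    proof -
      have "n1 f1 \<le> ennreal (D1 * C1) * (H1 f n + ennreal (x1 (- n) * kd f (- n)))"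
        using D1 f0S N1 by (intro ennreal_le_trans_mult[OF D1(2)]) auto
      also have "\<dots> \<le> ennreal C * (H1 f n + ennreal (x1 (- n) * kd f (- n)))"
        using C by (intro mult_right_mono ennreal_leI) auto
      finally show ?thesis .
    qed
    have Hfin: "H0 f n < \<infinity>" "H1 f n < \<infinity>"
      using fin rn_pos[of n] by (auto simp: H_def ennreal_mult_less_top)
    have fin01: "n0 f0 < \<infinity>" "n1 f1 < \<infinity>"
      by (rule le_mult_finite[OF h0], use Hfin in simp) (rule le_mult_finite[OF h1], use Hfin in simp)
    have X01: "f0 \<in> carr X0" "f1 \<in> carr X1"
      using fin01 f0S by (auto simp: X0_eq X1_eq finite_part_def)
    then show "f \<in> SX" using f01(3) by (auto simp: sum_carr_def)
    have "KX (rn n) f \<le> enn2real (n0 f0) + rn n * enn2real (n1 f1)"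
      using X.K_le[OF X01, of "rn n"] rn_pos[of n] f01(3) by (simp add: X0_eq X1_eq finite_part_def)
    then have "ennreal (KX (rn n) f) \<le> n0 f0 + ennreal (rn n) * n1 f1"
      using fin01 rn_pos[of n] by (simp add: ennreal_mult' ennreal_leI[THEN order.trans] less_imp_le)
    also have "\<dots> \<le> ennreal C * (H0 f n + ennreal (x0 n * ka f n)) +
       ennreal (rn n) * (ennreal C * (H1 f n + ennreal (x1 (- n) * kd f (- n))))"
      by (intro add_mono mult_left_mono h0 h1) auto
    also have "\<dots> = ennreal C * (H0 f n + ennreal (x0 n * ka f n) + (ennreal (rn n) * H1 f n + ennreal (rn n * (x1 (- n) * kd f (- n)))))"
      unfolding ennreal_mult'[OF less_imp_le[OF rn_pos]] by (simp only: distrib_left mult_ac add_ac)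
    also have "\<dots> \<le> ennreal C * (H f n + H f n)"
    proof -
      \<comment> \<open>Each of the two pieces brings in the middle term once, which a single copy
        of \<open>H f n\<close> does not cover.\<close>
      have "H f n + H f n = H0 f n + ennreal (x0 n * ka f n) + (ennreal (rn n) * H1 f n + ennreal (x0 n * ka f n)) +
          (H0 f n + ennreal (rn n) * H1 f n)"
        unfolding H_def by (simp only: add_ac)
      then show ?thesis unfolding rn_kd by (intro mult_left_mono) simp_all
    qed
    also have "\<dots> = ennreal (2 * C) * H f n"
    proof -
      have "ennreal (2 * C) = ennreal C + ennreal C" using C(1) by (metis ennreal_plus mult_2 less_imp_le)
      then show ?thesis by (simp only: distrib_left distrib_right)
    qed
    finally show "ennreal (KX (rn n) f) \<le> ennreal (2 * C) * H f n" .
  qed (use C in auto)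
qed

text \<open>Given any decomposition, each term of \<open>H\<close> is split along it. A low part is
  bounded by the full norm when the piece belongs to the space in question and by
  \<open>cross_term_le\<close> otherwise; in the middle term both pieces are treated by
  \<open>tail_mult_le\<close>. The infimum over all decompositions gives the claim.\<close>

lemma holmstedt_lower:
  "\<exists>C>0. \<forall>f\<in>SX. \<forall>n. H f n \<le> ennreal C * ennreal (KX (rn n) f)"
proof -
  obtain Q where Q: "1 \<le> Q" "\<And>f g t. f \<in> S \<Longrightarrow> g \<in> S \<Longrightarrow> 0 \<le> t \<Longrightarrow> K t (f + g) \<le> Q * (K t f + K t g)"
    using K_add by blast
  obtain M0 where M0: "M0 > 0" "\<And>g h. N0 (\<lambda>j. g j + h j) \<le> ennreal M0 * (N0 g + N0 h)"
    using T0.add by blast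
  obtain M1 where M1: "M1 > 0" "\<And>g h. N1 (\<lambda>j. g j + h j) \<le> ennreal M1 * (N1 g + N1 h)"
    using T1.add by blast
  obtain D0 where D0: "D0 > 0" "\<And>f. f \<in> S \<Longrightarrow> N0 (\<lambda>j. ennreal (ka f j)) \<le> ennreal D0 * n0 f"
    using n0_equiv(2) by blast
  obtain D1 where D1: "D1 > 0" "\<And>f. f \<in> S \<Longrightarrow> N1 (\<lambda>j. ennreal (kd f j)) \<le> ennreal D1 * n1 f"
    using n1_equiv(2) by blast
  obtain B0 where B0: "B0 > 0" "\<And>\<kappa> n. (\<forall>j. 0 \<le> \<kappa> j) \<Longrightarrow> mono (\<lambda>j. exp (of_int j) * \<kappa> (- j)) \<Longrightarrow>
     N0 (low n (\<lambda>j. ennreal (\<kappa> j))) \<le>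
       ennreal (B0 * (exp (of_int n) * x0 n / x1 (- n))) * N1 (\<lambda>j. ennreal (exp (of_int j) * \<kappa> (- j)))"
    using cross_term_le[OF tail0 tail1] by blast
  obtain B1 where B1: "B1 > 0" "\<And>\<kappa> n. (\<forall>j. 0 \<le> \<kappa> j) \<Longrightarrow> mono (\<lambda>j. exp (of_int j) * \<kappa> (- j)) \<Longrightarrow>
     N1 (low n (\<lambda>j. ennreal (\<kappa> j))) \<le>
       ennreal (B1 * (exp (of_int n) * x1 n / x0 (- n))) * N0 (\<lambda>j. ennreal (exp (of_int j) * \<kappa> (- j)))"
    using cross_term_le[OF tail1 tail0] by blast
  obtain E0 where E0: "E0 > 0" "\<And>h n. (\<forall>j. 0 \<le> h j) \<Longrightarrow> (\<forall>j\<ge>n. h n \<le> h j) \<Longrightarrow>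
     ennreal (x0 n * h n) \<le> ennreal E0 * N0 (\<lambda>j. ennreal (h j))"
    using T0.tail_mult_le by blast
  obtain E1 where E1: "E1 > 0" "\<And>h n. (\<forall>j. 0 \<le> h j) \<Longrightarrow> (\<forall>j\<ge>n. h n \<le> h j) \<Longrightarrow>
     ennreal (x1 n * h n) \<le> ennreal E1 * N1 (\<lambda>j. ennreal (h j))"
    using T1.tail_mult_le by blast
  define B where "B = 1 + B0 + B1 + E0 + E1"
  have B: "1 \<le> B" "B0 \<le> B" "B1 \<le> B" "E0 \<le> B" "E1 \<le> B"
    using B0(1) B1(1) E0(1) E1(1) by (auto simp: B_def)
  define G where "G = Q * (M0 + M1 + 1) * B * (D0 + D1)"
  have up: "ennreal x * y \<le> ennreal z * y" if "x \<le> z" for x z :: real and y :: ennreal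
    using that by (intro mult_right_mono ennreal_leI) auto
  have pos: "0 < Q" "0 < M0 + M1 + 1" "0 < B" "0 < D0 + D1"
    using Q M0 M1 B D0 D1 by auto
  then have G: "0 < G" by (simp add: G_def)
  show ?thesis
  proof (intro exI[of _ "3 * G"] conjI ballI allI)
    fix f n assume f: "f \<in> SX"
    have *: "H f n \<le> ennreal (3 * G * (qnrm X0 f0 + rn n * qnrm X1 f1))"
      if f01: "f0 \<in> carr X0" "f1 \<in> carr X1" "f = f0 + f1" for f0 f1
    proof -
      have S: "f0 \<in> S" "f1 \<in> S" "f \<in> S" and q: "ennreal (qnrm X0 f0) = n0 f0" "ennreal (qnrm X1 f1) = n1 f1"
        using f01 f sum_X_subset by (auto simp: X0_eq X1_eq finite_part_def)
      define a where "a = N0 (\<lambda>j. ennreal (ka f0 j))"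
      \<comment> \<open>The factor \<rho> makes a + b bounded by a multiple of the quantity whose
        infimum is \<open>KX (rn n) f\<close>.\<close>
      define b where "b = ennreal (rn n) * N1 (\<lambda>j. ennreal (kd f1 j))"
      have ka: "ka f j \<le> Q * (ka f0 j + ka f1 j)" for j
        using Q(2)[OF S(1,2), of "pt 1 j"] f01(3) by (simp add: ka_def less_imp_le)
      have kd: "kd f j \<le> Q * (kd f0 j + kd f1 j)" for j
        using mult_left_mono[OF ka[of "- j"], of "exp (of_int j)"] by (simp add: kd_ka(1) algebra_simps)
      have kdm: "mono (\<lambda>j. exp (of_int j) * ka f1 (- j))"
        unfolding kd_ka(1)[symmetric] by (intro monoI kd_mono S)
      have kam: "mono (\<lambda>j. exp (of_int j) * kd f0 (- j))"
        unfolding kd_ka(2)[symmetric] by (intro monoI ka_mono S)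
      have low_add: "low m (\<lambda>j. ennreal (h j)) i \<le> ennreal Q * (low m (\<lambda>j. ennreal (h0 j)) i + low m (\<lambda>j. ennreal (h1 j)) i)"
        if "\<And>j. h j \<le> Q * (h0 j + h1 j)" "\<And>j. 0 \<le> h0 j" "\<And>j. 0 \<le> h1 j" for h h0 h1 :: "int \<Rightarrow> real" and m i
        using that[of i] Q(1) by (auto simp: low_def ennreal_mult'[symmetric] ennreal_plus[symmetric] simp del: ennreal_plus intro!: ennreal_leI)
      have H0: "H0 f n \<le> ennreal (Q * (M0 + M1 + 1) * B) * (a + b)"
      proof -
        have "H0 f n \<le> N0 (\<lambda>j. ennreal Q * (low n (\<lambda>j. ennreal (ka f0 j)) j + low n (\<lambda>j. ennreal (ka f1 j)) j))"
          unfolding H0_def using ka S by (intro T0.mono low_add ka_nonneg)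
        also have "\<dots> \<le> ennreal Q * (ennreal M0 * (N0 (low n (\<lambda>j. ennreal (ka f0 j))) + N0 (low n (\<lambda>j. ennreal (ka f1 j)))))"
          using Q by (subst T0.cmult) (auto intro!: mult_left_mono M0)
        also have "N0 (low n (\<lambda>j. ennreal (ka f0 j))) \<le> ennreal 1 * a"
          unfolding a_def ennreal_1 mult_1 by (intro T0.mono) (simp add: low_def)
        also have "\<dots> \<le> ennreal B * a" by (rule up[OF B(1)])
        also have "N0 (low n (\<lambda>j. ennreal (ka f1 j))) \<le> ennreal (B0 * rn n) * N1 (\<lambda>j. ennreal (kd f1 j))"
          using B0(2)[OF _ kdm, of n] ka_nonneg[OF S(2)] by (simp add: rn_def kd_ka(1)[symmetric])
        also have "\<dots> = ennreal B0 * b" using B0(1) rn_pos[of n] by (simp add: b_def ennreal_mult' mult.assoc)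
        also have "\<dots> \<le> ennreal B * b" by (rule up[OF B(2)])
        finally have "H0 f n \<le> ennreal Q * (ennreal M0 * (ennreal B * a + ennreal B * b))"
          by (simp add: mult_left_mono add_mono)
        also have "\<dots> = ennreal (Q * M0 * B) * (a + b)"
          using pos M0(1) by (simp add: ennreal_mult' mult.assoc distrib_left)
        also have "\<dots> \<le> ennreal (Q * (M0 + M1 + 1) * B) * (a + b)"
          using pos M1(1) by (intro up mult_right_mono mult_left_mono) auto
        finally show ?thesis .
      qed
      have H1: "ennreal (rn n) * H1 f n \<le> ennreal (Q * (M0 + M1 + 1) * B) * (a + b)"
      proof -
        have "H1 f n \<le> N1 (\<lambda>j. ennreal Q * (low (- n) (\<lambda>j. ennreal (kd f0 j)) j + low (- n) (\<lambda>j. ennreal (kd f1 j)) j))"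
          unfolding H1_def using kd S by (intro T1.mono low_add kd_nonneg)
        also have "\<dots> \<le> ennreal Q * (ennreal M1 * (N1 (low (- n) (\<lambda>j. ennreal (kd f0 j))) + N1 (low (- n) (\<lambda>j. ennreal (kd f1 j)))))"
          using Q by (subst T1.cmult) (auto intro!: mult_left_mono M1)
        also have "N1 (low (- n) (\<lambda>j. ennreal (kd f1 j))) \<le> ennreal 1 * N1 (\<lambda>j. ennreal (kd f1 j))"
          unfolding ennreal_1 mult_1 by (intro T1.mono) (simp add: low_def)
        also have "\<dots> \<le> ennreal B * N1 (\<lambda>j. ennreal (kd f1 j))" by (rule up[OF B(1)])
        also have "N1 (low (- n) (\<lambda>j. ennreal (kd f0 j))) \<le> ennreal (B1 * inverse (rn n)) * a"
          using B1(2)[OF _ kam, of "- n"] kd_nonneg[OF S(1)] T0.pos[of n]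
          by (simp add: a_def rn_def kd_ka(2)[symmetric] exp_minus field_simps)
        also have "\<dots> = ennreal B1 * (ennreal (inverse (rn n)) * a)" using B1(1) rn_pos[of n] by (simp add: ennreal_mult' mult.assoc)
        also have "\<dots> \<le> ennreal B * (ennreal (inverse (rn n)) * a)" by (rule up[OF B(3)])
        finally have "H1 f n \<le> ennreal Q * (ennreal M1 * (ennreal B * (ennreal (inverse (rn n)) * a) + ennreal B * N1 (\<lambda>j. ennreal (kd f1 j))))"
          by (simp add: mult_left_mono add_mono)
        then have "ennreal (rn n) * H1 f n \<le> ennreal (rn n) * (ennreal Q * (ennreal M1 * (ennreal B * (ennreal (inverse (rn n)) * a) + ennreal B * N1 (\<lambda>j. ennreal (kd f1 j)))))"
          by (rule mult_left_mono) simp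
        also have "\<dots> = ennreal Q * (ennreal M1 * (ennreal B * (ennreal (rn n) * (ennreal (inverse (rn n)) * a)) + ennreal B * b))"
          unfolding b_def by (simp only: distrib_left mult_ac)
        also have "\<dots> = ennreal (Q * M1 * B) * (a + b)"
          using pos M1(1) by (simp add: ennreal_inverse_cancel rn_pos) (simp add: ennreal_mult' mult.assoc distrib_left)
        also have "\<dots> \<le> ennreal (Q * (M0 + M1 + 1) * B) * (a + b)"
          using pos M0(1) by (intro up mult_right_mono mult_left_mono) auto
        finally show ?thesis .
      qed
      have Hm: "ennreal (x0 n * ka f n) \<le> ennreal (Q * (M0 + M1 + 1) * B) * (a + b)"
      proof -
        have "x0 n * ka f n \<le> x0 n * (Q * (ka f0 n + ka f1 n))"
          using T0.pos[of n] by (intro mult_left_mono ka) auto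
        then have "ennreal (x0 n * ka f n) \<le> ennreal (Q * (x0 n * ka f0 n + rn n * (x1 (- n) * kd f1 (- n))))"
          unfolding rn_kd by (intro ennreal_leI) (simp add: algebra_simps)
        also have "\<dots> = ennreal Q * (ennreal (x0 n * ka f0 n) + ennreal (rn n) * ennreal (x1 (- n) * kd f1 (- n)))"
          using Q(1) T0.pos[of n] T1.pos[of "- n"] ka_nonneg[OF S(1), of n] kd_nonneg[OF S(2), of "- n"] rn_pos[of n]
          by (simp add: ennreal_mult'[symmetric] ennreal_plus[symmetric] del: ennreal_plus)
        also have "ennreal (x0 n * ka f0 n) \<le> ennreal E0 * a"
          unfolding a_def using ka_nonneg[OF S(1)] ka_mono[OF S(1)] by (intro E0) auto
        also have "\<dots> \<le> ennreal B * a" by (rule up[OF B(4)])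
        also have "ennreal (x1 (- n) * kd f1 (- n)) \<le> ennreal E1 * N1 (\<lambda>j. ennreal (kd f1 j))"
          using kd_nonneg[OF S(2)] kd_mono[OF S(2)] by (intro E1) auto
        also have "\<dots> \<le> ennreal B * N1 (\<lambda>j. ennreal (kd f1 j))" by (rule up[OF B(5)])
        finally have "ennreal (x0 n * ka f n) \<le> ennreal Q * (ennreal B * a + ennreal (rn n) * (ennreal B * N1 (\<lambda>j. ennreal (kd f1 j))))"
          by (simp add: mult_left_mono add_mono)
        also have "\<dots> = ennreal (Q * 1 * B) * (a + b)"
          using pos by (simp add: b_def ennreal_mult' distrib_left mult_ac)
        also have "\<dots> \<le> ennreal (Q * (M0 + M1 + 1) * B) * (a + b)"
          using pos M0(1) M1(1) by (intro up mult_right_mono mult_left_mono) auto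
        finally show ?thesis .
      qed
      have three: "x + x + x = ennreal 3 * x" for x :: ennreal
      proof -
        have "ennreal 3 = 1 + 1 + 1" by simp
        then show ?thesis by (simp only: distrib_right mult_1)
      qed
      have "H f n \<le> ennreal 3 * (ennreal (Q * (M0 + M1 + 1) * B) * (a + b))"
        unfolding three[symmetric] H_def by (intro add_mono H0 H1 Hm)
      also have "a + b \<le> ennreal (D0 + D1) * (n0 f0 + ennreal (rn n) * n1 f1)"
      proof -
        have "a \<le> ennreal D0 * n0 f0" unfolding a_def by (rule D0(2)[OF S(1)])
        also have "\<dots> \<le> ennreal (D0 + D1) * n0 f0" using D1(1) by (intro up) auto
        finally have a: "a \<le> ennreal (D0 + D1) * n0 f0" .
        have "b \<le> ennreal (rn n) * (ennreal D1 * n1 f1)" unfolding b_def by (intro mult_left_mono D1(2)[OF S(2)]) auto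
        also have "\<dots> = ennreal D1 * (ennreal (rn n) * n1 f1)" by (simp only: mult_ac)
        also have "\<dots> \<le> ennreal (D0 + D1) * (ennreal (rn n) * n1 f1)" using D0(1) by (intro up) auto
        finally show ?thesis unfolding distrib_left by (intro add_mono a)
      qed
      also have "n0 f0 + ennreal (rn n) * n1 f1 = ennreal (qnrm X0 f0 + rn n * qnrm X1 f1)"
        using X.nonneg(1)[OF f01(1)] X.nonneg(2)[OF f01(2)] rn_pos[of n]
        by (simp add: q[symmetric] ennreal_mult'[symmetric] ennreal_plus[symmetric] del: ennreal_plus)
      finally have "H f n \<le> ennreal 3 * (ennreal (Q * (M0 + M1 + 1) * B) * (ennreal (D0 + D1) * ennreal (qnrm X0 f0 + rn n * qnrm X1 f1)))"
        by (simp add: mult_left_mono del: ennreal_numeral)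
      also have "\<dots> = ennreal (3 * G * (qnrm X0 f0 + rn n * qnrm X1 f1))"
      proof -
        have eq: "ennreal 3 * (ennreal x * (ennreal y * ennreal z)) = ennreal (3 * (x * y) * z)" if "0 \<le> x" "0 \<le> y" for x y z
          using that by (simp add: ennreal_mult'[symmetric] mult.assoc del: ennreal_numeral)
        show ?thesis unfolding G_def by (rule eq) (use pos in simp_all)
      qed
      finally show ?thesis .
    qed
    \<comment> \<open>One decomposition shows that \<open>H f n\<close> is finite; this is required
      before passing to the real-valued infimum.\<close>
    have "\<exists>h\<ge>0. H f n = ennreal h"
    proof -
      obtain f0 f1 where "f0 \<in> carr X0" "f1 \<in> carr X1" "f = f0 + f1" using f by (auto simp: sum_carr_def)
      from *[OF this] show ?thesis by (cases "H f n") (auto simp: top_unique)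
    qed
    then obtain h where h: "0 \<le> h" "H f n = ennreal h" by blast
    have "h / (3 * G) \<le> KX (rn n) f"
    proof (rule X.K_greatest[OF f])
      fix f0 f1 assume f01: "f0 \<in> carr X0" "f1 \<in> carr X1" "f = f0 + f1"
      have "0 \<le> qnrm X0 f0 + rn n * qnrm X1 f1"
        using X.nonneg(1)[OF f01(1)] X.nonneg(2)[OF f01(2)] rn_pos[of n] by simp
      with *[OF f01] h G have "h \<le> 3 * G * (qnrm X0 f0 + rn n * qnrm X1 f1)" by (simp add: ennreal_le_iff)
      then show "h / (3 * G) \<le> qnrm X0 f0 + rn n * qnrm X1 f1" using G by (simp add: field_simps)
    qed
    then have "h \<le> 3 * G * KX (rn n) f" using G by (simp add: field_simps)
    then show "H f n \<le> ennreal (3 * G) * ennreal (KX (rn n) f)"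
      unfolding h(2) using G by (subst ennreal_mult'[symmetric]) (auto intro!: ennreal_leI)
  qed (use G in auto)
qed

end

section \<open>Interpolation of the limiting spaces\<close>

text \<open>The domain is explicit because the K-functional of the limiting pair is meaningful only
  on their sum, whereas other comparisons hold on all of A0 + A1.\<close>

definition lesssim :: "'b set \<Rightarrow> ('b \<Rightarrow> ennreal) \<Rightarrow> ('b \<Rightarrow> ennreal) \<Rightarrow> bool" where
  "lesssim S F G \<longleftrightarrow> (\<exists>C>0. \<forall>f\<in>S. F f \<le> ennreal C * G f)"

lemma lesssimI: "0 < C \<Longrightarrow> (\<And>f. f \<in> S \<Longrightarrow> F f \<le> ennreal C * G f) \<Longrightarrow> lesssim S F G"
  by (auto simp: lesssim_def)

lemma lesssim_mono: "(\<And>f. f \<in> S \<Longrightarrow> F f \<le> G f) \<Longrightarrow> lesssim S F G"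
  by (rule lesssimI[of 1]) simp_all

lemma lesssim_trans [trans]: "lesssim S F G \<Longrightarrow> lesssim S G H \<Longrightarrow> lesssim S F H"
  unfolding lesssim_def by (metis ennreal_le_trans_mult less_imp_le mult_pos_pos)

lemma lesssim_subset: "lesssim S F G \<Longrightarrow> T \<subseteq> S \<Longrightarrow> lesssim T F G"
  unfolding lesssim_def by blast

lemma lesssim_add:
  assumes "lesssim S F H" "lesssim S G H" shows "lesssim S (\<lambda>f. F f + G f) H"
proof -
  obtain C where C: "C > 0" "\<And>f. f \<in> S \<Longrightarrow> F f \<le> ennreal C * H f" using assms unfolding lesssim_def by blast
  obtain D where D: "D > 0" "\<And>f. f \<in> S \<Longrightarrow> G f \<le> ennreal D * H f" using assms unfolding lesssim_def by blast
  show ?thesis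
  proof (rule lesssimI)
    show "F f + G f \<le> ennreal (C + D) * H f" if "f \<in> S" for f
      using add_mono[OF C(2)[OF that] D(2)[OF that]] C(1) D(1) by (simp add: distrib_right)
  qed (use C D in simp)
qed

lemma embedded_finite_part:
  assumes "T \<subseteq> S" "lesssim T F M" shows "embedded (finite_part T M) (finite_part S F)"
proof -
  obtain C where C: "C > 0" "\<And>f. f \<in> T \<Longrightarrow> F f \<le> ennreal C * M f" using assms unfolding lesssim_def by blast
  have "F f < \<infinity> \<and> enn2real (F f) \<le> C * enn2real (M f)" if "f \<in> T" "M f < \<infinity>" for f
  proof
    show fin: "F f < \<infinity>" using le_mult_finite[OF C(2)] that by blast
    have "enn2real (F f) \<le> enn2real (ennreal C * M f)"
      using that C(1) by (intro enn2real_mono C(2)) (auto simp: ennreal_mult_less_top)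
    then show "enn2real (F f) \<le> C * enn2real (M f)" using C(1) by (simp add: enn2real_mult)
  qed
  then show ?thesis using assms(1) C(1) unfolding embedded_def finite_part_def by auto
qed

lemma embedded_inter:
  assumes "embedded Z X" "embedded Z Y" "\<And>f. f \<in> carr Z \<Longrightarrow> 0 \<le> qnrm Z f"
  shows "embedded Z (inter_space X Y)"
proof -
  obtain C where C: "C > 0" "carr Z \<subseteq> carr X" "\<And>f. f \<in> carr Z \<Longrightarrow> qnrm X f \<le> C * qnrm Z f"
    using assms(1) unfolding embedded_def by blast
  obtain D where D: "D > 0" "carr Z \<subseteq> carr Y" "\<And>f. f \<in> carr Z \<Longrightarrow> qnrm Y f \<le> D * qnrm Z f"
    using assms(2) unfolding embedded_def by blast
  have "qnrm X f \<le> max C D * qnrm Z f" "qnrm Y f \<le> max C D * qnrm Z f" if "f \<in> carr Z" for f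
    using C(3)[OF that] D(3)[OF that] mult_right_mono[of _ "max C D", OF _ assms(3)[OF that]]
    by (meson max.cobounded1 max.cobounded2 order.trans)+
  then show ?thesis using C D unfolding embedded_def inter_space_def
    by (auto intro!: exI[of _ "max C D"])
qed

text \<open>The larger set \<open>S\<close> need not lie in \<open>T\<close>: membership in
  \<open>T\<close> has to come out of the finiteness of both norms, as it does for the sum of the
  limiting spaces.\<close>

lemma embedded_inter_finite_part:
  assumes "0 < C" "\<And>f. f \<in> S \<Longrightarrow> F f < \<infinity> \<Longrightarrow> G f < \<infinity> \<Longrightarrow> f \<in> T \<and> M f \<le> ennreal C * (F f + G f)"
  shows "embedded (inter_space (finite_part S F) (finite_part S G)) (finite_part T M)"
proof -
  have "f \<in> T \<and> M f < \<infinity> \<and> enn2real (M f) \<le> 2 * C * max (enn2real (F f)) (enn2real (G f))"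
    if f: "f \<in> S" "F f < \<infinity>" "G f < \<infinity>" for f
  proof (intro conjI)
    show "f \<in> T" using assms(2)[OF f] by blast
    have le: "M f \<le> ennreal C * (F f + G f)" using assms(2)[OF f] by blast
    show "M f < \<infinity>" using le_mult_finite[OF le] f by simp
    have "enn2real (M f) \<le> enn2real (ennreal C * (F f + G f))"
      using f by (intro enn2real_mono le) (auto simp: ennreal_mult_less_top)
    also have "\<dots> = C * (enn2real (F f) + enn2real (G f))"
      using f assms(1) by (simp add: enn2real_mult enn2real_plus)
    also have "\<dots> \<le> C * (2 * max (enn2real (F f)) (enn2real (G f)))"
      using assms(1) by (intro mult_left_mono) auto
    finally show "enn2real (M f) \<le> 2 * C * max (enn2real (F f)) (enn2real (G f))" by simp
  qed
  then show ?thesis using assms(1) unfolding embedded_def inter_space_def finite_part_def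
    by (auto intro!: exI[of _ "2 * C"])
qed

section \<open>The interpolation norm sampled along \<rho>\<close>

locale interpolation_weight = interpolation_setting A0 A1 q0 r0 q1 r1 a0 b0 a1 b1
  for A0 A1 :: "'a::hausdorff_tvs qspace" and q0 r0 q1 r1 :: ennreal and a0 b0 a1 b1 :: "real \<Rightarrow> real" +
  fixes r :: ennreal and a :: "real \<Rightarrow> real"
  assumes r: "0 < r" and svf_a: "svf a"
begin

lemma rho_pos: "0 < t \<Longrightarrow> 0 < \<rho> t"
  using svf_pos[OF svf_c0] svf_pos[OF svf_c1] by (simp add: rho_def c0_def c1_def)

text \<open>The logarithm of \<rho>(t)/t is the difference of ln \<open>c0\<close> and ln
  \<open>c1\<close>, each allotted the slope 1/4. As the total 1/2 is below 1, ln \<rho> grows at a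
  speed bounded from above and below, which \<open>lq_change\<close> relies on.\<close>

lemma rho_ln:
  obtains L where "0 \<le> L" "\<And>s t. 0 < s \<Longrightarrow> 0 < t \<Longrightarrow>
    \<bar>ln (\<rho> s) - ln (\<rho> t) - (ln s - ln t)\<bar> \<le> L + \<bar>ln s - ln t\<bar> / 2"
proof -
  obtain L0 where L0: "\<And>s t. 0 < s \<Longrightarrow> 0 < t \<Longrightarrow> \<bar>ln (c0 s) - ln (c0 t)\<bar> \<le> L0 + 1/4 * \<bar>ln s - ln t\<bar>"
    using svf_ln[OF svf_c0, of "1/4"] by auto
  obtain L1 where L1: "\<And>s t. 0 < s \<Longrightarrow> 0 < t \<Longrightarrow> \<bar>ln (c1 s) - ln (c1 t)\<bar> \<le> L1 + 1/4 * \<bar>ln s - ln t\<bar>"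
    using svf_ln[OF svf_c1, of "1/4"] by auto
  have ln: "ln (\<rho> t) = ln t + (ln (c0 t) - ln (c1 t))" if "0 < t" for t
    using svf_pos[OF svf_c0 that] svf_pos[OF svf_c1 that] that
    unfolding rho_def c0_def[symmetric] c1_def[symmetric] by (simp add: ln_mult ln_div)
  have "\<bar>ln (\<rho> s) - ln (\<rho> t) - (ln s - ln t)\<bar> \<le> L0 + L1 + \<bar>ln s - ln t\<bar> / 2" if "0 < s" "0 < t" for s t
    using L0[OF that] L1[OF that] ln[OF that(1)] ln[OF that(2)] by linarith
  moreover from this[of 1 1] have "0 \<le> L0 + L1" by simp
  ultimately show ?thesis using that by blast
qed

lemma svf_rho: assumes "svf f" shows "svf (\<lambda>t. f (\<rho> t))"
proof -
  obtain L where "0 \<le> L" and L: "\<And>s t. 0 < s \<Longrightarrow> 0 < t \<Longrightarrow>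
    \<bar>ln (\<rho> s) - ln (\<rho> t) - (ln s - ln t)\<bar> \<le> L + \<bar>ln s - ln t\<bar> / 2" by (rule rho_ln) (rule that)
  have *: "\<bar>x\<bar> \<le> L + 2 * \<bar>d\<bar>" if "\<bar>x - d\<bar> \<le> L + \<bar>d\<bar> / 2" for x d :: real
    using that by linarith
  have "\<bar>ln (\<rho> s) - ln (\<rho> t)\<bar> \<le> L + 2 * \<bar>ln s - ln t\<bar>" if "0 < s" "0 < t" for s t
    by (rule *[OF L[OF that]])
  then show ?thesis using svf_compose[OF assms] rho_pos by blast
qed

definition W :: "real \<Rightarrow> int \<Rightarrow> real" where "W p n = rn n powr p * a (rn n)"

lemma W_pos: "0 < W p n"
  using rn_pos[of n] svf_pos[OF svf_a rn_pos[of n]] by (simp add: W_def)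

lemma W_0: "W 0 n = a (\<rho> (exp (of_int n)))"
  unfolding W_def using rn_pos[of n] by (simp add: rn_rho[symmetric])

text \<open>Between m and n the term p ln \<rho> falls by at least |p| |n - m| / 2 up to a constant,
  and the slow variation of a after \<rho> takes back at most |p| |n - m| / 4. The sign condition
  selects the direction in which the weight decreases.\<close>

lemma W_decay:
  assumes "p \<noteq> 0"
  shows "\<exists>D>0. \<forall>m n. p * of_int (n - m) \<le> 0 \<longrightarrow> W p n \<le> D * exp (- (\<bar>p\<bar> / 4) * \<bar>of_int (n - m)\<bar>) * W p m"
proof -
  obtain L where "0 \<le> L" and L: "\<And>s t. 0 < s \<Longrightarrow> 0 < t \<Longrightarrow>
    \<bar>ln (\<rho> s) - ln (\<rho> t) - (ln s - ln t)\<bar> \<le> L + \<bar>ln s - ln t\<bar> / 2" by (rule rho_ln) (rule that)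
  have "0 < \<bar>p\<bar> / 4" using assms by simp
  then obtain L' where L': "\<And>s t. 0 < s \<Longrightarrow> 0 < t \<Longrightarrow> \<bar>ln (a (\<rho> s)) - ln (a (\<rho> t))\<bar> \<le> L' + \<bar>p\<bar> / 4 * \<bar>ln s - ln t\<bar>"
    using svf_ln[OF svf_rho[OF svf_a]] by blast
  have "W p n \<le> exp (\<bar>p\<bar> * L + L') * exp (- (\<bar>p\<bar> / 4) * \<bar>of_int (n - m)\<bar>) * W p m" if "p * of_int (n - m) \<le> 0" for m n
  proof -
    define d where "d = (of_int (n - m) :: real)"
    define x where "x = ln (rn n) - ln (rn m)"
    define y where "y = ln (a (rn n)) - ln (a (rn m))"
    have x: "\<bar>x - d\<bar> \<le> L + \<bar>d\<bar> / 2"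
      using L[of "exp (of_int n)" "exp (of_int m)"] by (simp add: rn_rho x_def d_def)
    have y: "y \<le> L' + \<bar>p\<bar> / 4 * \<bar>d\<bar>"
      using L'[of "exp (of_int n)" "exp (of_int m)"] by (simp add: rn_rho y_def d_def)
    have "p * (x - d) \<le> \<bar>p\<bar> * (L + \<bar>d\<bar> / 2)"
      using mult_left_mono[OF x, of "\<bar>p\<bar>"] abs_ge_self[of "p * (x - d)"] by (simp add: abs_mult)
    moreover have "p * d = - (\<bar>p\<bar> * \<bar>d\<bar>)"
      using that abs_mult[of p d] by (simp add: d_def)
    ultimately have "p * x + y \<le> \<bar>p\<bar> * L + L' - \<bar>p\<bar> / 4 * \<bar>d\<bar>"
      using y by (simp add: algebra_simps)
    then have "exp (p * ln (rn n) + ln (a (rn n))) \<le> exp (\<bar>p\<bar> * L + L' + - (\<bar>p\<bar> / 4) * \<bar>d\<bar> + (p * ln (rn m) + ln (a (rn m))))"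
      by (simp add: x_def y_def algebra_simps)
    moreover have "exp (p * ln (rn k) + ln (a (rn k))) = W p k" for k
      using rn_pos[of k] svf_pos[OF svf_a rn_pos[of k]] by (simp add: W_def exp_add powr_def)
    ultimately show ?thesis by (simp only: exp_add d_def)
  qed
  then show ?thesis by (intro exI[of _ "exp (\<bar>p\<bar> * L + L')"]) auto
qed

lemma W_rn: "W p n * rn n = W (p + 1) n"
  using rn_pos[of n] by (simp add: W_def powr_add)

definition nX :: "real \<Rightarrow> 'a \<Rightarrow> ennreal" where
  "nX \<theta> f = Lq r {0<..} (K_wt X0 X1 \<theta> r a f)"
text \<open>\<open>P\<close>, \<open>M\<close> and \<open>Q\<close> are the contributions of the
  three terms of \<open>H\<close>; the factor \<rho> of the last term raises the exponent of
  \<open>W\<close> from - \<theta> to 1 - \<theta>.\<close>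

definition P :: "real \<Rightarrow> 'a \<Rightarrow> ennreal" where
  "P \<theta> f = lq r (\<lambda>n. ennreal (W (- \<theta>) n) * H0 f n)"
definition M :: "real \<Rightarrow> 'a \<Rightarrow> ennreal" where
  "M \<theta> f = lq r (\<lambda>n. ennreal (W (- \<theta>) n * x0 n * ka f n))"
definition Q :: "real \<Rightarrow> 'a \<Rightarrow> ennreal" where
  "Q \<theta> f = lq r (\<lambda>n. ennreal (W (1 - \<theta>) n) * H1 f n)"

abbreviation nK :: "real \<Rightarrow> 'a \<Rightarrow> ennreal" where
  "nK \<equiv> \<lambda>\<theta> f. lq r (\<lambda>n. ennreal (W (- \<theta>) n * KX (rn n) f))"
abbreviation nH :: "real \<Rightarrow> 'a \<Rightarrow> ennreal" where
  "nH \<equiv> \<lambda>\<theta> f. lq r (\<lambda>n. ennreal (W (- \<theta>) n) * H f n)"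

text \<open>Sampling at the points exp k is replaced by sampling at \<rho>(exp n) through
  \<open>lq_change\<close>, where \<open>m n\<close> is the cell of \<rho>(exp n). The integrand
  changes by bounded factors within a cell and between cells at bounded distance.\<close>

lemma nX_discrete:
  "lesssim (SX) (nX \<theta>) (nK \<theta>)"
  "lesssim (SX) (nK \<theta>) (nX \<theta>)"
proof -
  obtain L where L: "0 \<le> L" "\<And>s t. 0 < s \<Longrightarrow> 0 < t \<Longrightarrow>
    \<bar>ln (\<rho> s) - ln (\<rho> t) - (ln s - ln t)\<bar> \<le> L + \<bar>ln s - ln t\<bar> / 2" by (rule rho_ln) (rule that)
  define m where "m n = idx (rn n)" for n
  have m: "\<bar>of_int (m n - m k) - of_int (n - k)\<bar> \<le> (L + 2) + \<bar>of_int (n - k)\<bar> / (2::real)" for n k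
  proof -
    have *: "\<bar>x' - y' - d\<bar> \<le> L + 2 + \<bar>d\<bar> / 2"
      if "\<bar>x - y - d\<bar> \<le> L + \<bar>d\<bar> / 2" "\<bar>x - x'\<bar> \<le> 1" "\<bar>y - y'\<bar> \<le> 1" for x y x' y' d :: real
      using that by linarith
    show ?thesis
      unfolding m_def of_int_diff
      using L(2)[of "exp (of_int n)" "exp (of_int k)"]
      by (intro *[OF _ ln_idx_dist ln_idx_dist]) (simp add: rn_rho)
  qed
  obtain C B where C: "1 \<le> C" "0 \<le> B" "\<And>H. lq r (\<lambda>n. H (m n)) \<le> ennreal C * lq r H"
    "\<And>H D. 0 \<le> D \<Longrightarrow> (\<And>k k'. \<bar>real_of_int (k - k')\<bar> \<le> B \<Longrightarrow> H k \<le> ennreal D * H k') \<Longrightarrow>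
       lq r H \<le> ennreal (D * C) * lq r (\<lambda>n. H (m n))"
    using lq_change[OF r m] by blast
  define \<phi> where "\<phi> f u = a u * (u powr (- \<theta>) * KX u f)" for f u
  obtain c where c: "reg c a" using svf_reg[OF svf_a] .
  define d where "d = c * (exp \<bar>\<theta>\<bar> * exp 1)"
  have reg: "reg d (\<phi> f)" if "f \<in> SX" for f
    using reg_mult[OF c X.reg_powr_K[OF that, of \<theta>]] by (simp add: d_def \<phi>_def[abs_def])
  have d: "0 < d" using c by (simp add: d_def reg_def)
  have \<phi>_rn: "\<phi> f (rn n) = W (- \<theta>) n * KX (rn n) f" for f n
    by (simp add: \<phi>_def W_def)
  have nX: "nX \<theta> f = Lq r {0<..} (wt r (\<phi> f))" for f
    by (simp add: nX_def K_wt_eq \<phi>_def[abs_def])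
  obtain E where E: "E > 0" "\<And>s t. 0 < s \<Longrightarrow> 0 < t \<Longrightarrow> a s \<le> E * exp (1 * \<bar>ln s - ln t\<bar>) * a t"
    using svfE[OF svf_a, of 1] by auto
  \<comment> \<open>The factors bound the change of a, of the power of u and of K over an index
    distance of at most \<open>B\<close>.\<close>
  define D where "D = E * exp B * (exp (\<bar>\<theta>\<bar> * B) * exp B)"
  have D: "0 \<le> D" using E by (simp add: D_def)
  have \<phi>_le: "\<phi> f (exp (of_int k)) \<le> D * \<phi> f (exp (of_int k'))"
    if f: "f \<in> SX" and kk: "\<bar>real_of_int (k - k')\<bar> \<le> B" for f k k'
  proof -
    have 1: "a (exp (of_int k)) \<le> E * exp B * a (exp (of_int k'))"
    proof -
      have "a (exp (of_int k)) \<le> E * exp \<bar>of_int (k - k')\<bar> * a (exp (of_int k'))"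
        using E(2)[of "exp (of_int k)" "exp (of_int k')"] by simp
      also have "\<dots> \<le> E * exp B * a (exp (of_int k'))"
        using kk E(1) svf_pos[OF svf_a, of "exp (of_int k')"] by (intro mult_right_mono mult_left_mono) auto
      finally show ?thesis .
    qed
    have 2: "exp (of_int k) powr (- \<theta>) \<le> exp (\<bar>\<theta>\<bar> * B) * exp (of_int k') powr (- \<theta>)"
    proof -
      have "- \<theta> * (of_int k - of_int k') \<le> \<bar>\<theta>\<bar> * B"
        using mult_left_mono[OF kk, of "\<bar>\<theta>\<bar>"] abs_ge_self[of "- \<theta> * (of_int k - of_int k')"] by (simp add: abs_mult)
      then show ?thesis by (simp add: powr_def exp_add[symmetric] algebra_simps)
    qed
    have 3: "KX (exp (of_int k)) f \<le> exp B * KX (exp (of_int k')) f"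
    proof (cases "k \<le> k'")
      case True
      then have "KX (exp (of_int k)) f \<le> 1 * KX (exp (of_int k')) f"
        using X.K_mono[OF f] by simp
      also have "\<dots> \<le> exp B * KX (exp (of_int k')) f"
        using C(2) X.K_nonneg[OF f] by (intro mult_right_mono) auto
      finally show ?thesis .
    next
      case False
      then have "KX (exp (of_int k)) f \<le> exp (of_int k) / exp (of_int k') * KX (exp (of_int k')) f"
        by (intro X.K_quot[OF f]) auto
      also have "\<dots> \<le> exp B * KX (exp (of_int k')) f"
        using kk X.K_nonneg[OF f] by (intro mult_right_mono) (auto simp: exp_diff[symmetric])
      finally show ?thesis .
    qed
    have "\<phi> f (exp (of_int k)) \<le> (E * exp B * a (exp (of_int k'))) *
       ((exp (\<bar>\<theta>\<bar> * B) * exp (of_int k') powr (- \<theta>)) * (exp B * KX (exp (of_int k')) f))"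
      unfolding \<phi>_def using 1 2 3 E(1) svf_pos[OF svf_a, of "exp (of_int k')"] X.K_nonneg[OF f]
      by (intro mult_mono) (auto intro!: mult_nonneg_nonneg)
    then show ?thesis by (simp add: \<phi>_def D_def mult_ac)
  qed
  show "lesssim (SX) (nX \<theta>) (nK \<theta>)"
  proof (rule lesssimI)
    fix f assume f: "f \<in> SX"
    have "nX \<theta> f \<le> ennreal (2 powr recip r * d) * lq r (\<lambda>k. if True then ennreal (\<phi> f (pt 1 k)) else 0)"
      unfolding nX by (intro R.Lq_wt_le r reg f) auto
    also have "lq r (\<lambda>k. if True then ennreal (\<phi> f (pt 1 k)) else 0) \<le> ennreal (D * C) * lq r (\<lambda>n. ennreal (\<phi> f (exp (of_int (m n)))))"
      using \<phi>_le[OF f] D unfolding pt_simps if_True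
      by (intro C(4)) (auto simp: ennreal_mult'[symmetric] intro!: ennreal_leI)
    also have "lq r (\<lambda>n. ennreal (\<phi> f (exp (of_int (m n))))) \<le> lq r (\<lambda>n. ennreal d * ennreal (W (- \<theta>) n * KX (rn n) f))"
      using reg[OF f] rn_pos d unfolding \<phi>_rn[symmetric] m_def reg_def
      by (intro lq_mono) (simp add: ennreal_mult'[symmetric] ennreal_leI)
    also have "\<dots> = ennreal d * nK \<theta> f"
      using d by (intro lq_cmult r) simp
    finally have "nX \<theta> f \<le> ennreal (2 powr recip r * d) * (ennreal (D * C) * (ennreal d * nK \<theta> f))"
      by (simp add: mult_left_mono)
    also have "\<dots> = ennreal (2 powr recip r * d * (D * C) * d) * nK \<theta> f"
      using d D C(1) by (simp add: ennreal_mult' mult.assoc)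
    finally show "nX \<theta> f \<le> \<dots>" .
  qed (use d C E in \<open>auto simp: D_def\<close>)
  show "lesssim (SX) (nK \<theta>) (nX \<theta>)"
  proof (rule lesssimI)
    fix f assume f: "f \<in> SX"
    have "nK \<theta> f \<le> lq r (\<lambda>n. ennreal d * ennreal (\<phi> f (exp (of_int (m n)))))"
      using reg[OF f] rn_pos d unfolding \<phi>_rn[symmetric] m_def reg_def
      by (intro lq_mono) (simp add: ennreal_mult'[symmetric] ennreal_leI)
    also have "\<dots> = ennreal d * lq r (\<lambda>n. ennreal (\<phi> f (exp (of_int (m n)))))"
      using d by (intro lq_cmult r) simp
    also have "lq r (\<lambda>n. ennreal (\<phi> f (exp (of_int (m n))))) \<le> ennreal C * lq r (\<lambda>k. ennreal (\<phi> f (exp (of_int k))))"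
      by (rule C(3))
    also have "lq r (\<lambda>k. ennreal (\<phi> f (exp (of_int k)))) \<le> ennreal (2 powr recip r * d) * nX \<theta> f"
      using R.Lq_wt_ge[of r "{0<..}" d "\<phi> f" "\<lambda>_. True"] r reg[OF f] by (simp add: nX pt_simps)
    finally have "nK \<theta> f \<le> ennreal d * (ennreal C * (ennreal (2 powr recip r * d) * nX \<theta> f))"
      by (simp add: mult_left_mono)
    also have "\<dots> = ennreal (d * C * (2 powr recip r * d)) * nX \<theta> f"
      using d C(1) by (simp add: ennreal_mult' mult.assoc)
    finally show "nK \<theta> f \<le> \<dots>" .
  qed (use d C in auto)
qed

lemma PMQ_le_nX:
  "lesssim (SX) (P \<theta>) (nX \<theta>)" "lesssim (SX) (M \<theta>) (nX \<theta>)" "lesssim (SX) (Q \<theta>) (nX \<theta>)"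
proof -
  obtain C where C: "C > 0" "\<And>f n. f \<in> SX \<Longrightarrow> H f n \<le> ennreal C * ennreal (KX (rn n) f)"
    using holmstedt_lower by blast
  have H: "lesssim (SX) (nH \<theta>) (nX \<theta>)"
  proof (rule lesssim_trans[OF lesssimI[OF C(1)] nX_discrete(2)])
    fix f assume f: "f \<in> SX"
    have "nH \<theta> f \<le> lq r (\<lambda>n. ennreal (W (- \<theta>) n) * (ennreal C * ennreal (KX (rn n) f)))"
      by (intro lq_mono mult_left_mono C f) auto
    also have "\<dots> = lq r (\<lambda>n. ennreal C * ennreal (W (- \<theta>) n * KX (rn n) f))"
      using W_pos[of "- \<theta>"] by (simp add: ennreal_mult' less_imp_le mult_ac)
    also have "\<dots> = ennreal C * nK \<theta> f"
      using C by (intro lq_cmult r) auto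
    finally show "nH \<theta> f \<le> \<dots>" .
  qed
  have "lesssim (SX) (P \<theta>) (nH \<theta>)"
    unfolding P_def H_def by (intro lesssim_mono lq_mono mult_left_mono) (auto simp: add.assoc)
  then show "lesssim (SX) (P \<theta>) (nX \<theta>)" using H by (rule lesssim_trans)
  have "lesssim (SX) (M \<theta>) (nH \<theta>)"
  proof (rule lesssim_mono)
    fix f
    have "M \<theta> f = lq r (\<lambda>n. ennreal (W (- \<theta>) n) * ennreal (x0 n * ka f n))"
      using W_pos[of "- \<theta>"] by (simp add: M_def ennreal_mult' less_imp_le mult.assoc)
    also have "\<dots> \<le> nH \<theta> f"
      unfolding H_def by (intro lq_mono mult_left_mono) (auto intro: add_increasing add_increasing2)
    finally show "M \<theta> f \<le> nH \<theta> f" .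
  qed
  then show "lesssim (SX) (M \<theta>) (nX \<theta>)" using H by (rule lesssim_trans)
  have "lesssim (SX) (Q \<theta>) (nH \<theta>)"
  proof (rule lesssim_mono)
    fix f
    have "Q \<theta> f = lq r (\<lambda>n. ennreal (W (- \<theta>) n) * (ennreal (rn n) * H1 f n))"
      using W_pos[of "- \<theta>"] W_rn[of "- \<theta>"]
      by (simp add: Q_def mult.assoc[symmetric] ennreal_mult'[symmetric] less_imp_le)
    also have "\<dots> \<le> nH \<theta> f"
      unfolding H_def by (intro lq_mono mult_left_mono) (auto intro: add_increasing)
    finally show "Q \<theta> f \<le> nH \<theta> f" .
  qed
  then show "lesssim (SX) (Q \<theta>) (nX \<theta>)" using H by (rule lesssim_trans)
qed

text \<open>If the right-hand side is finite, so is every \<open>H f n\<close>, as all weights are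
  positive. Hence the upper half of the Holmstedt formula applies and also supplies membership in
  the sum.\<close>

lemma nX_le_PMQ:
  "\<exists>C>0. \<forall>f\<in>S. P \<theta> f + M \<theta> f + Q \<theta> f < \<infinity> \<longrightarrow>
     f \<in> SX \<and> nX \<theta> f \<le> ennreal C * (P \<theta> f + M \<theta> f + Q \<theta> f)"
proof -
  obtain C where C: "C > 0" "\<And>f n. f \<in> S \<Longrightarrow> H f n < \<infinity> \<Longrightarrow> f \<in> SX"
    "\<And>f n. f \<in> S \<Longrightarrow> H f n < \<infinity> \<Longrightarrow> ennreal (KX (rn n) f) \<le> ennreal C * H f n"
    using holmstedt_upper by blast
  obtain B where B: "1 \<le> B" "\<And>g h. lq r (\<lambda>k. g k + h k) \<le> ennreal B * (lq r g + lq r h)"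
    using lq_add[OF r] by blast
  obtain D where D: "D > 0" "\<And>f. f \<in> SX \<Longrightarrow>
      nX \<theta> f \<le> ennreal D * nK \<theta> f"
    using nX_discrete(1) unfolding lesssim_def by blast
  define T where "T = nH \<theta>"
  have T: "T f \<le> ennreal (B * B) * (P \<theta> f + M \<theta> f + Q \<theta> f)" for f
  proof -
    have "T f = lq r (\<lambda>n. (ennreal (W (- \<theta>) n) * H0 f n + ennreal (W (- \<theta>) n * x0 n * ka f n)) + ennreal (W (1 - \<theta>) n) * H1 f n)"
      unfolding T_def H_def using W_pos[of "- \<theta>"] W_rn[of "- \<theta>", symmetric]
      by (simp add: distrib_left ennreal_mult' less_imp_le mult.assoc)
    also have "\<dots> \<le> ennreal B * (lq r (\<lambda>n. ennreal (W (- \<theta>) n) * H0 f n + ennreal (W (- \<theta>) n * x0 n * ka f n)) + Q \<theta> f)"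
      unfolding Q_def by (rule B)
    also have "\<dots> \<le> ennreal B * (ennreal B * (P \<theta> f + M \<theta> f) + ennreal B * Q \<theta> f)"
    proof (intro mult_left_mono add_mono)
      show "lq r (\<lambda>n. ennreal (W (- \<theta>) n) * H0 f n + ennreal (W (- \<theta>) n * x0 n * ka f n)) \<le> ennreal B * (P \<theta> f + M \<theta> f)"
        unfolding P_def M_def by (rule B)
      show "Q \<theta> f \<le> ennreal B * Q \<theta> f"
        using mult_right_mono[of 1 "ennreal B" "Q \<theta> f"] B(1) by simp
    qed auto
    also have "\<dots> = ennreal (B * B) * (P \<theta> f + M \<theta> f + Q \<theta> f)"
      using B(1) by (simp add: ennreal_mult' distrib_left mult.assoc)
    finally show ?thesis .
  qed
  show ?thesis
  proof (intro exI[of _ "D * C * (B * B)"] conjI ballI impI)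
    fix f assume f: "f \<in> S" and fin: "P \<theta> f + M \<theta> f + Q \<theta> f < \<infinity>"
    have Tfin: "T f < \<infinity>" by (rule le_mult_finite[OF T fin])
    have Hfin: "H f n < \<infinity>" for n
    proof -
      have "ennreal (W (- \<theta>) n) * H f n \<le> T f"
        unfolding T_def by (rule lq_ge[OF r, of "\<lambda>n. ennreal (W (- \<theta>) n) * H f n"])
      then have "ennreal (W (- \<theta>) n) * H f n < \<infinity>" using Tfin by (rule le_less_trans)
      then show ?thesis using W_pos[of "- \<theta>" n] by (auto simp: ennreal_mult_less_top)
    qed
    show fX: "f \<in> SX" by (rule C(2)[OF f Hfin])
    have "nK \<theta> f \<le> lq r (\<lambda>n. ennreal C * (ennreal (W (- \<theta>) n) * H f n))"
    proof (rule lq_mono)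
      fix n
      show "ennreal (W (- \<theta>) n * KX (rn n) f) \<le> ennreal C * (ennreal (W (- \<theta>) n) * H f n)"
        using mult_left_mono[OF C(3)[OF f Hfin, of n] zero_le, of "ennreal (W (- \<theta>) n)"] W_pos[of "- \<theta>" n]
        by (simp add: ennreal_mult' mult_ac)
    qed
    also have "\<dots> = ennreal C * T f" unfolding T_def using C(1) by (intro lq_cmult r) simp
    finally have "nX \<theta> f \<le> ennreal (D * C) * T f"
      using D(1) by (intro ennreal_le_trans_mult[OF D(2)[OF fX]]) auto
    then show "nX \<theta> f \<le> ennreal (D * C * (B * B)) * (P \<theta> f + M \<theta> f + Q \<theta> f)"
      using D(1) C(1) by (intro ennreal_le_trans_mult[OF _ T]) auto
  qed (use B C D in auto)
qed

section \<open>Absorbing the outer terms by Hardy inequalities\<close>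

lemma P_le_M: assumes "0 < \<theta>" shows "lesssim S (P \<theta>) (M \<theta>)"
proof -
  obtain D where D: "D > 0" "\<And>m n. - \<theta> * of_int (n - m) \<le> 0 \<Longrightarrow>
      W (- \<theta>) n \<le> D * exp (- (\<bar>- \<theta>\<bar> / 4) * \<bar>of_int (n - m)\<bar>) * W (- \<theta>) m"
    using W_decay[of "- \<theta>"] assms by auto
  have "\<exists>C>0. \<forall>h. (\<forall>j. 0 \<le> h j) \<longrightarrow>
     lq r (\<lambda>n. ennreal (W (- \<theta>) n) * N0 (low n (\<lambda>j. ennreal (h j)))) \<le>
       ennreal C * lq r (\<lambda>n. ennreal (W (- \<theta>) n * x0 n * h n))"
  proof (rule T0.hardy[OF _ r W_pos D(1)])
    show "W (- \<theta>) n \<le> D * exp (- (\<theta> / 4) * of_int (n - j)) * W (- \<theta>) j" if "j \<le> n" for j n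
      using D(2)[of n j] that assms by simp
  qed (use assms in simp)
  then show ?thesis unfolding lesssim_def P_def M_def H0_def using ka_nonneg by blast
qed

text \<open>After reversal of the index the weight \<rho>^(1 - \<theta>) a(\<rho>) decreases
  geometrically, and the sum over j >= n takes the form required by \<open>hardy\<close>. The
  identity \<open>rn_kd\<close> turns the resulting bound for \<open>kd\<close> into
  \<open>M\<close>.\<close>

lemma Q_le_M: assumes "\<theta> < 1" shows "lesssim S (Q \<theta>) (M \<theta>)"
proof -
  obtain D where D: "D > 0" "\<And>m n. (1 - \<theta>) * of_int (n - m) \<le> 0 \<Longrightarrow>
      W (1 - \<theta>) n \<le> D * exp (- (\<bar>1 - \<theta>\<bar> / 4) * \<bar>of_int (n - m)\<bar>) * W (1 - \<theta>) m"
    using W_decay[of "1 - \<theta>"] assms by auto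
  have "\<exists>C>0. \<forall>h. (\<forall>j. 0 \<le> h j) \<longrightarrow>
     lq r (\<lambda>n. ennreal (W (1 - \<theta>) (- n)) * N1 (low n (\<lambda>j. ennreal (h j)))) \<le>
       ennreal C * lq r (\<lambda>n. ennreal (W (1 - \<theta>) (- n) * x1 n * h n))"
  proof (rule T1.hardy[OF _ r W_pos D(1)])
    show "W (1 - \<theta>) (- n) \<le> D * exp (- ((1 - \<theta>) / 4) * of_int (n - j)) * W (1 - \<theta>) (- j)" if "j \<le> n" for j n
      using D(2)[of "- n" "- j"] that assms by (simp add: mult_nonneg_nonpos)
  qed (use assms in simp)
  then obtain C where C: "C > 0" "\<And>h. (\<forall>j. 0 \<le> h j) \<Longrightarrow>
     lq r (\<lambda>n. ennreal (W (1 - \<theta>) (- n)) * N1 (low n (\<lambda>j. ennreal (h j)))) \<le>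
       ennreal C * lq r (\<lambda>n. ennreal (W (1 - \<theta>) (- n) * x1 n * h n))" by blast
  show ?thesis
  proof (rule lesssimI[OF C(1)])
    fix f assume f: "f \<in> S"
    have "Q \<theta> f = lq r (\<lambda>n. ennreal (W (1 - \<theta>) (- n)) * H1 f (- n))"
      unfolding Q_def by (rule lq_uminus[symmetric])
    also have "\<dots> \<le> ennreal C * lq r (\<lambda>n. ennreal (W (1 - \<theta>) (- n) * x1 n * kd f n))"
      using C(2)[of "kd f"] kd_nonneg[OF f] by (simp add: H1_def)
    also have "lq r (\<lambda>n. ennreal (W (1 - \<theta>) (- n) * x1 n * kd f n)) = lq r (\<lambda>n. ennreal (W (1 - \<theta>) n * x1 (- n) * kd f (- n)))"
      using lq_uminus[of r "\<lambda>n. ennreal (W (1 - \<theta>) n * x1 (- n) * kd f (- n))"] by simp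
    also have "\<dots> = M \<theta> f"
    proof -
      have "W (1 - \<theta>) n * x1 (- n) * kd f (- n) = W (- \<theta>) n * x0 n * ka f n" for n
        using W_rn[of "- \<theta>" n, symmetric] rn_kd[of n f] by (simp add: mult.assoc)
      then show ?thesis by (simp add: M_def)
    qed
    finally show "Q \<theta> f \<le> ennreal C * M \<theta> f" .
  qed
qed

section \<open>The three terms as norms of the spaces in the statement\<close>

definition nA :: "real \<Rightarrow> 'a \<Rightarrow> ennreal" where
  "nA \<theta> f = Lq r {0<..} (K_wt A0 A1 \<theta> r (a_sharp Chi0 Chi1 a \<theta>) f)"

text \<open>At the sample points the weights agree exactly: \<rho>^(- \<theta>) contributes u^(-
  \<theta>), \<open>\<chi>\<^sub>0\<close> to the power - \<theta> and \<open>\<chi>\<^sub>1\<close>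
  to the power \<theta>, which combine with the factor \<open>x0\<close> of the middle term to the
  weight \<open>a_sharp\<close>.\<close>

lemma nA_equiv: "lesssim S (nA \<theta>) (M \<theta>)" "lesssim S (M \<theta>) (nA \<theta>)"
proof -
  let ?a = "a_sharp Chi0 Chi1 a \<theta>"
  have "svf (\<lambda>t. c0 t powr (1 - \<theta>) * c1 t powr \<theta> * a (\<rho> t))"
    by (intro svf_mult svf_powr svf_c0 svf_c1 svf_rho svf_a)
  then have "svf ?a" unfolding a_sharp_def[abs_def] c0_def c1_def .
  then obtain c where c: "reg c ?a" by (rule svf_reg)
  define d where "d = c * (exp \<bar>\<theta>\<bar> * exp 1)"
  define \<phi> where "\<phi> f u = ?a u * (u powr (- \<theta>) * K u f)" for f u
  have reg: "reg d (\<phi> f)" if "f \<in> S" for f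
    using reg_mult[OF c A.reg_powr_K[OF that, of \<theta>]] by (simp add: d_def \<phi>_def[abs_def])
  have d: "0 < 2 powr recip r * d" using c by (simp add: d_def reg_def)
  have \<phi>: "\<phi> f (pt 1 n) = W (- \<theta>) n * x0 n * ka f n" for f n
  proof -
    have p: "0 < x0 n" "0 < x1 (- n)" using T0.pos T1.pos by auto
    have e: "c0 (exp (of_int n)) = x0 n" "c1 (exp (of_int n)) = x1 (- n)" by (simp_all add: x0_def x1_def pt_simps)
    have "?a (pt 1 n) = x0 n powr (1 - \<theta>) * x1 (- n) powr \<theta> * a (rn n)"
      unfolding a_sharp_def c0_def[symmetric] c1_def[symmetric] pt_simps rn_rho e ..
    moreover have "rn n powr (- \<theta>) = exp (of_int n) powr (- \<theta>) * x0 n powr (- \<theta>) * x1 (- n) powr \<theta>"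
      using p by (simp add: rn_def powr_mult powr_divide powr_minus_divide)
    moreover have "x0 n powr (1 - \<theta>) = x0 n * x0 n powr (- \<theta>)"
      using p by (simp add: powr_diff powr_minus_divide)
    ultimately show ?thesis by (simp add: \<phi>_def W_def ka_def pt_simps)
  qed
  have nA: "nA \<theta> f = Lq r {0<..} (wt r (\<phi> f))" for f
    by (simp add: nA_def K_wt_eq \<phi>_def[abs_def])
  show "lesssim S (nA \<theta>) (M \<theta>)"
  proof (rule lesssimI[OF d])
    show "nA \<theta> f \<le> ennreal (2 powr recip r * d) * M \<theta> f" if "f \<in> S" for f
      using R.Lq_wt_le[of r "{0<..}" d "\<phi> f" "\<lambda>_. True"] r reg[OF that] by (simp add: nA \<phi> M_def)
  qed
  show "lesssim S (M \<theta>) (nA \<theta>)"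
  proof (rule lesssimI[OF d])
    show "M \<theta> f \<le> ennreal (2 powr recip r * d) * nA \<theta> f" if "f \<in> S" for f
      using R.Lq_wt_ge[of r "{0<..}" d "\<phi> f" "\<lambda>_. True"] r reg[OF that] by (simp add: nA \<phi> M_def)
  qed
qed

definition nRL :: "'a \<Rightarrow> ennreal" where
  "nRL f = Lq r {0<..} (\<lambda>t. wt r (a \<circ> \<rho>) t * Lq r0 {0<..<t} (\<lambda>u. wt r0 b0 u * Lq q0 {u<..<t} (K_wt A0 A1 0 q0 a0 f)))"

definition nLR :: "'a \<Rightarrow> ennreal" where
  "nLR f = Lq r {0<..} (\<lambda>t. wt r (a \<circ> \<rho>) t * Lq r1 {t<..} (\<lambda>u. wt r1 b1 u * Lq q1 {t<..<u} (K_wt A0 A1 1 q1 a1 f)))"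

text \<open>At \<theta> = 0 the weight of \<open>P\<close> is a after \<rho> with no power of
  \<rho>, so \<open>P 0\<close> is the sampled form of the threefold norm.\<close>

lemma nRL_equiv: "lesssim S nRL (P 0)" "lesssim S (P 0) nRL"
proof -
  let ?d = "exp \<bar>0\<bar> * exp (1::real)"
  have sets: "{0<..<t} = before 1 t" "u \<in> {0<..<t} \<Longrightarrow> {u<..<t} = after 1 u \<inter> before 1 t" for t u
    by (auto simp: before_def after_def)
  have eq: "nRL f = Lq r {0<..} (\<lambda>t. wt r (a \<circ> \<rho>) t * Lq r0 (before 1 t) (\<lambda>s. wt r0 b0 s *
      Lq q0 (after 1 s \<inter> before 1 t) (wt q0 (\<lambda>t. a0 t * (t powr (- 0) * K t f)))))" for f
    unfolding nRL_def K_wt_eq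
    by (intro Lq_cong arg_cong2[of _ _ _ _ "(*)"] refl) (subst sets(1)[symmetric], intro Lq_cong, simp add: sets(2))
  have w: "svf (a \<circ> \<rho>)" using svf_rho[OF svf_a] by (simp add: comp_def)
  have P: "P 0 f = lq r (\<lambda>n. ennreal ((a \<circ> \<rho>) (pt 1 n)) * N0 (low n (\<lambda>j. ennreal ((\<lambda>t. t powr (- 0) * K t f) (pt 1 j)))))" for f
    unfolding P_def H0_def minus_zero W_0 by (simp add: pt_simps ka_def)
  have reg: "reg ?d (\<lambda>t. t powr (- 0) * K t f)" if "f \<in> S" for f
    using A.reg_powr_K[OF that, of 0] .
  show "lesssim S nRL (P 0)"
    using R.outer_le[OF r w, of ?d] reg unfolding lesssim_def eq P by meson
  show "lesssim S (P 0) nRL"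
    using R.outer_ge[OF r w, of ?d] reg unfolding lesssim_def eq P by meson
qed

text \<open>At \<theta> = 1 the factor \<rho> of the last term cancels the power \<rho>^(- 1), which
  again leaves a after \<rho> as the outermost weight.\<close>

lemma nLR_equiv: "lesssim S nLR (Q 1)" "lesssim S (Q 1) nLR"
proof -
  let ?d = "exp \<bar>1\<bar> * exp (1::real)"
  have sets: "0 < t \<Longrightarrow> {t<..} = before (- 1) t" "0 < t \<Longrightarrow> u \<in> {t<..} \<Longrightarrow> {t<..<u} = after (- 1) u \<inter> before (- 1) t" for t u
    by (auto simp: before_def after_def)
  have eq: "nLR f = Lq r {0<..} (\<lambda>t. wt r (a \<circ> \<rho>) t * Lq r1 (before (- 1) t) (\<lambda>s. wt r1 b1 s *
      Lq q1 (after (- 1) s \<inter> before (- 1) t) (wt q1 (\<lambda>t. a1 t * (t powr (- 1) * K t f)))))" for f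
    unfolding nLR_def K_wt_eq
    by (intro Lq_cong arg_cong2[of _ _ _ _ "(*)"] refl) (subst sets(1)[symmetric], simp, intro Lq_cong, simp add: sets(2))
  have w: "svf (a \<circ> \<rho>)" using svf_rho[OF svf_a] by (simp add: comp_def)
  have Q: "Q 1 f = lq r (\<lambda>n. ennreal ((a \<circ> \<rho>) (pt (- 1) n)) * N1 (low n (\<lambda>j. ennreal ((\<lambda>t. t powr (- 1) * K t f) (pt (- 1) j)))))" for f
  proof -
    have "Q 1 f = lq r (\<lambda>n. ennreal (W (1 - 1) (- n)) * H1 f (- n))"
      unfolding Q_def by (rule lq_uminus[symmetric])
    then show ?thesis
      unfolding H1_def diff_self W_0 by (simp add: pt_simps kd_def powr_def)
  qed
  have reg: "reg ?d (\<lambda>t. t powr (- 1) * K t f)" if "f \<in> S" for f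
    using A.reg_powr_K[OF that, of 1] .
  show "lesssim S nLR (Q 1)"
    using L.outer_le[OF r w, of ?d] reg unfolding lesssim_def eq Q by meson
  show "lesssim S (Q 1) nLR"
    using L.outer_ge[OF r w, of ?d] reg unfolding lesssim_def eq Q by meson
qed

lemma nX_le:
  assumes "lesssim S (\<lambda>f. P \<theta> f + M \<theta> f + Q \<theta> f) F"
  shows "\<exists>C>0. \<forall>f\<in>S. F f < \<infinity> \<longrightarrow> f \<in> SX \<and> nX \<theta> f \<le> ennreal C * F f"
proof -
  obtain C where C: "C > 0" "\<And>f. f \<in> S \<Longrightarrow> P \<theta> f + M \<theta> f + Q \<theta> f < \<infinity> \<Longrightarrow>
     f \<in> SX \<and> nX \<theta> f \<le> ennreal C * (P \<theta> f + M \<theta> f + Q \<theta> f)"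
    using nX_le_PMQ by blast
  obtain D where D: "D > 0" "\<And>f. f \<in> S \<Longrightarrow> P \<theta> f + M \<theta> f + Q \<theta> f \<le> ennreal D * F f"
    using assms unfolding lesssim_def by blast
  show ?thesis
  proof (intro exI[of _ "C * D"] conjI ballI impI)
    fix f assume f: "f \<in> S" and fin: "F f < \<infinity>"
    have "P \<theta> f + M \<theta> f + Q \<theta> f < \<infinity>" by (rule le_mult_finite[OF D(2)[OF f] fin])
    note * = C(2)[OF f this]
    show "f \<in> SX" using * by blast
    show "nX \<theta> f \<le> ennreal (C * D) * F f"
      using C(1) by (intro ennreal_le_trans_mult[OF conjunct2[OF *] D(2)[OF f]]) auto
  qed (use C D in auto)
qed

section \<open>The equalities of spaces\<close>

lemma interp_eqs:
  "interp_space X0 X1 \<theta> r a = finite_part (SX) (nX \<theta>)"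
  "interp_space A0 A1 \<theta> r (a_sharp Chi0 Chi1 a \<theta>) = finite_part S (nA \<theta>)"
  "RL_space A0 A1 0 r (a \<circ> \<rho>) r0 b0 q0 a0 = finite_part S nRL"
  "LR_space A0 A1 1 r (a \<circ> \<rho>) r1 b1 q1 a1 = finite_part S nLR"
  by (simp_all add: interp_space_def RL_space_def LR_space_def nX_def[abs_def] nA_def[abs_def] nRL_def[abs_def] nLR_def[abs_def])

lemma nA_le_nX: "lesssim (SX) (nA \<theta>) (nX \<theta>)"
  using lesssim_subset[OF nA_equiv(1) sum_X_subset] PMQ_le_nX(2) by (rule lesssim_trans)

lemma same_space_interior:
  assumes "0 < \<theta>" "\<theta> < 1"
  shows "same_space (interp_space X0 X1 \<theta> r a) (interp_space A0 A1 \<theta> r (a_sharp Chi0 Chi1 a \<theta>))"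
  unfolding same_space_def interp_eqs
proof
  show "embedded (finite_part (SX) (nX \<theta>)) (finite_part S (nA \<theta>))"
    by (rule embedded_finite_part[OF sum_X_subset nA_le_nX])
  have "lesssim S (\<lambda>f. P \<theta> f + M \<theta> f + Q \<theta> f) (nA \<theta>)"
    using assms by (intro lesssim_add lesssim_trans[OF P_le_M nA_equiv(2)] lesssim_trans[OF Q_le_M nA_equiv(2)] nA_equiv(2))
  from nX_le[OF this] obtain C where C: "C > 0" "\<And>f. f \<in> S \<Longrightarrow> nA \<theta> f < \<infinity> \<Longrightarrow> f \<in> SX \<and> nX \<theta> f \<le> ennreal C * nA \<theta> f"
    by blast
  \<comment> \<open>The elements of finite norm, which the previous estimate places in the sum of
    the limiting spaces; \<open>embedded_finite_part\<close> asks for this inclusion of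
    sets.\<close>
  define T where "T = {f \<in> S. nA \<theta> f < \<infinity>}"
  have "finite_part S (nA \<theta>) = finite_part T (nA \<theta>)" by (auto simp: finite_part_def T_def)
  moreover have "embedded (finite_part T (nA \<theta>)) (finite_part (SX) (nX \<theta>))"
    using C by (intro embedded_finite_part lesssimI[of C]) (auto simp: T_def)
  ultimately show "embedded (finite_part S (nA \<theta>)) (finite_part (SX) (nX \<theta>))" by simp
qed

text \<open>The one term that no Hardy inequality absorbs enters as an abstract \<open>F\<close>, so
  that both endpoints share the argument.\<close>

lemma same_space_endpoint:
  assumes "lesssim (SX) F (nX \<theta>)" "lesssim S (\<lambda>f. P \<theta> f + M \<theta> f + Q \<theta> f) (\<lambda>f. nA \<theta> f + F f)"
  shows "same_space (interp_space X0 X1 \<theta> r a)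
    (inter_space (interp_space A0 A1 \<theta> r (a_sharp Chi0 Chi1 a \<theta>)) (finite_part S F))"
  unfolding same_space_def interp_eqs
proof
  show "embedded (finite_part (SX) (nX \<theta>)) (inter_space (finite_part S (nA \<theta>)) (finite_part S F))"
    by (intro embedded_inter embedded_finite_part sum_X_subset nA_le_nX assms) (simp add: finite_part_def)
  from nX_le[OF assms(2)] obtain C where "C > 0" "\<And>f. f \<in> S \<Longrightarrow> nA \<theta> f + F f < \<infinity> \<Longrightarrow>
      f \<in> SX \<and> nX \<theta> f \<le> ennreal C * (nA \<theta> f + F f)" by blast
  then show "embedded (inter_space (finite_part S (nA \<theta>)) (finite_part S F)) (finite_part (SX) (nX \<theta>))"
    by (intro embedded_inter_finite_part[of C]) auto
qed

lemma same_space_zero: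
  "same_space (interp_space X0 X1 0 r a)
    (inter_space (interp_space A0 A1 0 r (a_sharp Chi0 Chi1 a 0)) (RL_space A0 A1 0 r (a \<circ> \<rho>) r0 b0 q0 a0))"
  unfolding interp_eqs(3)
proof (rule same_space_endpoint)
  show "lesssim (SX) nRL (nX 0)"
    using lesssim_subset[OF nRL_equiv(1) sum_X_subset] PMQ_le_nX(1) by (rule lesssim_trans)
  have sub: "lesssim S (nA 0) (\<lambda>f. nA 0 f + nRL f)" "lesssim S nRL (\<lambda>f. nA 0 f + nRL f)"
    by (auto intro!: lesssim_mono)
  show "lesssim S (\<lambda>f. P 0 f + M 0 f + Q 0 f) (\<lambda>f. nA 0 f + nRL f)"
    by (intro lesssim_add lesssim_trans[OF nRL_equiv(2) sub(2)] lesssim_trans[OF nA_equiv(2) sub(1)]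
        lesssim_trans[OF Q_le_M lesssim_trans[OF nA_equiv(2) sub(1)]]) simp_all
qed

lemma same_space_one:
  "same_space (interp_space X0 X1 1 r a)
    (inter_space (interp_space A0 A1 1 r (a_sharp Chi0 Chi1 a 1)) (LR_space A0 A1 1 r (a \<circ> \<rho>) r1 b1 q1 a1))"
  unfolding interp_eqs(4)
proof (rule same_space_endpoint)
  show "lesssim (SX) nLR (nX 1)"
    using lesssim_subset[OF nLR_equiv(1) sum_X_subset] PMQ_le_nX(3) by (rule lesssim_trans)
  have sub: "lesssim S (nA 1) (\<lambda>f. nA 1 f + nLR f)" "lesssim S nLR (\<lambda>f. nA 1 f + nLR f)"
    by (auto intro!: lesssim_mono)
  show "lesssim S (\<lambda>f. P 1 f + M 1 f + Q 1 f) (\<lambda>f. nA 1 f + nLR f)"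
    by (intro lesssim_add lesssim_trans[OF nLR_equiv(2) sub(2)] lesssim_trans[OF nA_equiv(2) sub(1)]
        lesssim_trans[OF P_le_M lesssim_trans[OF nA_equiv(2) sub(1)]]) simp_all
qed

end

theorem theorem36:
  fixes A0 A1 :: "'a::hausdorff_tvs qspace"
    and q0 r0 q1 r1 r :: ennreal
    and a a0 b0 a1 b1 :: "real \<Rightarrow> real"
    and \<chi>\<^sub>0 \<chi>\<^sub>1 :: "real \<Rightarrow> ennreal"
    and \<rho> :: "real \<Rightarrow> real"
    and X0 X1 :: "'a qspace"
  assumes "quasi_banach A0" and "quasi_banach A1"
    and "compatible_couple A0 A1"
    and "carr A0 \<inter> carr A1 \<noteq> {0}"
    and "0 < q1" and "0 < r1" and "a1 \<in> SV" and "b1 \<in> SV"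
    and "Lq r1 {1<..} (wt r1 b1) < \<infinity>"
    and "Lq r1 {0<..<1} (\<lambda>s. wt r1 b1 s * Lq q1 {0<..<s} (wt q1 a1)) < \<infinity>"
    and "\<chi>\<^sub>1 = chi1 r1 b1 q1 a1"
    and "0 < r" and "0 < r0" and "0 < q0" and "a \<in> SV" and "a0 \<in> SV" and "b0 \<in> SV"
    and "Lq r0 {0<..<1} (wt r0 b0) < \<infinity>"
    and "Lq r0 {1<..} (\<lambda>s. wt r0 b0 s * Lq q0 {s<..} (wt q0 a0)) < \<infinity>"
    and "\<chi>\<^sub>0 = chi0 r0 b0 q0 a0"
    and "\<rho> = rho \<chi>\<^sub>0 \<chi>\<^sub>1"
    and "X0 = R_space A0 A1 0 r0 b0 q0 a0"
    and "X1 = L_space A0 A1 1 r1 b1 q1 a1"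
  shows
    "(\<forall>\<theta>. 0 < \<theta> \<and> \<theta> < 1 \<longrightarrow>
        same_space (interp_space X0 X1 \<theta> r a)
                   (interp_space A0 A1 \<theta> r (a_sharp \<chi>\<^sub>0 \<chi>\<^sub>1 a \<theta>))) \<and>
     (Lq r {1<..} (wt r a) < \<infinity> \<longrightarrow>
        same_space (interp_space X0 X1 0 r a)
                   (inter_space (interp_space A0 A1 0 r (a_sharp \<chi>\<^sub>0 \<chi>\<^sub>1 a 0))
                                (RL_space A0 A1 0 r (a \<circ> \<rho>) r0 b0 q0 a0))) \<and>
     (Lq r {0<..<1} (wt r a) < \<infinity> \<longrightarrow>
        same_space (interp_space X0 X1 1 r a)
                   (inter_space (interp_space A0 A1 1 r (a_sharp \<chi>\<^sub>0 \<chi>\<^sub>1 a 1))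
                                (LR_space A0 A1 1 r (a \<circ> \<rho>) r1 b1 q1 a1)))"
proof -
  interpret interpolation_weight A0 A1 q0 r0 q1 r1 a0 b0 a1 b1 r a
    using assms SV_svf by unfold_locales (auto simp: quasi_banach_def)
  show ?thesis
    unfolding assms(11,20-23) using same_space_interior same_space_zero same_space_one by blast
qed

end
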